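(* Let $X$ be a finite set, $A=X$, let $H$ be a Hilbert space and $\phi:\mathcal{T}_X\to\mathcal{B}(H)$ be a linear map. Consider the conditions (i) $\phi$ is a unital completely positive map; (ii) $(\phi(e_{x,x',a,a'}))_{x,x',a,a'}\in M_{XA}\otimes\mathcal{B}(H)$ is a bistochastic operator matrix; (iii) there exists a unital $*$-representation $\pi:\mathcal{C}_X\to\mathcal{B}(H)$ such that $\phi=\pi|_{\mathcal{T}_X}$; and (i') $\phi$ is a completely positive map; (ii') $(\phi(e_{x,x',a,a'}))_{x,x',a,a'}\in (M_{XA}\otimes\mathcal{B}(H))^+$. Then (i)$\Leftrightarrow$(ii)$\Leftrightarrow$(iii) and (i')$\Leftrightarrow$(ii'). Thus the pair $(\mathcal{C}_X,\iota)$, where $\iota$ is the inclusion map of $\mathcal{T}_X$ into $\mathcal{C}_X$, is the universal C*-cover of $\mathcal{T}_X$. Moreover, if $(E_{x,x',a,a'})_{x,x',a,a'}$ is a bistochastic operator matrix acting on a Hilbert space $H$, then there exists a (unique) unital completely positive map $\phi:\mathcal{T}_X\to\mathcal{B}(H)$ such that $\phi(e_{x,x',a,a'})=E_{x,x',a,a'}$ for all $x,x',a,a'\in X$.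
   Context: $M_X$ is the algebra of complex $X\times X$ matrices with matrix units $\epsilon_{x,x'}$; $M_{XA}=M_X\otimes M_A$ with $A=X$. A family $(E_{x,x',a,a'})$ in $\mathcal{B}(H)$ is identified with $\sum\epsilon_{x,x'}\otimes\epsilon_{a,a'}\otimes E_{x,x',a,a'}\in M_{XA}\otimes\mathcal{B}(H)$. It is a bistochastic operator matrix (acting on $H$) if it is positive, $\sum_a E_{x,x',a,a}=\delta_{x,x'}I$ and $\sum_x E_{x,x,a,a'}=\delta_{a,a'}I$ for all $x,x',a,a'\in X$. Bi-isometries: a block operator matrix $V=(V_{a,x})_{a,x\in X}$, $V_{a,x}\in\mathcal{B}(H,K)$, is a bi-isometry if $V$ and its block transpose are both isometries $H^X\to K^X$, i.e. $\sum_a V_{a,x}^*V_{a,x'}=\delta_{x,x'}I$ and $\sum_x V_{a,x}^*V_{a',x}=\delta_{a,a'}I$. Definition of $\mathcal{C}_X$ and $\mathcal{T}_X$: let $(v_{a,x})_{a,x\in X}$ be the universal bi-isometry, i.e. the direct sum of representatives of all unitary equivalence classes of bi-isometries on Hilbert spaces of dimension bounded by a fixed sufficiently large infinite cardinal. Let $\mathcal{V}_X$ be the ternary ring of operators (closed under $(S,T,R)\mapsto ST^*R$) generated by the $v_{a,x}$. $\mathcal{C}_X$ is the right C*-algebra of $\mathcal{V}_X$, i.e. the closed linear span of $\mathcal{V}_X^*\mathcal{V}_X$ (equivalently, the unital C*-algebra generated by the products $v_{a,x}^*v_{a',x'}$). Set $e_{x,x',a,a'}=v_{a,x}^*v_{a',x'}$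 and $\mathcal{T}_X=\mathrm{span}\{e_{x,x',a,a'}:x,x',a,a'\in X\}$, an operator subsystem of $\mathcal{C}_X$. Universal C*-cover of an operator system $\mathcal{S}$: a pair $(C^*_u(\mathcal{S}),\iota)$ with $C_u^*(\mathcal{S})$ a unital C*-algebra and $\iota:\mathcal{S}\to C^*_u(\mathcal{S})$ a unital complete order embedding whose range generates $C^*_u(\mathcal{S})$, such that for every Hilbert space $K$ and unital completely positive $\phi:\mathcal{S}\to\mathcal{B}(K)$ there is a $*$-representation $\pi_\phi:C^*_u(\mathcal{S})\to\mathcal{B}(K)$ with $\pi_\phi\circ\iota=\phi$. *)

theory Defs
  imports "HOL-Analysis.Analysis" "HOL-Library.Infinite_Typeclass"
begin

section \<open>Complex Hilbert spaces\<close>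

class complex_vector = real_vector +
  fixes scaleC :: "complex \<Rightarrow> 'a \<Rightarrow> 'a"  (infixr \<open>*\<^sub>C\<close> 75)
  assumes scaleC_add_right: "c *\<^sub>C (x + y) = c *\<^sub>C x + c *\<^sub>C y"
    and scaleC_add_left: "(c + d) *\<^sub>C x = c *\<^sub>C x + d *\<^sub>C x"
    and scaleC_scaleC: "c *\<^sub>C (d *\<^sub>C x) = (c * d) *\<^sub>C x"
    and scaleC_of_real: "complex_of_real r *\<^sub>C x = r *\<^sub>R x"

global_interpretation complex_vector: vector_space "scaleC :: complex \<Rightarrow> 'a \<Rightarrow> 'a::complex_vector"
  defines csubspace = complex_vector.subspace
    and cspan = complex_vector.span
proof
  show "1 *\<^sub>C x = x" for x :: 'a
    using scaleC_of_real[of 1 x] by simp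
qed (simp_all add: scaleC_add_right scaleC_add_left scaleC_scaleC)

text \<open>The inner product is linear in the second variable. The last axiom contains positive
  definiteness, because \<^term>\<open>norm x\<close> is non-negative and vanishes only at \<open>0\<close>, while \<^const>\<open>sqrt\<close>
  is negative at negative arguments.\<close>

class complex_inner = complex_vector + real_normed_vector +
  fixes cinner :: "'a \<Rightarrow> 'a \<Rightarrow> complex"
  assumes cinner_commute: "cinner x y = cnj (cinner y x)"
    and cinner_add_right: "cinner x (y + z) = cinner x y + cinner x z"
    and cinner_scaleC_right: "cinner x (c *\<^sub>C y) = c * cinner x y"
    and norm_eq_sqrt_cinner: "norm x = sqrt (Re (cinner x x))"

class chilbert_space = complex_inner + banach

lemma cinner_add_left: "cinner (x + y) z = cinner x z + cinner y (z::'a::complex_inner)"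
  by (metis cinner_add_right cinner_commute complex_cnj_add)

lemma cinner_scaleC_left: "cinner (c *\<^sub>C x) y = cnj c * cinner x (y::'a::complex_inner)"
  by (metis cinner_scaleC_right cinner_commute complex_cnj_mult)

lemma cinner_zero_right [simp]: "cinner x (0::'a::complex_inner) = 0"
  using cinner_add_right[of x 0 0] by simp

lemma cinner_zero_left [simp]: "cinner (0::'a::complex_inner) x = 0"
  using cinner_add_left[of 0 0 x] by simp

lemma cinner_minus_right: "cinner x (- y) = - cinner x (y::'a::complex_inner)"
  using cinner_add_right[of x y "- y"] by (simp add: add_eq_0_iff)

lemma cinner_minus_left: "cinner (- x) y = - cinner x (y::'a::complex_inner)"
  using cinner_add_left[of x "- x" y] by (simp add: add_eq_0_iff)

lemma cinner_diff_right: "cinner x (y - z) = cinner x y - cinner x (z::'a::complex_inner)"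
  using cinner_add_right[of x y "- z"] by (simp add: cinner_minus_right)

lemma cinner_diff_left: "cinner (x - y) z = cinner x z - cinner y (z::'a::complex_inner)"
  using cinner_add_left[of x "- y" z] by (simp add: cinner_minus_left)

lemma cinner_sum_right: "cinner x (sum f A) = (\<Sum>i\<in>A. cinner x (f i :: 'a::complex_inner))"
  by (induction A rule: infinite_finite_induct) (auto simp: cinner_add_right)

lemma cinner_sum_left: "cinner (sum f A) x = (\<Sum>i\<in>A. cinner (f i :: 'a::complex_inner) x)"
  by (induction A rule: infinite_finite_induct) (auto simp: cinner_add_left)

lemma cinner_self: "cinner x x = complex_of_real ((norm (x::'a::complex_inner))\<^sup>2)"
proof -
  have "Re (cinner x x) \<ge> 0"
    using norm_eq_sqrt_cinner[of x] norm_ge_zero[of x] real_sqrt_ge_0_iff by metis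
  then have "(norm x)\<^sup>2 = Re (cinner x x)" by (simp add: norm_eq_sqrt_cinner)
  moreover have "Im (cinner x x) = 0"
    using arg_cong[OF cinner_commute[of x x], of Im] by simp
  ultimately show ?thesis by (simp add: complex_eq_iff)
qed

lemma cinner_eqI:
  assumes "\<And>z. cinner z x = cinner z (y::'a::complex_inner)"
  shows "x = y"
proof -
  have "cinner (x - y) (x - y) = 0" using assms by (simp add: cinner_diff_right)
  then show ?thesis by (simp add: cinner_self)
qed

lemma norm_scaleC: "norm (c *\<^sub>C (x::'a::complex_inner)) = cmod c * norm x"
proof -
  have "complex_of_real ((norm (c *\<^sub>C x))\<^sup>2) = cnj c * c * complex_of_real ((norm x)\<^sup>2)"
    by (simp only: cinner_self[symmetric] cinner_scaleC_left cinner_scaleC_right mult_ac)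
  also have "\<dots> = complex_of_real ((cmod c * norm x)\<^sup>2)"
    using complex_norm_square[of c] by (simp add: power_mult_distrib mult.commute[of "cnj c"])
  finally have "(norm (c *\<^sub>C x))\<^sup>2 = (cmod c * norm x)\<^sup>2" using of_real_eq_iff by blast
  then show ?thesis by (simp add: power2_eq_iff_nonneg)
qed

lemma norm_diff_square:
  "(norm (x - y))\<^sup>2 = (norm x)\<^sup>2 + (norm y)\<^sup>2 - 2 * Re (cinner x (y::'a::complex_inner))"
proof -
  have "complex_of_real ((norm (x - y))\<^sup>2) = cinner x x - cinner x y - cinner y x + cinner y y"
    by (simp only: cinner_self[symmetric] cinner_diff_left cinner_diff_right) simp
  then show ?thesis
    using cinner_commute[of y x] by (simp add: cinner_self complex_eq_iff)
qed

lemma norm_add_square: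
  "(norm (x + y))\<^sup>2 = (norm x)\<^sup>2 + (norm y)\<^sup>2 + 2 * Re (cinner x (y::'a::complex_inner))"
  using norm_diff_square[of x "- y"] by (simp add: cinner_minus_right)

lemma cauchy_schwarz_cinner: "cmod (cinner x y) \<le> norm x * norm (y::'a::complex_inner)"
proof (cases "y = 0")
  case False
  define c where "c = cinner y x / complex_of_real ((norm y)\<^sup>2)"
  have ny: "(norm y)\<^sup>2 > 0" using False by simp
  have cc: "cnj (cinner y x) = cinner x y" using cinner_commute[of x y] by simp
  have m: "cinner x y * cinner y x = complex_of_real ((cmod (cinner x y))\<^sup>2)"
    by (metis cc complex_norm_square complex_cnj_cnj)
  have "Re (cinner x (c *\<^sub>C y)) = (cmod (cinner x y))\<^sup>2 / (norm y)\<^sup>2"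
  proof -
    have "cinner x (c *\<^sub>C y) = complex_of_real ((cmod (cinner x y))\<^sup>2 / (norm y)\<^sup>2)"
      using m by (simp add: cinner_scaleC_right c_def mult.commute)
    then show ?thesis by simp
  qed
  moreover have "(norm (c *\<^sub>C y))\<^sup>2 = (cmod (cinner x y))\<^sup>2 / (norm y)\<^sup>2"
  proof -
    have "cmod (cinner y x) = cmod (cinner x y)" by (metis cc complex_mod_cnj)
    then show ?thesis using ny
      by (simp add: norm_scaleC c_def norm_divide power_mult_distrib power_divide field_simps power2_eq_square norm_mult)
  qed
  ultimately have "(norm (x - c *\<^sub>C y))\<^sup>2 = (norm x)\<^sup>2 - (cmod (cinner x y))\<^sup>2 / (norm y)\<^sup>2"
    by (simp add: norm_diff_square)
  then have "(cmod (cinner x y))\<^sup>2 / (norm y)\<^sup>2 \<le> (norm x)\<^sup>2"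
    by (metis diff_ge_0_iff_ge zero_le_power2)
  then have "(cmod (cinner x y))\<^sup>2 \<le> (norm x * norm y)\<^sup>2"
    using ny by (simp add: divide_simps power_mult_distrib mult.commute split: if_splits)
  then show ?thesis by (rule power2_le_imp_le) simp
qed simp

section \<open>The sequence spaces \<open>\<ell>\<^sup>2(I)\<close>\<close>

typedef 'i ell2 = "{f :: 'i \<Rightarrow> complex. (\<lambda>i. (cmod (f i))\<^sup>2) summable_on UNIV}"
  by (rule exI[of _ "\<lambda>_. 0"]) simp

setup_lifting type_definition_ell2

lemma square_summable_bound:
  assumes "(\<lambda>i. (cmod (f i))\<^sup>2) summable_on UNIV" "finite F"
  shows "L2_set (\<lambda>i. cmod (f i)) F \<le> sqrt (\<Sum>\<^sub>\<infinity>i. (cmod (f i))\<^sup>2)"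
  unfolding L2_set_def
  by (intro real_sqrt_le_mono finite_sum_le_infsum) (use assms in auto)

lemma square_summable_if_bounded:
  assumes "\<And>F. finite F \<Longrightarrow> L2_set (\<lambda>i. cmod (f i)) F \<le> B"
  shows "(\<lambda>i. (cmod (f i))\<^sup>2) summable_on UNIV" "sqrt (\<Sum>\<^sub>\<infinity>i. (cmod (f i))\<^sup>2) \<le> B"
proof -
  have B: "B \<ge> 0" using assms[of "{}"] by simp
  have le: "(\<Sum>i\<in>F. (cmod (f i))\<^sup>2) \<le> B\<^sup>2" if "finite F" for F
    using assms[OF that] unfolding L2_set_def by (simp add: real_sqrt_le_iff sqrt_le_D)
  show s: "(\<lambda>i. (cmod (f i))\<^sup>2) summable_on UNIV"
    by (rule nonneg_bounded_partial_sums_imp_summable_on[where C = "B\<^sup>2"])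
      (auto intro!: eventually_finite_subsets_at_top_weakI le)
  have "(\<Sum>\<^sub>\<infinity>i. (cmod (f i))\<^sup>2) \<le> B\<^sup>2"
    by (rule infsum_le_finite_sums[OF s]) (use le in auto)
  then show "sqrt (\<Sum>\<^sub>\<infinity>i. (cmod (f i))\<^sup>2) \<le> B" using B real_le_lsqrt by simp
qed

lemma square_summable_add:
  assumes f: "(\<lambda>i. (cmod (f i))\<^sup>2) summable_on UNIV" and g: "(\<lambda>i. (cmod (g i))\<^sup>2) summable_on UNIV"
  shows "(\<lambda>i. (cmod (f i + g i))\<^sup>2) summable_on UNIV"
    "sqrt (\<Sum>\<^sub>\<infinity>i. (cmod (f i + g i))\<^sup>2) \<le> sqrt (\<Sum>\<^sub>\<infinity>i. (cmod (f i))\<^sup>2) + sqrt (\<Sum>\<^sub>\<infinity>i. (cmod (g i))\<^sup>2)"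
proof -
  have *: "L2_set (\<lambda>i. cmod (f i + g i)) F \<le> sqrt (\<Sum>\<^sub>\<infinity>i. (cmod (f i))\<^sup>2) + sqrt (\<Sum>\<^sub>\<infinity>i. (cmod (g i))\<^sup>2)"
    if "finite F" for F
  proof -
    have "L2_set (\<lambda>i. cmod (f i + g i)) F \<le> L2_set (\<lambda>i. cmod (f i) + cmod (g i)) F"
      by (rule L2_set_mono) (auto intro: norm_triangle_ineq)
    also have "\<dots> \<le> L2_set (\<lambda>i. cmod (f i)) F + L2_set (\<lambda>i. cmod (g i)) F"
      by (rule L2_set_triangle_ineq)
    finally show ?thesis using square_summable_bound[OF f that] square_summable_bound[OF g that] by simp
  qed
  show "(\<lambda>i. (cmod (f i + g i))\<^sup>2) summable_on UNIV"
    "sqrt (\<Sum>\<^sub>\<infinity>i. (cmod (f i + g i))\<^sup>2) \<le> sqrt (\<Sum>\<^sub>\<infinity>i. (cmod (f i))\<^sup>2) + sqrt (\<Sum>\<^sub>\<infinity>i. (cmod (g i))\<^sup>2)"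
    using square_summable_if_bounded[OF *] by blast+
qed

lemma square_summable_scale:
  assumes f: "(\<lambda>i. (cmod (f i))\<^sup>2) summable_on UNIV"
  shows "(\<lambda>i. (cmod (c * f i))\<^sup>2) summable_on UNIV"
  using summable_on_cmult_right[OF f, of "(cmod c)\<^sup>2"] by (simp add: norm_mult power_mult_distrib)

lemma square_summable_product:
  assumes f: "(\<lambda>i. (cmod (f i))\<^sup>2) summable_on UNIV" and g: "(\<lambda>i. (cmod (g i))\<^sup>2) summable_on UNIV"
  shows "(\<lambda>i. cnj (f i) * g i) summable_on UNIV"
proof -
  have "(\<lambda>i. (cmod (f i))\<^sup>2 + (cmod (g i))\<^sup>2) summable_on UNIV" by (rule summable_on_add[OF f g])
  then have "(\<lambda>i. cmod (cnj (f i) * g i)) summable_on UNIV"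
  proof (rule summable_on_comparison_test)
    fix i
    have "0 \<le> (cmod (f i) - cmod (g i))\<^sup>2 + (cmod (f i))\<^sup>2 + (cmod (g i))\<^sup>2" by simp
    then have "2 * (cmod (f i) * cmod (g i)) \<le> 2 * ((cmod (f i))\<^sup>2 + (cmod (g i))\<^sup>2)"
      by (simp add: power2_diff)
    then show "cmod (cnj (f i) * g i) \<le> (cmod (f i))\<^sup>2 + (cmod (g i))\<^sup>2"
      by (simp add: norm_mult)
  qed auto
  then show ?thesis by (rule abs_summable_summable)
qed

instantiation ell2 :: (type) complex_inner
begin

lift_definition zero_ell2 :: "'a ell2" is "\<lambda>_. 0" by simp
lift_definition plus_ell2 :: "'a ell2 \<Rightarrow> 'a ell2 \<Rightarrow> 'a ell2" is "\<lambda>f g i. f i + g i"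
  by (rule square_summable_add)
lift_definition uminus_ell2 :: "'a ell2 \<Rightarrow> 'a ell2" is "\<lambda>f i. - f i" by simp
lift_definition minus_ell2 :: "'a ell2 \<Rightarrow> 'a ell2 \<Rightarrow> 'a ell2" is "\<lambda>f g i. f i - g i"
  using square_summable_add(1)[where g = "\<lambda>i. - g i" for g] by simp
lift_definition scaleC_ell2 :: "complex \<Rightarrow> 'a ell2 \<Rightarrow> 'a ell2" is "\<lambda>c f i. c * f i"
  by (rule square_summable_scale)
lift_definition scaleR_ell2 :: "real \<Rightarrow> 'a ell2 \<Rightarrow> 'a ell2" is "\<lambda>r f i. complex_of_real r * f i"
  by (rule square_summable_scale)
lift_definition norm_ell2 :: "'a ell2 \<Rightarrow> real" is "\<lambda>f. sqrt (\<Sum>\<^sub>\<infinity>i. (cmod (f i))\<^sup>2)" .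
lift_definition cinner_ell2 :: "'a ell2 \<Rightarrow> 'a ell2 \<Rightarrow> complex" is "\<lambda>f g. \<Sum>\<^sub>\<infinity>i. cnj (f i) * g i" .
definition dist_ell2 :: "'a ell2 \<Rightarrow> 'a ell2 \<Rightarrow> real" where "dist_ell2 f g = norm (f - g)"
definition sgn_ell2 :: "'a ell2 \<Rightarrow> 'a ell2" where "sgn_ell2 f = scaleR (inverse (norm f)) f"
definition uniformity_ell2 :: "('a ell2 \<times> 'a ell2) filter"
  where "uniformity_ell2 = (INF e\<in>{0 <..}. principal {(f, g). dist f g < e})"
definition open_ell2 :: "'a ell2 set \<Rightarrow> bool"
  where "open_ell2 S = (\<forall>x\<in>S. \<forall>\<^sub>F (x', y) in uniformity. x' = x \<longrightarrow> y \<in> S)"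

instance
proof
  fix f g h :: "'a ell2" and c d :: complex and r s :: real
  show "f + g + h = f + (g + h)" "f + g = g + f" "0 + f = f" "- f + f = 0" "f - g = f + - g"
    "r *\<^sub>R (f + g) = r *\<^sub>R f + r *\<^sub>R g" "(r + s) *\<^sub>R f = r *\<^sub>R f + s *\<^sub>R f"
    "r *\<^sub>R s *\<^sub>R f = (r * s) *\<^sub>R f" "1 *\<^sub>R f = f"
    "c *\<^sub>C (f + g) = c *\<^sub>C f + c *\<^sub>C g" "(c + d) *\<^sub>C f = c *\<^sub>C f + d *\<^sub>C f"
    "c *\<^sub>C d *\<^sub>C f = (c * d) *\<^sub>C f" "complex_of_real r *\<^sub>C f = r *\<^sub>R f"
    by (transfer; simp add: fun_eq_iff algebra_simps)+
  show "dist f g = norm (f - g)" by (rule dist_ell2_def)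
  show "sgn f = inverse (norm f) *\<^sub>R f" by (rule sgn_ell2_def)
  show "uniformity = (INF e\<in>{0 <..}. principal {(f, g :: 'a ell2). dist f g < e})"
    by (rule uniformity_ell2_def)
  show "open U = (\<forall>x\<in>U. \<forall>\<^sub>F (x', y) in uniformity. x' = x \<longrightarrow> y \<in> U)" for U :: "'a ell2 set"
    by (rule open_ell2_def)
  show "(norm f = 0) = (f = 0)"
  proof transfer
    fix f :: "'a \<Rightarrow> complex"
    assume f: "(\<lambda>i. (cmod (f i))\<^sup>2) summable_on UNIV"
    show "(sqrt (\<Sum>\<^sub>\<infinity>i. (cmod (f i))\<^sup>2) = 0) = (f = (\<lambda>_. 0))"
    proof
      assume "sqrt (\<Sum>\<^sub>\<infinity>i. (cmod (f i))\<^sup>2) = 0"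
      then have "(\<Sum>\<^sub>\<infinity>i. (cmod (f i))\<^sup>2) \<le> 0" by simp
      then have "(cmod (f i))\<^sup>2 = 0" for i
        using nonneg_infsum_le_0D[OF _ f, of i] by simp
      then show "f = (\<lambda>_. 0)" by (simp add: fun_eq_iff)
    qed simp
  qed
  show "norm (f + g) \<le> norm f + norm g" by transfer (rule square_summable_add(2))
  show "norm (r *\<^sub>R f) = \<bar>r\<bar> * norm f"
    by transfer (simp add: norm_mult power_mult_distrib infsum_cmult_right' real_sqrt_mult)
  show "cinner f g = cnj (cinner g f)"
    by transfer (simp add: infsum_cnj[symmetric] mult.commute)
  show "cinner f (g + h) = cinner f g + cinner f h"
    by transfer (simp add: distrib_left infsum_add square_summable_product)
  show "cinner f (c *\<^sub>C g) = c * cinner f g"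
    by transfer (simp add: infsum_cmult_right'[symmetric] mult.left_commute)
  show "norm f = sqrt (Re (cinner f f))"
  proof transfer
    fix f :: "'a \<Rightarrow> complex"
    assume f: "(\<lambda>i. (cmod (f i))\<^sup>2) summable_on UNIV"
    show "sqrt (\<Sum>\<^sub>\<infinity>i. (cmod (f i))\<^sup>2) = sqrt (Re (\<Sum>\<^sub>\<infinity>i. cnj (f i) * f i))"
    proof -
      have "Re (cnj (f i) * f i) = (cmod (f i))\<^sup>2" for i
        by (simp only: cmod_power2) (simp add: power2_eq_square)
      then show ?thesis using infsum_Re[OF square_summable_product[OF f f]] by simp
    qed
  qed
qed

end

lemma cmod_Rep_ell2_le: "cmod (Rep_ell2 f i) \<le> norm f"
  by transfer (use square_summable_bound[where F = "{i}" for i] in force)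

instance ell2 :: (type) chilbert_space
proof
  fix X :: "nat \<Rightarrow> 'a ell2"
  assume X: "Cauchy X"
  have "Cauchy (\<lambda>n. Rep_ell2 (X n) i)" for i
  proof (rule metric_CauchyI)
    fix e :: real assume "e > 0"
    then obtain N where N: "\<And>m n. m \<ge> N \<Longrightarrow> n \<ge> N \<Longrightarrow> norm (X m - X n) < e"
      using X unfolding Cauchy_def dist_norm by metis
    have "cmod (Rep_ell2 (X m) i - Rep_ell2 (X n) i) \<le> norm (X m - X n)" for m n
      using cmod_Rep_ell2_le[of "X m - X n" i] by (simp add: minus_ell2.rep_eq)
    then show "\<exists>M. \<forall>m\<ge>M. \<forall>n\<ge>M. dist (Rep_ell2 (X m) i) (Rep_ell2 (X n) i) < e"
      using N unfolding dist_norm by (meson order_le_less_trans)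
  qed
  then have "\<exists>l. (\<lambda>n. Rep_ell2 (X n) i) \<longlonglongrightarrow> l" for i
    using Cauchy_convergent convergent_def by blast
  then obtain g where g: "\<And>i. (\<lambda>n. Rep_ell2 (X n) i) \<longlonglongrightarrow> g i" by metis
  have bd: "L2_set (\<lambda>i. cmod (Rep_ell2 (X n) i - g i)) F \<le> e"
    if N: "\<And>m. m \<ge> N \<Longrightarrow> norm (X n - X m) \<le> e" and F: "finite F" for n N e F
  proof -
    have "(\<lambda>m. L2_set (\<lambda>i. cmod (Rep_ell2 (X n) i - Rep_ell2 (X m) i)) F)
        \<longlonglongrightarrow> L2_set (\<lambda>i. cmod (Rep_ell2 (X n) i - g i)) F"
      unfolding L2_set_def by (intro tendsto_intros g)
    moreover have "L2_set (\<lambda>i. cmod (Rep_ell2 (X n) i - Rep_ell2 (X m) i)) F \<le> e" if "m \<ge> N" for m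
    proof -
      have "L2_set (\<lambda>i. cmod (Rep_ell2 (X n - X m) i)) F \<le> norm (X n - X m)"
        unfolding norm_ell2.rep_eq
        by (rule square_summable_bound[OF _ F]) (use Rep_ell2[of "X n - X m"] in simp)
      with N[OF that] show ?thesis by (simp add: minus_ell2.rep_eq)
    qed
    ultimately show ?thesis by (intro LIMSEQ_le_const2) auto
  qed
  have ex: "\<exists>N. \<forall>n\<ge>N. \<forall>m\<ge>N. norm (X n - X m) \<le> e" if "e > 0" for e
    using X that unfolding Cauchy_def dist_norm by (meson less_imp_le)
  obtain N where N: "\<And>n m. n \<ge> N \<Longrightarrow> m \<ge> N \<Longrightarrow> norm (X n - X m) \<le> 1" using ex[of 1] by auto
  have "(\<lambda>i. (cmod (Rep_ell2 (X N) i - g i))\<^sup>2) summable_on UNIV"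
    by (rule square_summable_if_bounded(1)[OF bd[where N = N and e = 1]]) (use N in auto)
  then have "(\<lambda>i. (cmod (- 1 * (Rep_ell2 (X N) i - g i) + Rep_ell2 (X N) i))\<^sup>2) summable_on UNIV"
    by (intro square_summable_add square_summable_scale) (use Rep_ell2[of "X N"] in auto)
  then have gs: "(\<lambda>i. (cmod (g i))\<^sup>2) summable_on UNIV" by simp
  define G where "G = Abs_ell2 g"
  have RG: "Rep_ell2 G = g" using gs by (simp add: G_def Abs_ell2_inverse)
  have "X \<longlonglongrightarrow> G"
  proof (rule metric_LIMSEQ_I)
    fix e :: real assume e: "e > 0"
    then obtain M where M: "\<And>n m. n \<ge> M \<Longrightarrow> m \<ge> M \<Longrightarrow> norm (X n - X m) \<le> e / 2"
      using ex[of "e / 2"] by auto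
    have "norm (X n - G) \<le> e / 2" if "n \<ge> M" for n
      unfolding norm_ell2.rep_eq minus_ell2.rep_eq RG
      by (rule square_summable_if_bounded(2)[OF bd[where N = M]]) (use M that in auto)
    then show "\<exists>M. \<forall>n\<ge>M. dist (X n) G < e" using e unfolding dist_norm by (intro exI[of _ M]) force
  qed
  then show "convergent X" by (auto simp: convergent_def)
qed

section \<open>Bounded operators\<close>

typedef (overloaded) ('a, 'b) cblinfun =
  "{T :: 'a::complex_inner \<Rightarrow> 'b::complex_inner. bounded_linear T \<and> (\<forall>c x. T (c *\<^sub>C x) = c *\<^sub>C T x)}"
  morphisms cblinfun_apply Abs_cblinfun
  by (rule exI[of _ "\<lambda>_. 0"]) simp

setup_lifting type_definition_cblinfun

notation cblinfun_apply (infixr \<open>*\<^sub>V\<close> 70)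

lemma complex_vector_simps [simp]:
  "c *\<^sub>C (0::'a::complex_vector) = 0" "0 *\<^sub>C (x::'a) = 0" "1 *\<^sub>C (x::'a) = x"
  "c *\<^sub>C (- x) = - (c *\<^sub>C x)"
  by simp_all

lemma scaleC_scaleR_commute: "c *\<^sub>C (r *\<^sub>R x) = r *\<^sub>R (c *\<^sub>C (x::'a::complex_vector))"
  by (simp add: scaleC_of_real[symmetric] scaleC_scaleC mult.commute)

lemma bounded_linear_scaleC: "bounded_linear (\<lambda>x. c *\<^sub>C (x::'a::complex_inner))"
  by (rule bounded_linear_intro[where K = "cmod c"])
    (simp_all add: scaleC_add_right scaleC_scaleR_commute norm_scaleC)

instantiation cblinfun :: (complex_inner, complex_inner) "{complex_vector, real_normed_vector}"
begin

lift_definition zero_cblinfun :: "('a, 'b) cblinfun" is "\<lambda>_. 0" by simp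
lift_definition plus_cblinfun :: "('a, 'b) cblinfun \<Rightarrow> ('a, 'b) cblinfun \<Rightarrow> ('a, 'b) cblinfun"
  is "\<lambda>S T x. S x + T x" by (simp add: bounded_linear_add scaleC_add_right)
lift_definition uminus_cblinfun :: "('a, 'b) cblinfun \<Rightarrow> ('a, 'b) cblinfun"
  is "\<lambda>T x. - T x" by (simp add: bounded_linear_minus)
lift_definition minus_cblinfun :: "('a, 'b) cblinfun \<Rightarrow> ('a, 'b) cblinfun \<Rightarrow> ('a, 'b) cblinfun"
  is "\<lambda>S T x. S x - T x" by (simp add: bounded_linear_sub complex_vector.scale_right_diff_distrib)
lift_definition scaleC_cblinfun :: "complex \<Rightarrow> ('a, 'b) cblinfun \<Rightarrow> ('a, 'b) cblinfun"
  is "\<lambda>c T x. c *\<^sub>C T x"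
  by (simp add: bounded_linear_compose[OF bounded_linear_scaleC] scaleC_scaleC mult.commute)
lift_definition scaleR_cblinfun :: "real \<Rightarrow> ('a, 'b) cblinfun \<Rightarrow> ('a, 'b) cblinfun"
  is "\<lambda>r T x. r *\<^sub>R T x"
  by (simp add: bounded_linear_compose[OF bounded_linear_scaleR_right] scaleC_scaleR_commute)
lift_definition norm_cblinfun :: "('a, 'b) cblinfun \<Rightarrow> real" is onorm .
definition dist_cblinfun :: "('a, 'b) cblinfun \<Rightarrow> ('a, 'b) cblinfun \<Rightarrow> real"
  where "dist_cblinfun S T = norm (S - T)"
definition sgn_cblinfun :: "('a, 'b) cblinfun \<Rightarrow> ('a, 'b) cblinfun"
  where "sgn_cblinfun T = scaleR (inverse (norm T)) T"
definition uniformity_cblinfun :: "(('a, 'b) cblinfun \<times> ('a, 'b) cblinfun) filter"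
  where "uniformity_cblinfun = (INF e\<in>{0 <..}. principal {(S, T). dist S T < e})"
definition open_cblinfun :: "('a, 'b) cblinfun set \<Rightarrow> bool"
  where "open_cblinfun U = (\<forall>S\<in>U. \<forall>\<^sub>F (S', T) in uniformity. S' = S \<longrightarrow> T \<in> U)"

instance
proof
  fix R S T :: "('a, 'b) cblinfun" and c d :: complex and r s :: real
  show "R + S + T = R + (S + T)" "R + S = S + R" "0 + R = R" "- R + R = 0" "R - S = R + - S"
    "r *\<^sub>R (R + S) = r *\<^sub>R R + r *\<^sub>R S" "(r + s) *\<^sub>R R = r *\<^sub>R R + s *\<^sub>R R"
    "r *\<^sub>R s *\<^sub>R R = (r * s) *\<^sub>R R" "1 *\<^sub>R R = R"
    "c *\<^sub>C (R + S) = c *\<^sub>C R + c *\<^sub>C S" "(c + d) *\<^sub>C R = c *\<^sub>C R + d *\<^sub>C R"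
    "c *\<^sub>C d *\<^sub>C R = (c * d) *\<^sub>C R" "complex_of_real r *\<^sub>C R = r *\<^sub>R R"
    by (transfer; simp add: fun_eq_iff scaleR_add_right scaleR_add_left scaleC_add_right
        scaleC_add_left scaleC_scaleC scaleC_of_real)+
  show "dist R S = norm (R - S)" by (rule dist_cblinfun_def)
  show "sgn R = inverse (norm R) *\<^sub>R R" by (rule sgn_cblinfun_def)
  show "uniformity = (INF e\<in>{0 <..}. principal {(S, T :: ('a, 'b) cblinfun). dist S T < e})"
    by (rule uniformity_cblinfun_def)
  show "open U = (\<forall>S\<in>U. \<forall>\<^sub>F (S', T) in uniformity. S' = S \<longrightarrow> T \<in> U)"
    for U :: "('a, 'b) cblinfun set"
    by (rule open_cblinfun_def)
  show "(norm R = 0) = (R = 0)" by transfer (simp add: onorm_eq_0 fun_eq_iff)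
  show "norm (R + S) \<le> norm R + norm S" by transfer (simp add: onorm_triangle)
  show "norm (r *\<^sub>R R) = \<bar>r\<bar> * norm R" by transfer (simp add: onorm_scaleR)
qed

end

lift_definition cid :: "('a::complex_inner, 'a) cblinfun" is "\<lambda>x. x" by simp

lift_definition ccompose ::
  "('b::complex_inner, 'c::complex_inner) cblinfun \<Rightarrow> ('a::complex_inner, 'b) cblinfun \<Rightarrow> ('a, 'c) cblinfun"
  (infixl \<open>o\<^sub>C\<close> 70)
  is "\<lambda>S T x. S (T x)" by (simp add: bounded_linear_compose)

definition adj :: "('a::chilbert_space, 'b::chilbert_space) cblinfun \<Rightarrow> ('b, 'a) cblinfun"
  where "adj T = (THE S. \<forall>x y. cinner (S *\<^sub>V y) x = cinner y (T *\<^sub>V x))"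

lemma cblinfun_eqI: "(\<And>x. S *\<^sub>V x = T *\<^sub>V x) \<Longrightarrow> S = T"
  by transfer auto

lemma cblinfun_apply_simps [simp]:
  "0 *\<^sub>V x = 0" "(S + T) *\<^sub>V x = S *\<^sub>V x + T *\<^sub>V x" "(- T) *\<^sub>V x = - (T *\<^sub>V x)"
  "(S - T) *\<^sub>V x = S *\<^sub>V x - T *\<^sub>V x" "(c *\<^sub>C T) *\<^sub>V x = c *\<^sub>C (T *\<^sub>V x)"
  "cid *\<^sub>V y = y" "(R o\<^sub>C S) *\<^sub>V x = R *\<^sub>V S *\<^sub>V x"
  by (transfer; simp)+

lemma cblinfun_sum_apply: "sum T A *\<^sub>V x = (\<Sum>i\<in>A. T i *\<^sub>V x)"
  by (induction A rule: infinite_finite_induct) auto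

lemma cblinfun_apply_linear:
  "T *\<^sub>V (x + y) = T *\<^sub>V x + T *\<^sub>V y" "T *\<^sub>V (x - y) = T *\<^sub>V x - T *\<^sub>V y"
  "T *\<^sub>V (c *\<^sub>C x) = c *\<^sub>C (T *\<^sub>V x)" "T *\<^sub>V 0 = 0"
  by (transfer; simp add: linear_simps)+

lemma norm_cblinfun: "norm (T *\<^sub>V x) \<le> norm T * norm x"
  by transfer (simp add: onorm)

lemma riesz:
  fixes F :: "'a::chilbert_space \<Rightarrow> complex"
  assumes add: "\<And>x y. F (x + y) = F x + F y" and scale: "\<And>c x. F (c *\<^sub>C x) = c * F x"
    and bound: "\<And>x. cmod (F x) \<le> B * norm x"
  obtains z where "\<And>x. F x = cinner z x"
proof -
  define J where "J x = (norm x)\<^sup>2 - 2 * Re (F x)" for x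
  have lower: "- B\<^sup>2 \<le> J x" for x
  proof -
    have "Re (F x) \<le> B * norm x" using bound[of x] complex_Re_le_cmod[of "F x"] by linarith
    moreover have "0 \<le> (norm x - B)\<^sup>2" by simp
    ultimately show ?thesis by (simp add: J_def power2_diff mult.commute)
  qed
  define m where "m = Inf (range J)"
  have bdd: "bdd_below (range J)" by (rule bdd_belowI[of _ "- B\<^sup>2"]) (use lower in auto)
  have mJ: "m \<le> J x" for x unfolding m_def by (rule cInf_lower[OF _ bdd]) simp
  have FR: "F (r *\<^sub>R x) = of_real r * F x" for r x
    using scale[of "of_real r" x] by (simp add: scaleC_of_real)
  have dist: "(norm (x - y))\<^sup>2 \<le> 2 * J x + 2 * J y - 4 * m" for x y
  proof -
    have h: "J ((1/2) *\<^sub>R (x + y)) = (norm (x + y))\<^sup>2 / 4 - Re (F x) - Re (F y)"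
      unfolding J_def FR add by (simp add: power_divide add_divide_distrib)
    have arith: "p + q - 2 * r \<le> 2 * (p - 2 * u) + 2 * (q - 2 * v) - 4 * m"
      if "m \<le> (p + q + 2 * r) / 4 - u - v" for p q r u v :: real
      using that by (simp add: field_simps)
    show ?thesis
      using mJ[of "(1/2) *\<^sub>R (x + y)"] unfolding h
      unfolding J_def norm_add_square norm_diff_square by (rule arith)
  qed
  have "\<exists>x. J x < m + inverse (real (Suc n))" for n
  proof -
    have "Inf (range J) < m + inverse (real (Suc n))" by (simp add: m_def)
    then show ?thesis using cInf_less_iff[OF _ bdd] by auto
  qed
  then obtain X where X: "\<And>n. J (X n) < m + inverse (real (Suc n))" by metis
  have "Cauchy X"
  proof (rule metric_CauchyI)
    fix e :: real assume e: "e > 0"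
    then obtain N where N: "inverse (real (Suc N)) < e\<^sup>2 / 4"
      using reals_Archimedean[of "e\<^sup>2 / 4"] by auto
    have "dist (X k) (X n) < e" if "k \<ge> N" "n \<ge> N" for k n
    proof -
      have "inverse (real (Suc k)) \<le> inverse (real (Suc N))" "inverse (real (Suc n)) \<le> inverse (real (Suc N))"
        using that by (simp_all add: le_imp_inverse_le)
      then have "(norm (X k - X n))\<^sup>2 < e\<^sup>2"
        using dist[of "X k" "X n"] X[of k] X[of n] N by linarith
      then show ?thesis using e by (simp add: dist_norm power_less_imp_less_base)
    qed
    then show "\<exists>M. \<forall>k\<ge>M. \<forall>n\<ge>M. dist (X k) (X n) < e" by blast
  qed
  then obtain z where z: "X \<longlonglongrightarrow> z" using Cauchy_convergent convergent_def by blast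
  have F: "bounded_linear F"
    by (rule bounded_linear_intro[where K = B])
      (simp_all add: add FR bound scaleR_conv_of_real mult.commute)
  have "(\<lambda>n. J (X n)) \<longlonglongrightarrow> J z"
    unfolding J_def by (intro tendsto_intros z bounded_linear.tendsto[OF F])
  moreover have "(\<lambda>n. m + inverse (real (Suc n))) \<longlonglongrightarrow> m + 0"
    by (intro tendsto_intros LIMSEQ_inverse_real_of_nat)
  ultimately have Jz: "J z \<le> m"
    using LIMSEQ_le[of "\<lambda>n. J (X n)" "J z" "\<lambda>n. m + inverse (real (Suc n))" "m + 0"] X
    by (metis add_0_right less_imp_le)
  have re: "Re (F x) = Re (cinner z x)" for x
  proof (rule ccontr)
    assume ne: "Re (F x) \<noteq> Re (cinner z x)"
    define b where "b = Re (F x) - Re (cinner z x)"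
    define t where "t = b / ((norm x)\<^sup>2 + 1)"
    have pos: "(norm x)\<^sup>2 + 1 > 0" by (simp add: add_nonneg_pos)
    have "J (z + t *\<^sub>R x) = J z + t\<^sup>2 * (norm x)\<^sup>2 - 2 * t * b"
      by (simp add: J_def add scale norm_add_square b_def scaleC_of_real[symmetric] cinner_scaleC_right
          norm_scaleC power_mult_distrib algebra_simps)
    with Jz mJ[of "z + t *\<^sub>R x"] have "2 * t * b \<le> t\<^sup>2 * (norm x)\<^sup>2" by linarith
    also have "\<dots> \<le> t\<^sup>2 * ((norm x)\<^sup>2 + 1)" by (simp add: mult_left_mono)
    also have "\<dots> = t * b" using pos by (simp add: t_def power2_eq_square)
    finally have "t * b \<le> 0" by (simp add: mult.commute)
    moreover have "t * b = b\<^sup>2 / ((norm x)\<^sup>2 + 1)" by (simp add: t_def power2_eq_square)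
    moreover have "b\<^sup>2 / ((norm x)\<^sup>2 + 1) > 0" using ne pos by (simp add: b_def)
    ultimately show False by linarith
  qed
  have "F x = cinner z x" for x
  proof (rule complex_eqI)
    show "Im (F x) = Im (cinner z x)"
      using re[of "\<i> *\<^sub>C x"] by (simp add: scale cinner_scaleC_right)
  qed (rule re)
  then show thesis using that by blast
qed

lemma adj_exists:
  fixes T :: "('a::chilbert_space, 'b::chilbert_space) cblinfun"
  shows "\<exists>S. \<forall>x y. cinner (S *\<^sub>V y) x = cinner y (T *\<^sub>V x)"
proof -
  have "\<exists>z. \<forall>x. cinner y (T *\<^sub>V x) = cinner z x" for y
  proof (rule riesz[where F = "\<lambda>x. cinner y (T *\<^sub>V x)" and B = "norm y * norm T"])
    fix x
    have "cmod (cinner y (T *\<^sub>V x)) \<le> norm y * norm (T *\<^sub>V x)" by (rule cauchy_schwarz_cinner)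
    also have "\<dots> \<le> norm y * (norm T * norm x)" by (intro mult_left_mono norm_cblinfun) simp
    finally show "cmod (cinner y (T *\<^sub>V x)) \<le> norm y * norm T * norm x" by (simp add: mult.assoc)
  qed (auto simp: cblinfun_apply_linear cinner_add_right cinner_scaleC_right)
  then obtain S where S: "\<And>x y. cinner y (T *\<^sub>V x) = cinner (S y) x" by metis
  have eqI: "u = v" if "\<And>x. cinner u x = cinner v x" for u v :: 'a
    by (rule cinner_eqI) (metis that cinner_commute)
  have add: "S (u + v) = S u + S v" for u v
    by (rule eqI) (simp add: S[symmetric] cinner_add_left)
  have scale: "S (c *\<^sub>C u) = c *\<^sub>C S u" for c u
    by (rule eqI) (simp add: S[symmetric] cinner_scaleC_left)
  have "norm (S y) \<le> norm y * norm T" for y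
  proof (cases "S y = 0")
    case False
    have "(norm (S y))\<^sup>2 = cmod (cinner y (T *\<^sub>V S y))" by (simp add: S cinner_self norm_power)
    also have "\<dots> \<le> norm y * norm (T *\<^sub>V S y)" by (rule cauchy_schwarz_cinner)
    also have "\<dots> \<le> norm y * (norm T * norm (S y))" by (intro mult_left_mono norm_cblinfun) simp
    finally show ?thesis using False by (simp add: power2_eq_square)
  qed simp
  then have "bounded_linear S"
    by (intro bounded_linear_intro[where K = "norm T"])
      (simp_all add: add scaleC_of_real[symmetric] scale)
  then have "cblinfun_apply (Abs_cblinfun S) = S" by (simp add: Abs_cblinfun_inverse scale)
  then show ?thesis using S by metis
qed

lemma cinner_adj_left: "cinner (adj T *\<^sub>V y) x = cinner y (T *\<^sub>V x)"
proof -
  have ex1: "\<exists>!S. \<forall>x y. cinner (S *\<^sub>V y) x = cinner y (T *\<^sub>V x)"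
  proof (rule ex_ex1I[OF adj_exists])
    fix S R :: "('b, 'a) cblinfun"
    assume "\<forall>x y. cinner (S *\<^sub>V y) x = cinner y (T *\<^sub>V x)" "\<forall>x y. cinner (R *\<^sub>V y) x = cinner y (T *\<^sub>V x)"
    then have "cinner x (S *\<^sub>V y) = cinner x (R *\<^sub>V y)" for x y
      by (metis cinner_commute)
    then show "S = R" by (intro cblinfun_eqI cinner_eqI)
  qed
  show ?thesis using theI'[OF ex1] unfolding adj_def by blast
qed

lemma cinner_adj_right: "cinner x (adj T *\<^sub>V y) = cinner (T *\<^sub>V x) y"
  by (metis cinner_adj_left cinner_commute)

lemma adj_eqI:
  assumes "\<And>x y. cinner (S *\<^sub>V y) x = cinner y (T *\<^sub>V x)"
  shows "adj T = S"
  by (intro cblinfun_eqI cinner_eqI) (metis assms cinner_adj_left cinner_commute)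

lemma adj_adj [simp]: "adj (adj T) = T"
  by (rule adj_eqI) (simp add: cinner_adj_right)

lemma adj_ccompose: "adj (S o\<^sub>C T) = adj T o\<^sub>C adj S"
  by (rule adj_eqI) (simp add: cinner_adj_left)

lemma ccompose_assoc: "R o\<^sub>C S o\<^sub>C T = R o\<^sub>C (S o\<^sub>C T)"
  by (rule cblinfun_eqI) simp

section \<open>Concrete operator systems and C*-algebras\<close>

text \<open>A family \<open>T\<close> indexed by a finite set \<open>I\<close> of rows and columns is an operator on the Hilbert sum
  \<open>H\<^sup>I\<close>, equivalently an element of \<open>M\<^sub>I \<otimes> B(H)\<close>; its quadratic form at \<open>\<xi> \<in> H\<^sup>I\<close> is the double sum
  below.  Being positive is understood in this sense for matrices over any subspace of \<open>B(H)\<close>.\<close>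

definition block_positive :: "'i set \<Rightarrow> ('i \<Rightarrow> 'i \<Rightarrow> ('h::chilbert_space, 'h) cblinfun) \<Rightarrow> bool"
  where "block_positive I T \<longleftrightarrow>
    (\<forall>\<xi>. (\<Sum>i\<in>I. \<Sum>j\<in>I. cinner (\<xi> i) (T i j *\<^sub>V \<xi> j)) \<in> \<real>\<^sub>\<ge>\<^sub>0)"

definition operator_system :: "('h::chilbert_space, 'h) cblinfun set \<Rightarrow> bool"
  where "operator_system S \<longleftrightarrow> csubspace S \<and> cid \<in> S \<and> (\<forall>T\<in>S. adj T \<in> S)"

definition unital_cstar_algebra :: "('h::chilbert_space, 'h) cblinfun set \<Rightarrow> bool"
  where "unital_cstar_algebra C \<longleftrightarrow> csubspace C \<and> closed C \<and> cid \<in> C \<and>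
    (\<forall>S\<in>C. \<forall>T\<in>C. S o\<^sub>C T \<in> C) \<and> (\<forall>T\<in>C. adj T \<in> C)"

text \<open>Maps on a subspace \<open>S\<close> are total functions whose values outside \<open>S\<close> are irrelevant.\<close>

definition clinear_on :: "'a::complex_vector set \<Rightarrow> ('a \<Rightarrow> 'b::complex_vector) \<Rightarrow> bool"
  where "clinear_on S \<phi> \<longleftrightarrow>
    (\<forall>s\<in>S. \<forall>t\<in>S. \<phi> (s + t) = \<phi> s + \<phi> t) \<and> (\<forall>c. \<forall>s\<in>S. \<phi> (c *\<^sub>C s) = c *\<^sub>C \<phi> s)"

definition cp_on ::
  "('l::chilbert_space, 'l) cblinfun set \<Rightarrow> (('l, 'l) cblinfun \<Rightarrow> ('h::chilbert_space, 'h) cblinfun) \<Rightarrow> bool"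
  where "cp_on S \<phi> \<longleftrightarrow> clinear_on S \<phi> \<and>
    (\<forall>(n::nat) T. (\<forall>i<n. \<forall>j<n. T i j \<in> S) \<longrightarrow> block_positive {..<n} T \<longrightarrow>
      block_positive {..<n} (\<lambda>i j. \<phi> (T i j)))"

definition ucp_on ::
  "('l::chilbert_space, 'l) cblinfun set \<Rightarrow> (('l, 'l) cblinfun \<Rightarrow> ('h::chilbert_space, 'h) cblinfun) \<Rightarrow> bool"
  where "ucp_on S \<phi> \<longleftrightarrow> cp_on S \<phi> \<and> \<phi> cid = cid"

definition complete_order_embedding ::
  "('l::chilbert_space, 'l) cblinfun set \<Rightarrow> (('l, 'l) cblinfun \<Rightarrow> ('h::chilbert_space, 'h) cblinfun) \<Rightarrow> bool"
  where "complete_order_embedding S \<iota> \<longleftrightarrow> clinear_on S \<iota> \<and> inj_on \<iota> S \<and>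
    (\<forall>(n::nat) T. (\<forall>i<n. \<forall>j<n. T i j \<in> S) \<longrightarrow>
      (block_positive {..<n} T \<longleftrightarrow> block_positive {..<n} (\<lambda>i j. \<iota> (T i j))))"

definition star_representation ::
  "('l::chilbert_space, 'l) cblinfun set \<Rightarrow> (('l, 'l) cblinfun \<Rightarrow> ('h::chilbert_space, 'h) cblinfun) \<Rightarrow> bool"
  where "star_representation C \<pi> \<longleftrightarrow> clinear_on C \<pi> \<and>
    (\<forall>S\<in>C. \<forall>T\<in>C. \<pi> (S o\<^sub>C T) = \<pi> S o\<^sub>C \<pi> T) \<and> (\<forall>T\<in>C. \<pi> (adj T) = adj (\<pi> T))"

text \<open>The C*-algebra is given concretely, as a unital C*-subalgebra of \<open>B(M)\<close>. The Hilbert space on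
  which the completely positive maps take their values is a type and cannot be bound by a quantifier
  inside the definition; the first argument names it. A pair is the universal C*-cover if it
  satisfies the predicate for every \<open>'k\<close>.\<close>

definition universal_cstar_cover ::
  "'k::chilbert_space itself \<Rightarrow> ('l::chilbert_space, 'l) cblinfun set \<Rightarrow>
    ('m::chilbert_space, 'm) cblinfun set \<Rightarrow> (('l, 'l) cblinfun \<Rightarrow> ('m, 'm) cblinfun) \<Rightarrow> bool"
  where "universal_cstar_cover _ S C \<iota> \<longleftrightarrow>
    operator_system S \<and> unital_cstar_algebra C \<and>
    complete_order_embedding S \<iota> \<and> \<iota> cid = cid \<and>
    C = unital_cstar_algebra hull (\<iota> ` S) \<and>
    (\<forall>\<phi> :: ('l, 'l) cblinfun \<Rightarrow> ('k, 'k) cblinfun. ucp_on S \<phi> \<longrightarrow>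
      (\<exists>\<pi>. star_representation C \<pi> \<and> (\<forall>s\<in>S. \<pi> (\<iota> s) = \<phi> s)))"

text \<open>\<open>E x x' a a'\<close> is the entry in row \<open>(x, a)\<close> and column \<open>(x', a')\<close>.\<close>

definition xa_matrix :: "('x \<Rightarrow> 'x \<Rightarrow> 'x \<Rightarrow> 'x \<Rightarrow> 'b) \<Rightarrow> 'x \<times> 'x \<Rightarrow> 'x \<times> 'x \<Rightarrow> 'b"
  where "xa_matrix E = (\<lambda>(x, a) (x', a'). E x x' a a')"

definition bistochastic ::
  "('x::finite \<Rightarrow> 'x \<Rightarrow> 'x \<Rightarrow> 'x \<Rightarrow> ('h::chilbert_space, 'h) cblinfun) \<Rightarrow> bool"
  where "bistochastic E \<longleftrightarrow> block_positive UNIV (xa_matrix E) \<and>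
    (\<forall>x x'. (\<Sum>a\<in>UNIV. E x x' a a) = (if x = x' then cid else 0)) \<and>
    (\<forall>a a'. (\<Sum>x\<in>UNIV. E x x a a') = (if a = a' then cid else 0))"

section \<open>Ternary rings of operators\<close>

definition tro :: "('h::chilbert_space, 'k::chilbert_space) cblinfun set \<Rightarrow> bool"
  where "tro W \<longleftrightarrow> csubspace W \<and> closed W \<and> (\<forall>S\<in>W. \<forall>T\<in>W. \<forall>R\<in>W. S o\<^sub>C adj T o\<^sub>C R \<in> W)"

definition right_cstar_algebra ::
  "('h::chilbert_space, 'k::chilbert_space) cblinfun set \<Rightarrow> ('h, 'h) cblinfun set"
  where "right_cstar_algebra W = closure (cspan {adj S o\<^sub>C T | S T. S \<in> W \<and> T \<in> W})"

section \<open>Bi-isometries\<close>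

text \<open>Bi-isometries from the range of the projection \<open>P\<close> to the range of the projection \<open>Q\<close>; for full
  spaces, both projections are the identity.\<close>

definition bi_isometry ::
  "('h::chilbert_space, 'h) cblinfun \<Rightarrow> ('k::chilbert_space, 'k) cblinfun \<Rightarrow>
    ('x::finite \<Rightarrow> 'x \<Rightarrow> ('h, 'k) cblinfun) \<Rightarrow> bool"
  where "bi_isometry P Q V \<longleftrightarrow> (\<forall>a x. Q o\<^sub>C V a x o\<^sub>C P = V a x) \<and>
    (\<forall>x x'. (\<Sum>a\<in>UNIV. adj (V a x) o\<^sub>C V a x') = (if x = x' then P else 0)) \<and>
    (\<forall>a a'. (\<Sum>x\<in>UNIV. adj (V a x) o\<^sub>C V a' x) = (if a = a' then P else 0))"

lemma restrict_square_summable: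
  assumes f: "(\<lambda>i. (cmod (f i))\<^sup>2) summable_on UNIV" and h: "inj_on h S"
  shows "(\<lambda>s. (cmod (if s \<in> S then f (h s) else 0))\<^sup>2) summable_on UNIV"
    and "sqrt (\<Sum>\<^sub>\<infinity>s. (cmod (if s \<in> S then f (h s) else 0))\<^sup>2) \<le> sqrt (\<Sum>\<^sub>\<infinity>i. (cmod (f i))\<^sup>2)"
proof -
  have *: "L2_set (\<lambda>s. cmod (if s \<in> S then f (h s) else 0)) F \<le> sqrt (\<Sum>\<^sub>\<infinity>i. (cmod (f i))\<^sup>2)"
    if F: "finite F" for F
  proof -
    have "(\<Sum>s\<in>F. (cmod (if s \<in> S then f (h s) else 0))\<^sup>2) = (\<Sum>s\<in>F \<inter> S. (cmod (f (h s)))\<^sup>2)"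
      using F by (auto intro!: sum.mono_neutral_cong_right split: if_splits)
    also have "\<dots> = (\<Sum>i\<in>h ` (F \<inter> S). (cmod (f i))\<^sup>2)"
      using h by (subst sum.reindex) (auto intro: inj_on_subset)
    finally show ?thesis
      using square_summable_bound[OF f, of "h ` (F \<inter> S)"] F by (simp add: L2_set_def)
  qed
  show "(\<lambda>s. (cmod (if s \<in> S then f (h s) else 0))\<^sup>2) summable_on UNIV"
    "sqrt (\<Sum>\<^sub>\<infinity>s. (cmod (if s \<in> S then f (h s) else 0))\<^sup>2) \<le> sqrt (\<Sum>\<^sub>\<infinity>i. (cmod (f i))\<^sup>2)"
    using square_summable_if_bounded[OF *] by blast+
qed

text \<open>The projection of \<open>\<ell>\<^sup>2(I)\<close> onto \<open>\<ell>\<^sup>2(S)\<close> for \<open>S \<subseteq> I\<close>.\<close>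

lift_definition ell2_restrict :: "'i set \<Rightarrow> 'i ell2 \<Rightarrow> 'i ell2"
  is "\<lambda>S f s. if s \<in> S then f s else 0"
  using restrict_square_summable(1)[where h = "\<lambda>s. s"] by simp

lemma norm_ell2_restrict: "norm (ell2_restrict S f) \<le> norm f"
  by transfer (use restrict_square_summable(2)[where h = "\<lambda>s. s"] in simp)

lift_definition coord_proj :: "'i set \<Rightarrow> ('i ell2, 'i ell2) cblinfun" is ell2_restrict
proof (intro conjI allI)
  fix S :: "'i set"
  show scale: "ell2_restrict S (c *\<^sub>C f) = c *\<^sub>C ell2_restrict S f" for c f
    by transfer (simp add: fun_eq_iff)
  have "ell2_restrict S (f + g) = ell2_restrict S f + ell2_restrict S g" for f g
    by transfer (simp add: fun_eq_iff)
  then show "bounded_linear (ell2_restrict S)"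
    by (intro bounded_linear_intro[where K = 1])
      (simp_all add: scaleC_of_real[symmetric] scale norm_ell2_restrict)
qed

lemma Rep_coord_proj: "Rep_ell2 (coord_proj S *\<^sub>V f) s = (if s \<in> S then Rep_ell2 f s else 0)"
  by (simp add: coord_proj.rep_eq ell2_restrict.rep_eq)

lemma ell2_eqI: "(\<And>i. Rep_ell2 f i = Rep_ell2 g i) \<Longrightarrow> f = g"
  by (metis Rep_ell2_inject ext)

lemma coord_proj_UNIV: "coord_proj UNIV = cid"
  by (intro cblinfun_eqI ell2_eqI) (simp add: Rep_coord_proj)

lemma coord_proj_empty: "coord_proj {} = 0"
  by (intro cblinfun_eqI ell2_eqI) (simp add: Rep_coord_proj zero_ell2.rep_eq)

lemma coord_proj_idem: "coord_proj S o\<^sub>C coord_proj S = coord_proj S"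
  by (intro cblinfun_eqI ell2_eqI) (simp add: Rep_coord_proj)

lemma adj_coord_proj: "adj (coord_proj S) = coord_proj S"
proof (rule adj_eqI)
  fix f g :: "'a ell2"
  show "cinner (coord_proj S *\<^sub>V g) f = cinner g (coord_proj S *\<^sub>V f)"
    unfolding cinner_ell2.rep_eq by (rule infsum_cong) (simp add: Rep_coord_proj)
qed

text \<open>\<open>(S, T, V)\<close> stands for \<open>V = (V\<^sub>a\<^sub>,\<^sub>x)\<close> with \<open>V\<^sub>a\<^sub>,\<^sub>x : \<ell>\<^sup>2(S) \<rightarrow> \<ell>\<^sup>2(T)\<close> and \<open>S, T \<subseteq> 'c\<close>. Up to unitary
  equivalence these are the Hilbert spaces of dimension at most the cardinality of \<open>'c\<close>.\<close>

type_synonym ('x, 'c) biiso_data =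
  "'c set \<times> 'c set \<times> ('x \<Rightarrow> 'x \<Rightarrow> ('c ell2, 'c ell2) cblinfun)"

definition bi_isometries :: "('x::finite, 'c) biiso_data set"
  where "bi_isometries = {(S, T, V). bi_isometry (coord_proj S) (coord_proj T) V}"

definition unitarily_equivalent :: "('x, 'c) biiso_data \<Rightarrow> ('x, 'c) biiso_data \<Rightarrow> bool"
  where "unitarily_equivalent = (\<lambda>(S, T, V) (S', T', V').
    \<exists>U W. adj U o\<^sub>C U = coord_proj S \<and> U o\<^sub>C adj U = coord_proj S' \<and>
      adj W o\<^sub>C W = coord_proj T \<and> W o\<^sub>C adj W = coord_proj T' \<and>
      (\<forall>a x. W o\<^sub>C V a x = V' a x o\<^sub>C U))"

definition biiso_reps :: "('x::finite, 'c) biiso_data set"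
  where "biiso_reps =
    (\<lambda>d. SOME d'. d' \<in> bi_isometries \<and> unitarily_equivalent d d') ` bi_isometries"

lemma bi_isometries_support:
  assumes "(S, T, V) \<in> bi_isometries"
  shows "coord_proj T o\<^sub>C V a x = V a x" "V a x o\<^sub>C coord_proj S = V a x"
proof -
  have V: "coord_proj T o\<^sub>C V a x o\<^sub>C coord_proj S = V a x"
    using assms by (simp add: bi_isometries_def bi_isometry_def)
  show "coord_proj T o\<^sub>C V a x = V a x" by (metis V ccompose_assoc coord_proj_idem)
  show "V a x o\<^sub>C coord_proj S = V a x" by (metis V ccompose_assoc coord_proj_idem)
qed

lemma unitarily_equivalent_refl:
  assumes "d \<in> bi_isometries"
  shows "unitarily_equivalent d d"
proof -
  obtain S T V where d: "d = (S, T, V)" by (metis prod_cases3)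
  note bi_isometries_support[OF assms[unfolded d]]
  then show ?thesis
    unfolding unitarily_equivalent_def d prod.case
    by (intro exI[where P = "\<lambda>U. \<exists>W. Q U W" and x = "coord_proj S" for Q] exI[of _ "coord_proj T"])
      (simp add: adj_coord_proj coord_proj_idem)
qed

lemma partial_isometry_left: "adj U o\<^sub>C U = coord_proj S \<Longrightarrow> U o\<^sub>C coord_proj S = U"
proof -
  assume U: "adj U o\<^sub>C U = coord_proj S"
  have "(U o\<^sub>C coord_proj S) *\<^sub>V x - U *\<^sub>V x = 0" for x
  proof -
    let ?z = "coord_proj S *\<^sub>V x - x"
    have "cinner (U *\<^sub>V ?z) (U *\<^sub>V ?z) = cinner ?z ((adj U o\<^sub>C U) *\<^sub>V ?z)"
      by (simp add: cinner_adj_right)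
    also have "\<dots> = 0"
      using arg_cong[OF coord_proj_idem[of S], of "\<lambda>A. A *\<^sub>V x"]
      by (simp add: U cblinfun_apply_linear)
    finally have "U *\<^sub>V ?z = 0" by (simp add: cinner_self)
    then show ?thesis by (simp add: cblinfun_apply_linear)
  qed
  then show ?thesis by (intro cblinfun_eqI) simp
qed

lemma partial_isometry_right: "U o\<^sub>C adj U = coord_proj S \<Longrightarrow> coord_proj S o\<^sub>C U = U"
  using partial_isometry_left[of "adj U" S] by (metis adj_adj adj_ccompose adj_coord_proj)

lemma unitarily_equivalent_sym:
  assumes "d \<in> bi_isometries" "unitarily_equivalent d d'" "d' \<in> bi_isometries"
  shows "unitarily_equivalent d' d"
proof -
  obtain S T V S' T' V' where d: "d = (S, T, V)" "d' = (S', T', V')" by (metis prod_cases3)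
  obtain U W where UW: "adj U o\<^sub>C U = coord_proj S" "U o\<^sub>C adj U = coord_proj S'"
      "adj W o\<^sub>C W = coord_proj T" "W o\<^sub>C adj W = coord_proj T'"
    and I: "W o\<^sub>C V a x = V' a x o\<^sub>C U" for a x
    using assms(2) by (auto simp: unitarily_equivalent_def d)
  note V = bi_isometries_support(1)[OF assms(1)[unfolded d]]
    bi_isometries_support(2)[OF assms(3)[unfolded d]]
  have "adj W o\<^sub>C V' a x = V a x o\<^sub>C adj U" for a x
  proof -
    have "adj W o\<^sub>C V' a x = adj W o\<^sub>C (V' a x o\<^sub>C U) o\<^sub>C adj U"
      by (metis UW(2) V(2) ccompose_assoc)
    also have "\<dots> = V a x o\<^sub>C adj U" by (metis I UW(3) V(1) ccompose_assoc)
    finally show ?thesis .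
  qed
  then show ?thesis
    unfolding d unitarily_equivalent_def prod.case using UW
    by (intro exI[where P = "\<lambda>U. \<exists>W. Q U W" and x = "adj U" for Q] exI[of _ "adj W"]) simp
qed

lemma unitarily_equivalent_trans:
  assumes "unitarily_equivalent d d'" "unitarily_equivalent d' d''"
  shows "unitarily_equivalent d d''"
proof -
  obtain S T V S' T' V' S'' T'' V'' where
    d: "d = (S, T, V)" "d' = (S', T', V')" "d'' = (S'', T'', V'')" by (metis prod_cases3)
  obtain U W where UW: "adj U o\<^sub>C U = coord_proj S" "U o\<^sub>C adj U = coord_proj S'"
      "adj W o\<^sub>C W = coord_proj T" "W o\<^sub>C adj W = coord_proj T'"
    and I: "W o\<^sub>C V a x = V' a x o\<^sub>C U" for a x
    using assms(1) by (auto simp: unitarily_equivalent_def d)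
  obtain U' W' where UW': "adj U' o\<^sub>C U' = coord_proj S'" "U' o\<^sub>C adj U' = coord_proj S''"
      "adj W' o\<^sub>C W' = coord_proj T'" "W' o\<^sub>C adj W' = coord_proj T''"
    and I': "W' o\<^sub>C V' a x = V'' a x o\<^sub>C U'" for a x
    using assms(2) by (auto simp: unitarily_equivalent_def d)
  have A: "adj (B o\<^sub>C A) o\<^sub>C (B o\<^sub>C A) = coord_proj X" "B o\<^sub>C A o\<^sub>C adj (B o\<^sub>C A) = coord_proj Z"
    if "adj A o\<^sub>C A = coord_proj X" "A o\<^sub>C adj A = coord_proj Y"
      "adj B o\<^sub>C B = coord_proj Y" "B o\<^sub>C adj B = coord_proj Z" for A B X Y Z
  proof -
    have "adj (B o\<^sub>C A) o\<^sub>C (B o\<^sub>C A) = adj A o\<^sub>C ((adj B o\<^sub>C B) o\<^sub>C A)"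
      by (simp only: adj_ccompose ccompose_assoc)
    then show "adj (B o\<^sub>C A) o\<^sub>C (B o\<^sub>C A) = coord_proj X"
      using that partial_isometry_right by metis
    have "B o\<^sub>C A o\<^sub>C adj (B o\<^sub>C A) = B o\<^sub>C (A o\<^sub>C adj A) o\<^sub>C adj B"
      by (simp only: adj_ccompose ccompose_assoc)
    then show "B o\<^sub>C A o\<^sub>C adj (B o\<^sub>C A) = coord_proj Z"
      using that partial_isometry_left by metis
  qed
  have "W' o\<^sub>C W o\<^sub>C V a x = V'' a x o\<^sub>C (U' o\<^sub>C U)" for a x
    by (metis I I' ccompose_assoc)
  then show ?thesis
    unfolding d unitarily_equivalent_def prod.case
    using A[OF UW(1,2) UW'(1,2)] A[OF UW(3,4) UW'(3,4)]
    by (intro exI[where P = "\<lambda>U. \<exists>W. Q U W" and x = "U' o\<^sub>C U" for Q] exI[of _ "W' o\<^sub>C W"]) simp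
qed

lemma biiso_reps_subset: "d \<in> biiso_reps \<Longrightarrow> d \<in> bi_isometries"
  unfolding biiso_reps_def using someI2_ex[of "\<lambda>d'. d' \<in> bi_isometries \<and> unitarily_equivalent _ d'"]
    unitarily_equivalent_refl by fast

lemma biiso_reps_unique:
  fixes d :: "('x::finite, 'c) biiso_data"
  assumes "d \<in> bi_isometries"
  shows "\<exists>!d'. d' \<in> biiso_reps \<and> unitarily_equivalent d d'"
proof (rule ex_ex1I)
  have s: "\<exists>d'. d' \<in> bi_isometries \<and> unitarily_equivalent d d'" if "d \<in> bi_isometries"
    for d :: "('x, 'c) biiso_data" using unitarily_equivalent_refl that by blast
  show "\<exists>d'. d' \<in> biiso_reps \<and> unitarily_equivalent d d'"
    unfolding biiso_reps_def using someI_ex[OF s[OF assms]] assms by blast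
  fix d1 d2
  assume 1: "d1 \<in> biiso_reps \<and> unitarily_equivalent d d1"
    and 2: "d2 \<in> biiso_reps \<and> unitarily_equivalent d d2"
  have *: "d1 = (SOME d'. d' \<in> bi_isometries \<and> unitarily_equivalent d d')"
    if 1: "d1 \<in> biiso_reps \<and> unitarily_equivalent d d1" for d1
  proof -
    obtain c where c: "c \<in> bi_isometries"
      and d1: "d1 = (SOME d'. d' \<in> bi_isometries \<and> unitarily_equivalent c d')"
      using 1 by (auto simp: biiso_reps_def)
    have cd1: "d1 \<in> bi_isometries" "unitarily_equivalent c d1"
      using someI_ex[OF s[OF c]] unfolding d1[symmetric] by blast+
    have "unitarily_equivalent c d'  \<longleftrightarrow> unitarily_equivalent d d'" if "d' \<in> bi_isometries" for d'
      by (meson 1 assms c cd1 unitarily_equivalent_sym unitarily_equivalent_trans)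
    then have "(\<lambda>d'. d' \<in> bi_isometries \<and> unitarily_equivalent c d')
        = (\<lambda>d'. d' \<in> bi_isometries \<and> unitarily_equivalent d d')" by blast
    then show ?thesis using d1 by simp
  qed
  show "d1 = d2" using *[OF 1] *[OF 2] by simp
qed

lemma cid_neq_0: "(cid :: ('i ell2, 'i ell2) cblinfun) \<noteq> 0"
proof
  fix i :: 'i
  assume c: "(cid :: ('i ell2, 'i ell2) cblinfun) = 0"
  define k :: "'i ell2" where "k = Abs_ell2 (\<lambda>j. if j = i then 1 else 0)"
  have "(\<lambda>j. (cmod (if j = i then 1 else 0))\<^sup>2) summable_on (UNIV :: 'i set)"
    by (rule finite_nonzero_values_imp_summable_on) (rule finite_subset[of _ "{i}"], auto)
  then have "Rep_ell2 k i = 1" unfolding k_def by (subst Abs_ell2_inverse) auto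
  moreover have "k = 0" using arg_cong[OF c, of "\<lambda>T. T *\<^sub>V k"] by simp
  ultimately show False by (simp add: zero_ell2.rep_eq)
qed

lemma biiso_reps_nonempty:
  "\<exists>d \<in> (biiso_reps :: ('x::finite, 'c) biiso_data set). fst d \<noteq> {} \<and> fst (snd d) \<noteq> {}"
proof -
  define d :: "('x, 'c) biiso_data" where "d = (UNIV, UNIV, \<lambda>a x. if a = x then cid else 0)"
  have ac: "adj cid = (cid :: ('c ell2, 'c ell2) cblinfun)"
    using adj_coord_proj[of "UNIV :: 'c set"] by (simp add: coord_proj_UNIV)
  have a0: "adj 0 = (0 :: ('c ell2, 'c ell2) cblinfun)" by (rule adj_eqI) simp
  have cc: "S o\<^sub>C cid = S" "cid o\<^sub>C S = S" "0 o\<^sub>C S = 0" "S o\<^sub>C 0 = 0"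
    for S :: "('c ell2, 'c ell2) cblinfun"
    by (rule cblinfun_eqI, simp add: cblinfun_apply_linear)+
  have dd: "adj (if a = x then cid else 0) o\<^sub>C (if b = y then cid else 0)
      = (if a = x \<and> b = y then cid else (0 :: ('c ell2, 'c ell2) cblinfun))" for a b x y :: 'x
    by (simp add: ac a0 cc)
  have "d \<in> bi_isometries"
    unfolding d_def bi_isometries_def bi_isometry_def
    by (simp add: coord_proj_UNIV cc dd) (auto simp: if_distrib sum.delta' sum.delta intro!: sum.neutral
      split: if_splits)
  then obtain d' where d': "d' \<in> biiso_reps" "unitarily_equivalent d d'"
    using biiso_reps_unique[of d] by blast
  obtain S T V where d'_eq: "d' = (S, T, V)" by (metis prod_cases3)
  obtain U W :: "('c ell2, 'c ell2) cblinfun" where UW: "adj U o\<^sub>C U = cid" "U o\<^sub>C adj U = coord_proj S"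
      "adj W o\<^sub>C W = cid" "W o\<^sub>C adj W = coord_proj T"
    using d'(2) unfolding unitarily_equivalent_def d_def d'_eq coord_proj_UNIV prod.case by blast
  have *: "X \<noteq> {}" if "adj A o\<^sub>C A = cid" "A o\<^sub>C adj A = coord_proj X"
    for A :: "('c ell2, 'c ell2) cblinfun" and X
  proof
    assume "X = {}"
    then have "adj A o\<^sub>C (A o\<^sub>C adj A) o\<^sub>C A = 0" using that by (simp add: coord_proj_empty cc)
    moreover have "adj A o\<^sub>C (A o\<^sub>C adj A) o\<^sub>C A = (adj A o\<^sub>C A) o\<^sub>C (adj A o\<^sub>C A)"
      by (simp only: ccompose_assoc)
    ultimately show False using that cid_neq_0[where 'i = 'c] by (simp add: cc)
  qed
  show ?thesis using d'(1) *[OF UW(1,2)] *[OF UW(3,4)] by (intro bexI[of _ d']) (simp_all add: d'_eq)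
qed

section \<open>The universal bi-isometry\<close>

text \<open>With the index types below, \<open>\<ell>\<^sup>2\<close> of \<open>('x, 'c) src\<close> is the Hilbert sum of the spaces \<open>\<ell>\<^sup>2(S)\<close>, and
  \<open>\<ell>\<^sup>2\<close> of \<open>('x, 'c) tgt\<close> that of the spaces \<open>\<ell>\<^sup>2(T)\<close>, over all chosen representatives \<open>(S, T, V)\<close>.\<close>

typedef (overloaded) ('x, 'c) src =
  "{(d :: ('x::finite, 'c) biiso_data, s). d \<in> biiso_reps \<and> s \<in> fst d}"
  using biiso_reps_nonempty by fast

typedef (overloaded) ('x, 'c) tgt =
  "{(d :: ('x::finite, 'c) biiso_data, t). d \<in> biiso_reps \<and> t \<in> fst (snd d)}"
  using biiso_reps_nonempty by fast

lift_definition src_component :: "('x::finite, 'c) biiso_data \<Rightarrow> ('x, 'c) src ell2 \<Rightarrow> 'c ell2"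
  is "\<lambda>d f s. if s \<in> {s. d \<in> biiso_reps \<and> s \<in> fst d} then f (Abs_src (d, s)) else 0"
  by (rule restrict_square_summable(1)) (auto simp: inj_on_def Abs_src_inject)

lemma src_component_linear:
  "src_component d (f + g) = src_component d f + src_component d g"
  "src_component d (c *\<^sub>C f) = c *\<^sub>C src_component d f"
  by (transfer; simp add: fun_eq_iff)+

lemma coord_proj_src_component:
  "coord_proj (fst d) *\<^sub>V src_component d f = src_component d f"
  by (rule ell2_eqI) (simp add: Rep_coord_proj src_component.rep_eq)

lemma infsum_src:
  fixes F :: "('x::finite, 'c) biiso_data \<times> 'c \<Rightarrow> 'b::{comm_monoid_add, t2_space}"
  shows "(\<Sum>\<^sub>\<infinity>p\<in>UNIV. F (Rep_src p)) = (\<Sum>\<^sub>\<infinity>p\<in>Sigma biiso_reps fst. F p)"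
  "(\<lambda>p. F (Rep_src p)) summable_on UNIV \<longleftrightarrow> F summable_on Sigma biiso_reps fst"
proof -
  have "bij_betw Rep_src (UNIV :: ('x, 'c) src set) (Sigma biiso_reps fst)"
    unfolding bij_betw_def type_definition.Rep_range[OF type_definition_src]
    by (auto simp: inj_on_def Rep_src_inject)
  then show "(\<Sum>\<^sub>\<infinity>p\<in>UNIV. F (Rep_src p)) = (\<Sum>\<^sub>\<infinity>p\<in>Sigma biiso_reps fst. F p)"
    "(\<lambda>p. F (Rep_src p)) summable_on UNIV \<longleftrightarrow> F summable_on Sigma biiso_reps fst"
    using infsum_reindex_bij_betw summable_on_reindex_bij_betw by blast+
qed

lemma infsum_tgt:
  fixes F :: "('x::finite, 'c) biiso_data \<times> 'c \<Rightarrow> 'b::{comm_monoid_add, t2_space}"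
  shows "(\<Sum>\<^sub>\<infinity>p\<in>UNIV. F (Rep_tgt p)) = (\<Sum>\<^sub>\<infinity>p\<in>Sigma biiso_reps (\<lambda>d. fst (snd d)). F p)"
  "(\<lambda>p. F (Rep_tgt p)) summable_on UNIV \<longleftrightarrow> F summable_on Sigma biiso_reps (\<lambda>d. fst (snd d))"
proof -
  have "bij_betw Rep_tgt (UNIV :: ('x, 'c) tgt set) (Sigma biiso_reps (\<lambda>d. fst (snd d)))"
    unfolding bij_betw_def type_definition.Rep_range[OF type_definition_tgt]
    by (auto simp: inj_on_def Rep_tgt_inject)
  then show "(\<Sum>\<^sub>\<infinity>p\<in>UNIV. F (Rep_tgt p)) = (\<Sum>\<^sub>\<infinity>p\<in>Sigma biiso_reps (\<lambda>d. fst (snd d)). F p)"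
    "(\<lambda>p. F (Rep_tgt p)) summable_on UNIV \<longleftrightarrow> F summable_on Sigma biiso_reps (\<lambda>d. fst (snd d))"
    using infsum_reindex_bij_betw summable_on_reindex_bij_betw by blast+
qed

lemma ell2_product_summable: "(\<lambda>i. cnj (Rep_ell2 f i) * Rep_ell2 g i) summable_on UNIV"
  by (rule square_summable_product) (use Rep_ell2 in auto)

lemma cinner_src:
  "((\<lambda>d. cinner (src_component d f) (src_component d g)) has_sum cinner f g) biiso_reps"
proof -
  define G where "G p = cnj (Rep_ell2 f (Abs_src p)) * Rep_ell2 g (Abs_src p)" for p
  have G: "G (Rep_src p) = cnj (Rep_ell2 f p) * Rep_ell2 g p" for p
    by (simp add: G_def Rep_src_inverse)
  have s: "G summable_on Sigma biiso_reps fst"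
    using infsum_src(2)[of G] ell2_product_summable[of f g] by (simp add: G)
  have comp: "(\<Sum>\<^sub>\<infinity>s\<in>fst d. G (d, s)) = cinner (src_component d f) (src_component d g)"
    if "d \<in> biiso_reps" for d
    unfolding cinner_ell2.rep_eq
    by (rule infsum_cong_neutral) (use that in \<open>auto simp: src_component.rep_eq G_def\<close>)
  have "cinner f g = (\<Sum>\<^sub>\<infinity>p\<in>Sigma biiso_reps fst. G p)"
    unfolding cinner_ell2.rep_eq using infsum_src(1)[of G] by (simp add: G)
  also have "\<dots> = (\<Sum>\<^sub>\<infinity>d\<in>biiso_reps. \<Sum>\<^sub>\<infinity>s\<in>fst d. G (d, s))"
    using infsum_Sigma'_banach[of "\<lambda>d s. G (d, s)"] s by (simp add: case_prod_unfold)
  finally have "cinner f g = (\<Sum>\<^sub>\<infinity>d\<in>biiso_reps. cinner (src_component d f) (src_component d g))"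
    by (simp add: comp cong: infsum_cong)
  moreover have "(\<lambda>d. \<Sum>\<^sub>\<infinity>s\<in>fst d. G (d, s)) summable_on biiso_reps"
    using summable_on_Sigma_banach[of "\<lambda>d s. G (d, s)" biiso_reps fst] s by (simp add: case_prod_unfold)
  then have "(\<lambda>d. cinner (src_component d f) (src_component d g)) summable_on biiso_reps"
    by (simp add: comp cong: summable_on_cong)
  ultimately show ?thesis by (simp add: has_sum_iff)
qed

lemma norm_src_component_sum:
  assumes "finite D" "D \<subseteq> biiso_reps"
  shows "(\<Sum>d\<in>D. (norm (src_component d f))\<^sup>2) \<le> (norm f)\<^sup>2"
proof -
  have "((\<lambda>d. Re (cinner (src_component d f) (src_component d f))) has_sum Re (cinner f f)) biiso_reps"
    by (rule has_sum_Re[OF cinner_src])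
  then have "((\<lambda>d. (norm (src_component d f))\<^sup>2) has_sum (norm f)\<^sup>2) biiso_reps"
    by (simp add: cinner_self)
  then show ?thesis by (rule finite_sum_le_has_sum) (use assms in auto)
qed

lemma bi_isometries_contractive:
  assumes "(S, T, V) \<in> bi_isometries"
  shows "norm (V a x *\<^sub>V f) \<le> norm f"
proof -
  have "(\<Sum>b\<in>UNIV. adj (V b x) o\<^sub>C V b x) = coord_proj S"
    using assms by (auto simp: bi_isometries_def bi_isometry_def)
  then have "cinner f (coord_proj S *\<^sub>V f) = (\<Sum>b\<in>UNIV. cinner f ((adj (V b x) o\<^sub>C V b x) *\<^sub>V f))"
    by (simp add: cinner_sum_right[symmetric] cblinfun_sum_apply[symmetric] del: cblinfun_apply_simps)
  also have "\<dots> = complex_of_real (\<Sum>b\<in>UNIV. (norm (V b x *\<^sub>V f))\<^sup>2)"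
    by (simp add: cinner_adj_right cinner_self)
  finally have eq: "cinner f (coord_proj S *\<^sub>V f) = complex_of_real (\<Sum>b\<in>UNIV. (norm (V b x *\<^sub>V f))\<^sup>2)" .
  have "(norm (V a x *\<^sub>V f))\<^sup>2 \<le> (\<Sum>b\<in>UNIV. (norm (V b x *\<^sub>V f))\<^sup>2)"
    by (rule member_le_sum) auto
  also have "\<dots> \<le> cmod (cinner f (coord_proj S *\<^sub>V f))"
    unfolding eq norm_of_real by (rule abs_ge_self)
  also have "\<dots> \<le> norm f * norm (coord_proj S *\<^sub>V f)" by (rule cauchy_schwarz_cinner)
  also have "\<dots> \<le> norm f * norm f"
    by (simp add: coord_proj.rep_eq norm_ell2_restrict mult_left_mono)
  finally have "(norm (V a x *\<^sub>V f))\<^sup>2 \<le> (norm f)\<^sup>2" by (simp only: power2_eq_square)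
  then show ?thesis by (rule power2_le_imp_le) simp
qed

definition biiso_op :: "('x, 'c) biiso_data \<Rightarrow> 'x \<Rightarrow> 'x \<Rightarrow> ('c ell2, 'c ell2) cblinfun"
  where "biiso_op d = snd (snd d)"

lemma direct_sum_square_summable:
  fixes f :: "('x::finite, 'c) src ell2" and a x :: 'x
  defines "u \<equiv> \<lambda>q. case Rep_tgt q of (d, t) \<Rightarrow> Rep_ell2 (biiso_op d a x *\<^sub>V src_component d f) t"
  shows "(\<lambda>q. (cmod (u q))\<^sup>2) summable_on UNIV" "sqrt (\<Sum>\<^sub>\<infinity>q. (cmod (u q))\<^sup>2) \<le> norm f"
proof -
  have bound: "L2_set (\<lambda>q. cmod (u q)) F \<le> norm f" if F: "finite F" for F
  proof -
    define D where "D = fst ` Rep_tgt ` F"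
    define T where "T = snd ` Rep_tgt ` F"
    have "fst (Rep_tgt q) \<in> biiso_reps" for q :: "('x, 'c) tgt"
      using Rep_tgt[of q] by (simp add: case_prod_unfold)
    then have D: "finite D" "D \<subseteq> biiso_reps" and T: "finite T"
      using F by (simp_all add: D_def T_def image_subset_iff)
    let ?w = "\<lambda>d. biiso_op d a x *\<^sub>V src_component d f"
    have "(\<Sum>q\<in>F. (cmod (u q))\<^sup>2) = (\<Sum>(d, t)\<in>Rep_tgt ` F. (cmod (Rep_ell2 (?w d) t))\<^sup>2)"
      by (subst sum.reindex) (auto simp: inj_on_def Rep_tgt_inject u_def case_prod_unfold)
    also have "\<dots> \<le> (\<Sum>(d, t)\<in>D \<times> T. (cmod (Rep_ell2 (?w d) t))\<^sup>2)"
    proof (rule sum_mono2)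
      show "Rep_tgt ` F \<subseteq> D \<times> T" unfolding D_def T_def by (rule subset_fst_snd)
    qed (simp_all add: D T case_prod_unfold)
    also have "\<dots> = (\<Sum>d\<in>D. \<Sum>t\<in>T. (cmod (Rep_ell2 (?w d) t))\<^sup>2)"
      by (rule sum.cartesian_product[symmetric])
    also have "\<dots> \<le> (\<Sum>d\<in>D. (norm (src_component d f))\<^sup>2)"
    proof (rule sum_mono)
      fix d assume d: "d \<in> D"
      have "L2_set (\<lambda>t. cmod (Rep_ell2 (?w d) t)) T \<le> norm (?w d)"
        unfolding norm_ell2.rep_eq
        by (rule square_summable_bound[OF _ T]) (use Rep_ell2 in auto)
      also have "\<dots> \<le> norm (src_component d f)"
        using bi_isometries_contractive[of "fst d" "fst (snd d)" "snd (snd d)"]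
          biiso_reps_subset[of d] D d by (auto simp: biiso_op_def)
      finally show "(\<Sum>t\<in>T. (cmod (Rep_ell2 (?w d) t))\<^sup>2) \<le> (norm (src_component d f))\<^sup>2"
        unfolding L2_set_def by (rule sqrt_le_D)
    qed
    also have "\<dots> \<le> (norm f)\<^sup>2" by (rule norm_src_component_sum[OF D])
    finally show ?thesis unfolding L2_set_def by (simp add: real_le_lsqrt sum_nonneg)
  qed
  show "(\<lambda>q. (cmod (u q))\<^sup>2) summable_on UNIV" "sqrt (\<Sum>\<^sub>\<infinity>q. (cmod (u q))\<^sup>2) \<le> norm f"
    using square_summable_if_bounded[OF bound] by blast+
qed

lift_definition direct_sum_map ::
  "'x \<Rightarrow> 'x \<Rightarrow> ('x::finite, 'c) src ell2 \<Rightarrow> ('x, 'c) tgt ell2"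
  is "\<lambda>a x f q. case Rep_tgt q of (d, t) \<Rightarrow> Rep_ell2 (biiso_op d a x *\<^sub>V src_component d f) t"
  by (rule direct_sum_square_summable(1))

lift_definition univ_biiso ::
  "'x \<Rightarrow> 'x \<Rightarrow> (('x::finite, 'c) src ell2, ('x, 'c) tgt ell2) cblinfun"
  is direct_sum_map
proof (intro conjI allI)
  fix a x :: 'x
  show scale: "direct_sum_map a x (c *\<^sub>C f) = c *\<^sub>C direct_sum_map a x f"
    for c and f :: "('x, 'c) src ell2"
    by (rule ell2_eqI)
      (simp add: direct_sum_map.rep_eq scaleC_ell2.rep_eq src_component_linear cblinfun_apply_linear
        split: prod.split)
  have add: "direct_sum_map a x (f + g) = direct_sum_map a x f + direct_sum_map a x g"
    for f g :: "('x, 'c) src ell2"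
    by (rule ell2_eqI)
      (simp add: direct_sum_map.rep_eq plus_ell2.rep_eq src_component_linear cblinfun_apply_linear
        split: prod.split)
  have "norm (direct_sum_map a x f) \<le> norm f" for f :: "('x, 'c) src ell2"
    unfolding norm_ell2.rep_eq[of "direct_sum_map a x f"] direct_sum_map.rep_eq
    by (rule direct_sum_square_summable(2))
  then show "bounded_linear (direct_sum_map a x :: ('x, 'c) src ell2 \<Rightarrow> _)"
    by (intro bounded_linear_intro[where K = 1])
      (simp_all add: add scaleC_of_real[symmetric] scale)
qed

lemma Rep_univ_biiso:
  "Rep_ell2 (univ_biiso a x *\<^sub>V f) q =
    (case Rep_tgt q of (d, t) \<Rightarrow> Rep_ell2 (biiso_op d a x *\<^sub>V src_component d f) t)"
  by (simp add: univ_biiso.rep_eq direct_sum_map.rep_eq)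

lemma cinner_univ_biiso:
  "((\<lambda>d. cinner (biiso_op d a x *\<^sub>V src_component d f) (biiso_op d b y *\<^sub>V src_component d g))
    has_sum cinner (univ_biiso a x *\<^sub>V f) (univ_biiso b y *\<^sub>V g)) biiso_reps"
proof -
  let ?w = "\<lambda>d. biiso_op d a x *\<^sub>V src_component d f"
  let ?z = "\<lambda>d. biiso_op d b y *\<^sub>V src_component d g"
  let ?T = "\<lambda>d. fst (snd d)"
  define G where "G p = (case p of (d, t) \<Rightarrow> cnj (Rep_ell2 (?w d) t) * Rep_ell2 (?z d) t)" for p
  have G: "G (Rep_tgt p) = cnj (Rep_ell2 (univ_biiso a x *\<^sub>V f) p) * Rep_ell2 (univ_biiso b y *\<^sub>V g) p" for p
    by (simp add: G_def Rep_univ_biiso split: prod.split)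
  have s: "G summable_on Sigma biiso_reps ?T"
    using infsum_tgt(2)[of G] ell2_product_summable[of "univ_biiso a x *\<^sub>V f" "univ_biiso b y *\<^sub>V g"]
    by (simp add: G)
  have supp: "coord_proj (?T d) *\<^sub>V ?w d = ?w d" if "d \<in> biiso_reps" for d
    using arg_cong[OF bi_isometries_support(1)[of "fst d" "?T d" "snd (snd d)" a x],
        of "\<lambda>A. A *\<^sub>V src_component d f"] biiso_reps_subset[OF that]
    by (simp add: biiso_op_def)
  have comp: "(\<Sum>\<^sub>\<infinity>t\<in>?T d. G (d, t)) = cinner (?w d) (?z d)" if "d \<in> biiso_reps" for d
    unfolding cinner_ell2.rep_eq
  proof (rule infsum_cong_neutral)
    fix t assume "t \<in> UNIV - ?T d"
    then have "Rep_ell2 (?w d) t = 0"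
      using arg_cong[OF supp[OF that], of "\<lambda>h. Rep_ell2 h t"] by (simp add: Rep_coord_proj)
    then show "cnj (Rep_ell2 (?w d) t) * Rep_ell2 (?z d) t = 0" by simp
  qed (auto simp: G_def)
  have "cinner (univ_biiso a x *\<^sub>V f) (univ_biiso b y *\<^sub>V g) = (\<Sum>\<^sub>\<infinity>p\<in>Sigma biiso_reps ?T. G p)"
    unfolding cinner_ell2.rep_eq using infsum_tgt(1)[of G] by (simp add: G)
  also have "\<dots> = (\<Sum>\<^sub>\<infinity>d\<in>biiso_reps. \<Sum>\<^sub>\<infinity>t\<in>?T d. G (d, t))"
    using infsum_Sigma'_banach[of "\<lambda>d s. G (d, s)"] s by (simp add: case_prod_unfold)
  finally have "cinner (univ_biiso a x *\<^sub>V f) (univ_biiso b y *\<^sub>V g)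
      = (\<Sum>\<^sub>\<infinity>d\<in>biiso_reps. cinner (?w d) (?z d))"
    by (simp add: comp cong: infsum_cong)
  moreover have "(\<lambda>d. \<Sum>\<^sub>\<infinity>s\<in>?T d. G (d, s)) summable_on biiso_reps"
    using summable_on_Sigma_banach[of "\<lambda>d s. G (d, s)" biiso_reps ?T] s by (simp add: case_prod_unfold)
  then have "(\<lambda>d. cinner (?w d) (?z d)) summable_on biiso_reps"
    by (simp add: comp cong: summable_on_cong)
  ultimately show ?thesis by (simp add: has_sum_iff)
qed

lemma has_sum_finite_sum:
  fixes h :: "'i \<Rightarrow> 'd \<Rightarrow> complex"
  assumes "\<And>i. i \<in> A \<Longrightarrow> (h i has_sum l i) D"
  shows "((\<lambda>d. \<Sum>i\<in>A. h i d) has_sum (\<Sum>i\<in>A. l i)) D"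
  using assms by (induction A rule: infinite_finite_induct) (auto intro: has_sum_add)

theorem bi_isometry_univ_biiso:
  "bi_isometry cid cid (univ_biiso :: 'x::finite \<Rightarrow> 'x \<Rightarrow> (('x, 'c) src ell2, ('x, 'c) tgt ell2) cblinfun)"
proof -
  let ?v = "univ_biiso :: 'x \<Rightarrow> 'x \<Rightarrow> (('x, 'c) src ell2, ('x, 'c) tgt ell2) cblinfun"
  have eq: "(\<Sum>i\<in>UNIV. adj (?v (\<alpha> i) (\<beta> i)) o\<^sub>C ?v (\<gamma> i) (\<delta> i)) = (if P then cid else 0)"
    if loc: "\<And>d. d \<in> biiso_reps \<Longrightarrow> (\<Sum>i\<in>UNIV. adj (biiso_op d (\<alpha> i) (\<beta> i)) o\<^sub>C biiso_op d (\<gamma> i) (\<delta> i))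
        = (if P then coord_proj (fst d) else (0 :: ('c ell2, 'c ell2) cblinfun))"
    for \<alpha> \<beta> \<gamma> \<delta> :: "'x \<Rightarrow> 'x" and P
  proof (intro cblinfun_eqI cinner_eqI)
    fix f g :: "('x, 'c) src ell2"
    let ?w = "\<lambda>i d. cinner (biiso_op d (\<alpha> i) (\<beta> i) *\<^sub>V src_component d f)
      (biiso_op d (\<gamma> i) (\<delta> i) *\<^sub>V src_component d g)"
    have "((\<lambda>d. \<Sum>i\<in>UNIV. ?w i d) has_sum
        (\<Sum>i\<in>UNIV. cinner (?v (\<alpha> i) (\<beta> i) *\<^sub>V f) (?v (\<gamma> i) (\<delta> i) *\<^sub>V g))) biiso_reps"
      by (rule has_sum_finite_sum) (rule cinner_univ_biiso)
    moreover have "(\<Sum>i\<in>UNIV. ?w i d)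
        = (if P then cinner (src_component d f) (src_component d g) else 0)" if "d \<in> biiso_reps" for d
    proof -
      have "(\<Sum>i\<in>UNIV. ?w i d) = cinner (src_component d f)
          ((\<Sum>i\<in>UNIV. adj (biiso_op d (\<alpha> i) (\<beta> i)) o\<^sub>C biiso_op d (\<gamma> i) (\<delta> i)) *\<^sub>V src_component d g)"
        by (simp add: cblinfun_sum_apply cinner_sum_right cinner_adj_right)
      then show ?thesis by (simp add: loc[OF that] coord_proj_src_component)
    qed
    ultimately have "((\<lambda>d. if P then cinner (src_component d f) (src_component d g) else 0) has_sum
        (\<Sum>i\<in>UNIV. cinner (?v (\<alpha> i) (\<beta> i) *\<^sub>V f) (?v (\<gamma> i) (\<delta> i) *\<^sub>V g))) biiso_reps"
      by (simp cong: has_sum_cong)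
    moreover have "((\<lambda>d. if P then cinner (src_component d f) (src_component d g) else 0) has_sum
        (if P then cinner f g else 0)) biiso_reps"
      using cinner_src[of f g] by simp
    ultimately have "(\<Sum>i\<in>UNIV. cinner (?v (\<alpha> i) (\<beta> i) *\<^sub>V f) (?v (\<gamma> i) (\<delta> i) *\<^sub>V g))
        = (if P then cinner f g else 0)"
      by (rule has_sum_unique)
    then show "cinner f ((\<Sum>i\<in>UNIV. adj (?v (\<alpha> i) (\<beta> i)) o\<^sub>C ?v (\<gamma> i) (\<delta> i)) *\<^sub>V g)
        = cinner f ((if P then cid else 0) *\<^sub>V g)"
      by (simp add: cblinfun_sum_apply cinner_sum_right cinner_adj_right)
  qed
  have loc: "(\<Sum>a\<in>UNIV. adj (biiso_op d a x) o\<^sub>C biiso_op d a x') = (if x = x' then coord_proj (fst d) else 0)"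
    "(\<Sum>y\<in>UNIV. adj (biiso_op d a y) o\<^sub>C biiso_op d a' y) = (if a = a' then coord_proj (fst d) else 0)"
    if "d \<in> biiso_reps" for d :: "('x, 'c) biiso_data" and x x' a a'
    using biiso_reps_subset[OF that]
    by (auto simp: biiso_op_def bi_isometries_def bi_isometry_def split: prod.splits)
  have "cid o\<^sub>C ?v a x o\<^sub>C cid = ?v a x" for a x by (rule cblinfun_eqI) simp
  then show ?thesis
    unfolding bi_isometry_def
    using eq[of "\<lambda>a. a" "\<lambda>_. x" "\<lambda>a. a" "\<lambda>_. x'" "x = x'" for x x', OF loc(1)]
      eq[of "\<lambda>_. a" "\<lambda>y. y" "\<lambda>_. a'" "\<lambda>y. y" "a = a'" for a a', OF loc(2)]
    by blast
qed

section \<open>The C*-algebra and the operator system of the universal bi-isometry\<close>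

text \<open>The infinite type \<open>'c\<close> is the cardinal bounding the dimensions in the universal bi-isometry. As
  \<open>'x\<close> is finite, every infinite cardinal is sufficiently large.\<close>

type_synonym ('x, 'c) univ_op = "(('x, 'c) src ell2, ('x, 'c) src ell2) cblinfun"

definition V_X :: "(('x::finite, 'c::infinite) src ell2, ('x, 'c) tgt ell2) cblinfun set"
  where "V_X = tro hull {univ_biiso a x | a x. True}"

definition C_X :: "('x::finite, 'c::infinite) univ_op set"
  where "C_X = right_cstar_algebra V_X"

definition e_X :: "'x \<Rightarrow> 'x \<Rightarrow> 'x \<Rightarrow> 'x \<Rightarrow> ('x::finite, 'c::infinite) univ_op"
  where "e_X x x' a a' = adj (univ_biiso a x) o\<^sub>C univ_biiso a' x'"

definition T_X :: "('x::finite, 'c::infinite) univ_op set"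
  where "T_X = cspan {e_X x x' a a' | x x' a a'. True}"

end

theory Submission
  imports Defs
begin

text \<open>Why the theorem holds. The Gram matrix of the \<open>v\<^sub>a\<^sub>,\<^sub>x\<close> is positive and, because \<open>v\<close> is a
  bi-isometry, its partial sums over \<open>a = a'\<close> and over \<open>x = x'\<close> are \<open>\<delta>\<close> times
  the identity; both properties pass to the images
  under a linear map \<open>\<phi>\<close> of the kind considered: positivity by complete positivity, applied to the one
  matrix \<open>(e)\<close>, and the partial sums by linearity alone. So (i) implies (ii), (i') implies (ii'),
  and for (iii) implies (ii) one needs in addition that a *-representation of \<open>C\<close> preserves positivity
  of matrices over \<open>C\<close>; this follows from the existence of a square root of such a matrix inside
  \<open>M\<^sub>I(C)\<close> (\<open>positive_op_sqrt\<close>, \<open>star_representation_block_positive\<close>).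

  The substance is the converse. A bistochastic matrix \<open>E\<close> on \<open>H\<close> is positive, hence of the form
  \<open>E = V\<^sup>*V\<close>, and \<open>V\<close> is a bi-isometry because the partial sums of \<open>E\<close> are those of a bistochastic matrix. The space \<open>H\<close>
  can be of arbitrary dimension, while \<open>v\<close> only contains bi-isometries between subspaces of
  \<open>\<ell>\<^sup>2('c)\<close>. But any countable set of vectors of \<open>H\<close> lies in a separable subspace that is invariant under
  all entries of \<open>E\<close>, and the compression of \<open>V\<close> to it is unitarily equivalent to a summand of \<open>v\<close>.
  This gives a supply of contractions \<open>Y\<close> with \<open>Y e = E Y\<close> for all indices (intertwiners), such that
  every sequence in \<open>H\<close> is fixed by \<open>Y Y\<^sup>*\<close> for one of them (\<open>bistochastic_intertwiner\<close>).

  These intertwiners define the representation: say that \<open>t\<close> is intertwined with \<open>s\<close> if \<open>Y t = s Y\<close> and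
  \<open>Y t\<^sup>* = s\<^sup>* Y\<close> for all of them. Since every vector is in the range of an intertwiner,
  \<open>s\<close> is unique and \<open>\<parallel>s\<parallel> \<le> \<parallel>t\<parallel>\<close>; hence those \<open>t\<close> that have a partner form a C*-algebra
  that contains all \<open>e\<close>, and therefore all of \<open>C\<close>. Uniqueness makes \<open>t \<mapsto> s\<close> a *-representation, and
  \<open>s = Y t Y\<^sup>*\<close> on the finitely many vectors involved makes it positive on matrices
  (\<open>block_positive_induced_rep\<close>). That settles (ii) implies (i) and (iii), the universal property and the
  existence of \<open>\<phi>\<close>.

  Finally (ii') implies (i') is reduced to the unital case. The partial sums of \<open>(\<phi>(e))\<close> are
  \<open>\<delta> \<phi>(1)\<close>. After adding \<open>\<epsilon>\<close> times a fixed unital completely positive map, \<open>\<phi>(1)\<close>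
  becomes invertible, and conjugating with the inverse of its square root gives a bistochastic matrix.
  The conclusion for \<open>\<phi>\<close> follows by letting \<open>\<epsilon>\<close> tend to \<open>0\<close>.\<close>

section \<open>The calculus of bounded operators\<close>

lemma ccompose_linear:
  "(R + S) o\<^sub>C T = R o\<^sub>C T + S o\<^sub>C T" "T o\<^sub>C (R' + S') = T o\<^sub>C R' + T o\<^sub>C S'"
  "(R - S) o\<^sub>C T = R o\<^sub>C T - S o\<^sub>C T" "T o\<^sub>C (R' - S') = T o\<^sub>C R' - T o\<^sub>C S'"
  "(c *\<^sub>C R) o\<^sub>C T = c *\<^sub>C (R o\<^sub>C T)" "T o\<^sub>C (c *\<^sub>C R') = c *\<^sub>C (T o\<^sub>C R')"
  by (rule cblinfun_eqI, simp add: cblinfun_apply_linear)+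

lemma ccompose_simps [simp]:
  "0 o\<^sub>C T = 0" "T o\<^sub>C 0 = 0" "cid o\<^sub>C T = T" "T o\<^sub>C cid = T"
  by (rule cblinfun_eqI, simp add: cblinfun_apply_linear)+

lemma ccompose_sum:
  "(\<Sum>i\<in>I. S i) o\<^sub>C T = (\<Sum>i\<in>I. S i o\<^sub>C T)" "T o\<^sub>C (\<Sum>i\<in>I. R i) = (\<Sum>i\<in>I. T o\<^sub>C R i)"
  by (induction I rule: infinite_finite_induct) (simp_all add: ccompose_linear)

lemma adj_linear:
  "adj (S + T) = adj S + adj T" "adj (S - T) = adj S - adj T" "adj (c *\<^sub>C T) = cnj c *\<^sub>C adj T"
  by (rule adj_eqI, simp add: cinner_adj_left cinner_add_left cinner_diff_left cinner_scaleC_left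
      cinner_add_right cinner_diff_right cinner_scaleC_right)+

lemma adj_simps [simp]: "adj 0 = 0" "adj cid = cid"
  by (rule adj_eqI, simp)+

lemma norm_cblinfun_le:
  assumes "B \<ge> 0" "\<And>x. norm (T *\<^sub>V x) \<le> B * norm x"
  shows "norm T \<le> B"
  using assms by transfer (rule onorm_bound)

lemma norm_ccompose: "norm (S o\<^sub>C T) \<le> norm S * norm T"
proof (rule norm_cblinfun_le)
  fix x
  have "norm (S *\<^sub>V T *\<^sub>V x) \<le> norm S * norm (T *\<^sub>V x)" by (rule norm_cblinfun)
  also have "\<dots> \<le> norm S * (norm T * norm x)" by (intro mult_left_mono norm_cblinfun) simp
  finally show "norm ((S o\<^sub>C T) *\<^sub>V x) \<le> norm S * norm T * norm x" by (simp add: mult.assoc)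
qed simp

lemma norm_adj_le: "norm (adj T) \<le> norm T"
proof (rule norm_cblinfun_le)
  fix y
  let ?x = "adj T *\<^sub>V y"
  have "(norm ?x)\<^sup>2 = cmod (cinner y (T *\<^sub>V ?x))"
    by (simp flip: cinner_adj_left add: cinner_self norm_power)
  also have "\<dots> \<le> norm y * norm (T *\<^sub>V ?x)" by (rule cauchy_schwarz_cinner)
  also have "\<dots> \<le> norm y * (norm T * norm ?x)" by (intro mult_left_mono norm_cblinfun) simp
  finally have "norm ?x * norm ?x \<le> (norm T * norm y) * norm ?x"
    by (simp add: power2_eq_square mult_ac)
  then show "norm ?x \<le> norm T * norm y"
    by (cases "norm ?x = 0") (auto simp: mult_le_cancel_right)
qed simp

lemma norm_scaleC_cblinfun: "norm (c *\<^sub>C (T :: ('a::complex_inner, 'b::complex_inner) cblinfun)) = cmod c * norm T"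
proof -
  have le: "norm (c *\<^sub>C T) \<le> cmod c * norm T" for c and T :: "('a, 'b) cblinfun"
    by (rule norm_cblinfun_le)
      (simp_all add: norm_scaleC mult.assoc mult_left_mono norm_cblinfun)
  show ?thesis
  proof (cases "c = 0")
    case False
    have "norm T \<le> norm (c *\<^sub>C T) / cmod c"
      using le[of "inverse c" "c *\<^sub>C T"] False by (simp add: scaleC_scaleC norm_inverse divide_inverse mult.commute)
    then have "cmod c * norm T \<le> norm (c *\<^sub>C T)" using False by (simp add: field_simps)
    with le[of c T] show ?thesis by linarith
  qed simp
qed

lemma bounded_linear_ccompose_left: "bounded_linear (\<lambda>T. S o\<^sub>C T)"
proof (rule bounded_linear_intro[where K = "norm S"])
  show "norm (S o\<^sub>C T) \<le> norm T * norm S" for T using norm_ccompose[of S T] by (simp add: mult.commute)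
qed (simp_all add: ccompose_linear flip: scaleC_of_real)

lemma bounded_linear_ccompose_right: "bounded_linear (\<lambda>T. T o\<^sub>C S)"
  by (rule bounded_linear_intro[where K = "norm S"])
    (simp_all add: ccompose_linear norm_ccompose flip: scaleC_of_real)

lemma bounded_linear_adj: "bounded_linear adj"
  by (rule bounded_linear_intro[where K = 1])
    (simp_all add: adj_linear norm_adj_le flip: scaleC_of_real)

lemma bounded_linear_scaleC_cblinfun:
  "bounded_linear (\<lambda>T. c *\<^sub>C (T :: ('a::complex_inner, 'b::complex_inner) cblinfun))"
  by (rule bounded_linear_intro[where K = "cmod c"])
    (simp_all add: scaleC_add_right scaleC_scaleR_commute norm_scaleC_cblinfun)

lemma tendsto_ccompose:
  assumes "(S \<longlongrightarrow> S') F" "(T \<longlongrightarrow> T') F"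
  shows "((\<lambda>n. S n o\<^sub>C T n) \<longlongrightarrow> S' o\<^sub>C T') F"
proof -
  have "bounded_bilinear (\<lambda>S T. S o\<^sub>C T)"
    by (rule bounded_bilinear.intro)
      (auto simp: ccompose_linear norm_ccompose simp flip: scaleC_of_real intro!: exI[of _ 1])
  then show ?thesis using assms by (rule bounded_bilinear.tendsto)
qed

text \<open>Completeness is inherited from the Banach space of bounded real-linear maps, since a limit of
  complex-linear maps is complex-linear.\<close>

instance cblinfun :: (complex_inner, chilbert_space) banach
proof
  fix X :: "nat \<Rightarrow> ('a, 'b) cblinfun"
  assume X: "Cauchy X"
  define Y where "Y n = Blinfun (cblinfun_apply (X n))" for n
  have bl: "bounded_linear (cblinfun_apply T)" for T :: "('a, 'b) cblinfun"
    using cblinfun_apply[of T] by simp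
  have Y: "blinfun_apply (Y n) = cblinfun_apply (X n)" for n
    unfolding Y_def by (rule bounded_linear_Blinfun_apply[OF bl])
  have dY: "norm (Y n - Blinfun (cblinfun_apply T)) = norm (X n - T)" for n T
  proof -
    have "blinfun_apply (Y n - Blinfun (cblinfun_apply T)) = cblinfun_apply (X n - T)"
      by (simp add: fun_eq_iff Y blinfun.diff_left bounded_linear_Blinfun_apply[OF bl])
    then show ?thesis by (simp add: norm_blinfun.rep_eq norm_cblinfun.rep_eq)
  qed
  have "Cauchy Y"
    using X dY[of _ "X _"] unfolding Cauchy_def dist_norm Y_def by simp
  then obtain L where L: "Y \<longlonglongrightarrow> L" using Cauchy_convergent convergent_def by blast
  have pt: "(\<lambda>n. X n *\<^sub>V x) \<longlonglongrightarrow> blinfun_apply L x" for x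
    using blinfun.tendsto[OF L tendsto_const, of x] by (simp add: Y)
  have "blinfun_apply L (c *\<^sub>C x) = c *\<^sub>C blinfun_apply L x" for c x
  proof (rule LIMSEQ_unique)
    show "(\<lambda>n. X n *\<^sub>V (c *\<^sub>C x)) \<longlonglongrightarrow> c *\<^sub>C blinfun_apply L x"
      unfolding cblinfun_apply_linear by (rule bounded_linear.tendsto[OF bounded_linear_scaleC pt])
  qed (rule pt)
  then have Z: "cblinfun_apply (Abs_cblinfun (blinfun_apply L)) = blinfun_apply L"
    by (simp add: Abs_cblinfun_inverse blinfun.bounded_linear_right)
  have "X \<longlonglongrightarrow> Abs_cblinfun (blinfun_apply L)"
    using L dY[of _ "Abs_cblinfun (blinfun_apply L)"]
    by (simp add: Z blinfun_apply_inverse tendsto_iff dist_norm)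
  then show "convergent X" by (auto simp: convergent_def)
qed

section \<open>Positive operators and their square roots\<close>

definition positive_op :: "('h::chilbert_space, 'h) cblinfun \<Rightarrow> bool"
  where "positive_op G \<longleftrightarrow> (\<forall>\<xi>. cinner \<xi> (G *\<^sub>V \<xi>) \<in> \<real>\<^sub>\<ge>\<^sub>0)"

text \<open>Polarization: over the complex numbers, a real quadratic form comes from a self-adjoint operator.\<close>

lemma positive_op_selfadjoint:
  assumes "positive_op G"
  shows "adj G = G"
proof (rule adj_eqI)
  fix x y
  let ?q = "\<lambda>u v. cinner (G *\<^sub>V u) v - cinner u (G *\<^sub>V v)"
  have "cinner \<xi> (G *\<^sub>V \<xi>) \<in> \<real>" for \<xi>
    using assms nonneg_Reals_subset_Reals unfolding positive_op_def by blast
  then have q: "?q \<xi> \<xi> = 0" for \<xi>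
    by (metis Reals_cnj_iff cinner_commute diff_self)
  have 1: "?q y x + ?q x y = 0"
    using q[of "x + y"] q[of x] q[of y]
    by (simp add: cblinfun_apply_linear cinner_add_left cinner_add_right algebra_simps)
  have "\<i> * ?q y x - \<i> * ?q x y = 0"
    using q[of "y + \<i> *\<^sub>C x"] q[of x] q[of y]
    by (simp add: cblinfun_apply_linear cinner_add_left cinner_add_right cinner_scaleC_left
        cinner_scaleC_right algebra_simps)
  then have "?q y x = ?q x y" by (simp flip: right_diff_distrib)
  with 1 have "?q y x = 0" by simp
  then show "cinner (G *\<^sub>V y) x = cinner y (G *\<^sub>V x)" by simp
qed

text \<open>Evaluating the positive form at \<open>\<xi> - G \<xi> / c\<close> gives \<open>\<parallel>G \<xi>\<parallel>\<^sup>2 \<le> c \<langle>\<xi>, G \<xi>\<rangle>\<close>, which turns the expansion of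
  the square on the left into the bound on the right. Two consequences are used: \<open>1 - G/c\<close> is always a
  contraction, and a strict one if \<open>G\<close> is bounded below.\<close>

lemma positive_op_contraction:
  assumes G: "positive_op G" and c: "norm G \<le> c" "c > 0"
  shows "(norm (\<xi> - complex_of_real (1 / c) *\<^sub>C (G *\<^sub>V \<xi>)))\<^sup>2 \<le> (norm \<xi>)\<^sup>2 - Re (cinner \<xi> (G *\<^sub>V \<xi>)) / c"
proof -
  let ?g = "G *\<^sub>V \<xi>" let ?t = "complex_of_real (1 / c)"
  have sym: "cinner \<xi> (G *\<^sub>V ?g) = cinner ?g ?g"
    using cinner_adj_left[of G \<xi> ?g] positive_op_selfadjoint[OF G] by simp
  have "0 \<le> Re (cinner (\<xi> - ?t *\<^sub>C ?g) (G *\<^sub>V (\<xi> - ?t *\<^sub>C ?g)))"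
    using G unfolding positive_op_def complex_nonneg_Reals_iff by blast
  also have "\<dots> = Re (cinner \<xi> ?g) - 2 / c * (norm ?g)\<^sup>2 + 1 / c\<^sup>2 * Re (cinner ?g (G *\<^sub>V ?g))"
    by (simp add: cblinfun_apply_linear cinner_diff_left cinner_diff_right cinner_scaleC_left
        cinner_scaleC_right sym cinner_self power2_eq_square diff_divide_distrib)
  also have "Re (cinner ?g (G *\<^sub>V ?g)) \<le> c * (norm ?g)\<^sup>2"
  proof -
    have "Re (cinner ?g (G *\<^sub>V ?g)) \<le> norm ?g * norm (G *\<^sub>V ?g)"
      using cauchy_schwarz_cinner[of ?g "G *\<^sub>V ?g"] complex_Re_le_cmod order_trans by blast
    also have "\<dots> \<le> norm ?g * (c * norm ?g)"
      using norm_cblinfun[of G ?g] c by (intro mult_left_mono) (auto intro: order_trans[OF _ mult_right_mono])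
    finally show ?thesis by (simp add: power2_eq_square mult_ac)
  qed
  finally have le: "(norm ?g)\<^sup>2 / c \<le> Re (cinner \<xi> ?g)"
    using c by (simp add: field_simps power2_eq_square mult_left_mono)
  have "(norm (\<xi> - ?t *\<^sub>C ?g))\<^sup>2 = (norm \<xi>)\<^sup>2 + (norm ?g)\<^sup>2 / c / c - 2 * Re (cinner \<xi> ?g) / c"
  proof -
    have "norm (?t *\<^sub>C ?g) = norm ?g / c" using c by (simp add: norm_scaleC norm_divide)
    moreover have "Re (cinner \<xi> (?t *\<^sub>C ?g)) = Re (cinner \<xi> ?g) / c" by (simp add: cinner_scaleC_right)
    ultimately show ?thesis unfolding norm_diff_square by (simp add: power_divide power2_eq_square)
  qed
  also have "\<dots> \<le> (norm \<xi>)\<^sup>2 + Re (cinner \<xi> ?g) / c - 2 * Re (cinner \<xi> ?g) / c"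
    using le c by (intro diff_right_mono add_left_mono divide_right_mono) auto
  finally show ?thesis by simp
qed

lemma unital_cstar_algebraD:
  assumes "unital_cstar_algebra A"
  shows "csubspace A" "closed A" "cid \<in> A" "S \<in> A \<Longrightarrow> T \<in> A \<Longrightarrow> S o\<^sub>C T \<in> A" "T \<in> A \<Longrightarrow> adj T \<in> A"
    "0 \<in> A" "S \<in> A \<Longrightarrow> T \<in> A \<Longrightarrow> S + T \<in> A" "S \<in> A \<Longrightarrow> T \<in> A \<Longrightarrow> S - T \<in> A" "T \<in> A \<Longrightarrow> c *\<^sub>C T \<in> A"
    "(\<And>i. i \<in> I \<Longrightarrow> f i \<in> A) \<Longrightarrow> sum f I \<in> A"
proof -
  note A = assms[unfolded unital_cstar_algebra_def]
  show "csubspace A" "closed A" "cid \<in> A" "S \<in> A \<Longrightarrow> T \<in> A \<Longrightarrow> S o\<^sub>C T \<in> A" "T \<in> A \<Longrightarrow> adj T \<in> A"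
    using A by blast+
  then show "0 \<in> A" "S \<in> A \<Longrightarrow> T \<in> A \<Longrightarrow> S + T \<in> A" "S \<in> A \<Longrightarrow> T \<in> A \<Longrightarrow> S - T \<in> A"
    "T \<in> A \<Longrightarrow> c *\<^sub>C T \<in> A" "(\<And>i. i \<in> I \<Longrightarrow> f i \<in> A) \<Longrightarrow> sum f I \<in> A"
    by (auto intro: complex_vector.subspace_0 complex_vector.subspace_add
        complex_vector.subspace_diff complex_vector.subspace_scale complex_vector.subspace_sum)
qed

text \<open>A solution of \<open>(1 - y)\<^sup>2 = 1 - x\<close> is a fixed point of \<open>y \<mapsto> (x + y\<^sup>2)/2\<close>. If \<open>\<parallel>x\<parallel> = 1\<close> this map need not be
  a strict contraction near the fixed point, so its iterates \<open>y\<^sub>n\<close> are compared with the iterates \<open>\<eta>\<^sub>n\<close> of the real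
  map \<open>t \<mapsto> (1 + t\<^sup>2)/2\<close>, which increase and are bounded by \<open>1\<close>: the increments satisfy
  \<open>\<parallel>y\<^sub>n\<^sub>+\<^sub>1 - y\<^sub>n\<parallel> \<le> \<eta>\<^sub>n\<^sub>+\<^sub>1 - \<eta>\<^sub>n\<close>.\<close>

lemma sqrt_iteration_converges:
  fixes x :: "('h::chilbert_space, 'h) cblinfun"
  assumes A: "unital_cstar_algebra A" and x: "x \<in> A" "adj x = x" "norm x \<le> 1"
  shows "\<exists>y\<in>A. adj y = y \<and> (cid - y) o\<^sub>C (cid - y) = cid - x"
proof -
  define y where "y = rec_nat 0 (\<lambda>n z. (1/2) *\<^sub>C (x + z o\<^sub>C z))"
  have y: "y 0 = 0" "y (Suc n) = (1/2) *\<^sub>C (x + y n o\<^sub>C y n)" for n by (simp_all add: y_def)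
  define \<eta> where "\<eta> = rec_nat (0::real) (\<lambda>n t. (1 + t\<^sup>2) / 2)"
  have \<eta>: "\<eta> 0 = 0" "\<eta> (Suc n) = (1 + (\<eta> n)\<^sup>2) / 2" for n by (simp_all add: \<eta>_def)
  have \<eta>b: "0 \<le> \<eta> n \<and> \<eta> n \<le> 1" for n
  proof (induction n)
    case (Suc n)
    then have "(\<eta> n)\<^sup>2 \<le> 1" by (simp add: power_le_one)
    then show ?case by (simp add: \<eta>(2))
  qed (simp add: \<eta>(1))
  have yA: "y n \<in> A \<and> adj (y n) = y n" for n
    by (induction n)
      (auto simp: y x adj_linear adj_ccompose intro!: unital_cstar_algebraD[OF A])
  have half: "norm ((1/2::complex) *\<^sub>C T) = norm T / 2" for T :: "('h, 'h) cblinfun"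
    by (simp add: norm_scaleC_cblinfun)
  have yn: "norm (y n) \<le> \<eta> n" for n
  proof (induction n)
    case (Suc n)
    have "norm (y n o\<^sub>C y n) \<le> \<eta> n * \<eta> n"
      using norm_ccompose[of "y n" "y n"] mult_mono[OF Suc Suc] \<eta>b[of n] by (simp add: order_trans)
    then show ?case
      using norm_triangle_ineq[of x "y n o\<^sub>C y n"] x(3)
      by (simp add: y(2) half \<eta>(2) power2_eq_square)
  qed (simp add: y \<eta>)
  have step: "norm (y (Suc n) - y n) \<le> \<eta> (Suc n) - \<eta> n" for n
  proof (induction n)
    case 0
    then show ?case using x(3) by (simp add: y \<eta> half)
  next
    case (Suc n)
    let ?d = "y (Suc n) - y n"
    \<comment> \<open>\<open>b\<^sup>2 - a\<^sup>2 = b (b - a) + (b - a) a\<close> holds without commutativity.\<close>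
    have "y (Suc (Suc n)) - y (Suc n) = (1/2) *\<^sub>C (y (Suc n) o\<^sub>C ?d + ?d o\<^sub>C y n)"
      unfolding y(2)[of "Suc n"] y(2)[of n, THEN arg_cong, of "\<lambda>t. _ - t"]
      by (simp add: ccompose_linear flip: complex_vector.scale_right_diff_distrib)
    also have "norm \<dots> \<le> (norm (y (Suc n)) * norm ?d + norm ?d * norm (y n)) / 2"
      unfolding half
      using norm_triangle_ineq[of "y (Suc n) o\<^sub>C ?d" "?d o\<^sub>C y n"]
        norm_ccompose[of "y (Suc n)" ?d] norm_ccompose[of ?d "y n"] by simp
    also have "\<dots> \<le> (\<eta> (Suc n) * (\<eta> (Suc n) - \<eta> n) + (\<eta> (Suc n) - \<eta> n) * \<eta> n) / 2"
      using Suc yn[of n] yn[of "Suc n"] \<eta>b[of n] \<eta>b[of "Suc n"] norm_ge_zero[of ?d]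
      by (intro divide_right_mono add_mono mult_mono) (linarith | simp)+
    also have "\<dots> = \<eta> (Suc (Suc n)) - \<eta> (Suc n)"
      by (simp only: \<eta>(2)[of "Suc n"]) (simp add: \<eta>(2)[of n] power2_eq_square field_simps)
    finally show ?case .
  qed
  have tel: "norm (y (n + k) - y n) \<le> \<eta> (n + k) - \<eta> n" for n k
  proof (induction k)
    case (Suc k)
    have "norm (y (n + Suc k) - y n) \<le> norm (y (Suc (n + k)) - y (n + k)) + norm (y (n + k) - y n)"
      using norm_triangle_ineq[of "y (Suc (n + k)) - y (n + k)" "y (n + k) - y n"] by simp
    then show ?case using Suc step[of "n + k"] by simp
  qed simp
  have "incseq \<eta>"
    by (rule incseq_SucI) (use step norm_ge_zero order_trans diff_ge_0_iff_ge in blast)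
  then have "convergent \<eta>"
    using \<eta>b incseq_convergent[of \<eta> 1] unfolding convergent_def by blast
  then have C\<eta>: "Cauchy \<eta>" by (rule convergent_Cauchy)
  have "Cauchy y"
  proof (rule metric_CauchyI)
    fix e :: real assume "e > 0"
    then obtain N where N: "\<And>m n. m \<ge> N \<Longrightarrow> n \<ge> N \<Longrightarrow> \<bar>\<eta> m - \<eta> n\<bar> < e"
      using C\<eta> unfolding Cauchy_def dist_real_def by blast
    have *: "norm (y m - y n) < e" if "m \<ge> n" "n \<ge> N" for m n
      using tel[of n "m - n"] N[of m n] that by simp
    have "norm (y m - y n) < e" if "m \<ge> N" "n \<ge> N" for m n
      using *[of m n] *[of n m] that by (cases "m \<ge> n") (auto simp: norm_minus_commute)
    then show "\<exists>M. \<forall>m\<ge>M. \<forall>n\<ge>M. dist (y m) (y n) < e" unfolding dist_norm by blast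
  qed
  then obtain z where z: "y \<longlonglongrightarrow> z" using Cauchy_convergent convergent_def by blast
  have "z \<in> A"
    using closed_sequentially[OF unital_cstar_algebraD(2)[OF A] _ z] yA by blast
  moreover have "adj z = z"
  proof (rule LIMSEQ_unique[OF _ z])
    show "y \<longlonglongrightarrow> adj z" using bounded_linear.tendsto[OF bounded_linear_adj z] yA by simp
  qed
  moreover have "z = (1/2) *\<^sub>C (x + z o\<^sub>C z)"
  proof (rule LIMSEQ_unique)
    show "(\<lambda>n. y (Suc n)) \<longlonglongrightarrow> z" using z by (rule LIMSEQ_Suc)
    show "(\<lambda>n. y (Suc n)) \<longlonglongrightarrow> (1/2) *\<^sub>C (x + z o\<^sub>C z)" unfolding y(2)
      by (intro bounded_linear.tendsto[OF bounded_linear_scaleC_cblinfun] tendsto_add tendsto_const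
          tendsto_ccompose z)
  qed
  then have "z + z = x + z o\<^sub>C z"
  proof -
    have "z + z = (1 + 1) *\<^sub>C z" unfolding scaleC_add_left by simp
    also have "\<dots> = (1 + 1) *\<^sub>C ((1/2) *\<^sub>C (x + z o\<^sub>C z))"
      using \<open>z = (1/2) *\<^sub>C (x + z o\<^sub>C z)\<close> by (rule arg_cong)
    finally show ?thesis by (simp add: scaleC_scaleC)
  qed
  then have "(cid - z) o\<^sub>C (cid - z) = cid - x"
    by (simp add: ccompose_linear algebra_simps)
  ultimately show ?thesis by blast
qed

text \<open>Square roots have to be found inside a given C*-algebra, because they are needed in \<open>M\<^sub>I(C)\<close>. They are
  constructed as norm limits of polynomials, without spectral theory.\<close>

lemma positive_op_sqrt:
  assumes A: "unital_cstar_algebra A" and G: "G \<in> A" "positive_op G"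
  shows "\<exists>S\<in>A. adj S = S \<and> S o\<^sub>C S = G"
proof -
  \<comment> \<open>The summand \<open>1\<close> keeps \<open>c\<close> positive when \<open>G = 0\<close>.\<close>
  define c where "c = norm G + 1"
  have c: "c > 0" "norm G \<le> c" by (simp_all add: c_def add_nonneg_pos)
  let ?x = "cid - complex_of_real (1 / c) *\<^sub>C G"
  have "(norm (?x *\<^sub>V \<xi>))\<^sup>2 \<le> (norm \<xi>)\<^sup>2" for \<xi>
  proof -
    have "Re (cinner \<xi> (G *\<^sub>V \<xi>)) / c \<ge> 0"
      using G(2) c(1) by (simp add: positive_op_def complex_nonneg_Reals_iff)
    moreover have *: "?x *\<^sub>V \<xi> = \<xi> - complex_of_real (1 / c) *\<^sub>C (G *\<^sub>V \<xi>)" by simp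
    ultimately show ?thesis
      unfolding * using positive_op_contraction[OF G(2) c(2,1), of \<xi>] by linarith
  qed
  then have "norm (?x *\<^sub>V \<xi>) \<le> 1 * norm \<xi>" for \<xi>
    unfolding mult_1_left using power2_le_imp_le norm_ge_zero by blast
  then have "norm ?x \<le> 1" by (rule norm_cblinfun_le[OF zero_le_one])
  moreover have "?x \<in> A" using G(1) by (intro unital_cstar_algebraD(3,8,9)[OF A])
  moreover have "adj ?x = ?x" by (simp add: adj_linear positive_op_selfadjoint[OF G(2)])
  ultimately obtain y where y: "y \<in> A" "adj y = y" "(cid - y) o\<^sub>C (cid - y) = cid - ?x"
    using sqrt_iteration_converges[OF A] by blast
  let ?S = "complex_of_real (sqrt c) *\<^sub>C (cid - y)"
  have "?S o\<^sub>C ?S = complex_of_real (sqrt c * sqrt c) *\<^sub>C (cid - ?x)"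
    unfolding y(3)[symmetric]
    by (simp only: ccompose_linear(5,6) scaleC_scaleC of_real_mult)
  also have "\<dots> = complex_of_real c *\<^sub>C (complex_of_real (1 / c) *\<^sub>C G)"
    using c(1) by simp
  also have "\<dots> = G" unfolding scaleC_scaleC of_real_mult[symmetric] using c(1) by simp
  finally have "?S o\<^sub>C ?S = G" .
  moreover have "?S \<in> A" using y(1) by (intro unital_cstar_algebraD(3,8,9)[OF A])
  moreover have "adj ?S = ?S" using y(2) by (simp add: adj_linear)
  ultimately show ?thesis by blast
qed

lemma unital_cstar_algebra_UNIV: "unital_cstar_algebra UNIV"
  by (simp add: unital_cstar_algebra_def)

section \<open>Finite Hilbert sums and operator matrices\<close>

text \<open>The Hilbert sum \<open>H\<^sup>I\<close> over a finite type \<open>I\<close>. Its norm is already the Euclidean one.\<close>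

instantiation vec :: (complex_vector, finite) complex_vector
begin

definition scaleC_vec :: "complex \<Rightarrow> 'a ^ 'b \<Rightarrow> 'a ^ 'b"
  where "scaleC_vec c v = (\<chi> i. c *\<^sub>C v $ i)"

instance
  by standard (simp_all add: scaleC_vec_def vec_eq_iff scaleC_add_right scaleC_add_left
      scaleC_scaleC scaleC_of_real)

end

lemma scaleC_vec_nth [simp]: "(c *\<^sub>C v) $ i = c *\<^sub>C v $ i"
  by (simp add: scaleC_vec_def)

instantiation vec :: (complex_inner, finite) complex_inner
begin

definition cinner_vec :: "'a ^ 'b \<Rightarrow> 'a ^ 'b \<Rightarrow> complex"
  where "cinner_vec u v = (\<Sum>i\<in>UNIV. cinner (u $ i) (v $ i))"

instance
proof
  fix u v w :: "'a ^ 'b" and c :: complex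
  show "cinner u v = cnj (cinner v u)"
    unfolding cinner_vec_def cnj_sum by (rule sum.cong) (simp_all flip: cinner_commute)
  show "cinner u (v + w) = cinner u v + cinner u w"
    by (simp add: cinner_vec_def cinner_add_right sum.distrib)
  show "cinner u (c *\<^sub>C v) = c * cinner u v"
    by (simp add: cinner_vec_def cinner_scaleC_right sum_distrib_left)
  show "norm u = sqrt (Re (cinner u u))"
    by (simp add: norm_vec_def L2_set_def cinner_vec_def cinner_self)
qed

end

instance vec :: (chilbert_space, finite) chilbert_space ..

lift_definition coord :: "'i \<Rightarrow> ('h::complex_inner ^ 'i::finite, 'h) cblinfun" is "\<lambda>i v. v $ i"
  by (simp add: bounded_linear_vec_nth)

lemma coord_apply [simp]: "coord i *\<^sub>V v = v $ i"
  by transfer simp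

text \<open>The adjoint of a coordinate map is the inclusion of the corresponding summand.\<close>

lemma adj_coord_apply: "(adj (coord i) *\<^sub>V h) $ j = (if i = j then h else 0)"
proof -
  define a where "a = (\<chi> k. if k = i then h else 0)"
  have "adj (coord i) *\<^sub>V h = a"
  proof (rule cinner_eqI)
    fix v
    have "cinner v a = (\<Sum>k\<in>UNIV. if k = i then cinner (v $ k) h else 0)"
      unfolding cinner_vec_def a_def by (rule sum.cong) auto
    then show "cinner v (adj (coord i) *\<^sub>V h) = cinner v a"
      by (simp add: cinner_adj_right)
  qed
  then show ?thesis by (simp add: a_def)
qed

lemma coord_adj_coord: "coord i o\<^sub>C adj (coord j) = (if i = j then cid else 0)"
  by (rule cblinfun_eqI) (auto simp: adj_coord_apply)

lemma sum_adj_coord_coord: "(\<Sum>i\<in>UNIV. adj (coord i) o\<^sub>C coord i) = cid"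
  by (rule cblinfun_eqI) (simp add: cblinfun_sum_apply vec_eq_iff adj_coord_apply)

definition op_of_matrix ::
  "('i \<Rightarrow> 'i \<Rightarrow> ('h::chilbert_space, 'h) cblinfun) \<Rightarrow> ('h ^ 'i::finite, 'h ^ 'i) cblinfun"
  where "op_of_matrix T = (\<Sum>i\<in>UNIV. \<Sum>j\<in>UNIV. adj (coord i) o\<^sub>C T i j o\<^sub>C coord j)"

definition entry ::
  "('h::chilbert_space ^ 'i::finite, 'h ^ 'i) cblinfun \<Rightarrow> 'i \<Rightarrow> 'i \<Rightarrow> ('h, 'h) cblinfun"
  where "entry A i j = coord i o\<^sub>C A o\<^sub>C adj (coord j)"

lemma entry_op_of_matrix: "entry (op_of_matrix T) i j = T i j"
proof -
  have "entry (op_of_matrix T) i j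
      = (\<Sum>k\<in>UNIV. \<Sum>l\<in>UNIV. (coord i o\<^sub>C adj (coord k)) o\<^sub>C T k l o\<^sub>C (coord l o\<^sub>C adj (coord j)))"
    by (simp add: entry_def op_of_matrix_def ccompose_sum ccompose_assoc)
  also have "\<dots> = (\<Sum>k\<in>UNIV. if k = i then (\<Sum>l\<in>UNIV. if l = j then T k l else 0) else 0)"
  proof -
    have "(if P then cid else 0) o\<^sub>C S = (if P then S else 0)" "S o\<^sub>C (if P then cid else 0) = (if P then S else 0)"
      for P and S :: "('a, 'a) cblinfun" by simp_all
    then show ?thesis by (intro sum.cong refl) (auto simp: coord_adj_coord intro!: sum.neutral)
  qed
  finally show ?thesis by (simp add: sum.delta)
qed

lemma entry_ccompose: "entry (A o\<^sub>C B) i j = (\<Sum>k\<in>UNIV. entry A i k o\<^sub>C entry B k j)"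
proof -
  have "entry (A o\<^sub>C B) i j
      = coord i o\<^sub>C A o\<^sub>C (\<Sum>k\<in>UNIV. adj (coord k) o\<^sub>C coord k) o\<^sub>C B o\<^sub>C adj (coord j)"
    by (simp add: entry_def sum_adj_coord_coord ccompose_assoc)
  also have "\<dots> = (\<Sum>k\<in>UNIV. entry A i k o\<^sub>C entry B k j)"
    by (simp add: entry_def ccompose_sum ccompose_assoc)
  finally show ?thesis .
qed

lemma entry_adj: "entry (adj A) i j = adj (entry A j i)"
  by (simp add: entry_def adj_ccompose ccompose_assoc)

lemma entry_linear:
  "entry (A + B) i j = entry A i j + entry B i j" "entry (c *\<^sub>C A) i j = c *\<^sub>C entry A i j"
  "entry 0 i j = 0" "entry cid i j = (if i = j then cid else 0)"
  by (simp_all add: entry_def ccompose_linear coord_adj_coord)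

text \<open>The algebra \<open>M\<^sub>I(C)\<close>, acting on the Hilbert sum of \<open>I\<close> copies of the space of \<open>C\<close>.\<close>

lemma unital_cstar_algebra_matrices:
  assumes C: "unital_cstar_algebra C"
  shows "unital_cstar_algebra {A. \<forall>i j. entry A i j \<in> C}" (is "unital_cstar_algebra ?M")
proof -
  note D = unital_cstar_algebraD[OF C]
  have "csubspace ?M"
    by (rule complex_vector.subspaceI) (use D(6,7,9) in \<open>auto simp: entry_linear\<close>)
  moreover have "closed ?M"
  proof -
    have "continuous_on UNIV (\<lambda>A. entry A i j)" for i j :: 'b
      unfolding entry_def
      by (intro bounded_linear.continuous_on[OF bounded_linear_ccompose_right]
          bounded_linear.continuous_on[OF bounded_linear_ccompose_left] continuous_on_id)
    from closed_vimage[OF D(2) this] have "closed {A. entry A i j \<in> C}" for i j :: 'b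
      unfolding vimage_def .
    then show ?thesis by (intro closed_Collect_all)
  qed
  moreover have "cid \<in> ?M" using D(3,6) by (simp add: entry_linear)
  moreover have "S o\<^sub>C T \<in> ?M" if "S \<in> ?M" "T \<in> ?M" for S T
    using that D(4) by (auto simp: entry_ccompose intro!: D(10))
  moreover have "adj T \<in> ?M" if "T \<in> ?M" for T
    using that D(5) by (auto simp: entry_adj)
  ultimately show ?thesis unfolding unital_cstar_algebra_def by blast
qed

lemma block_positive_iff_positive_op:
  "block_positive UNIV T \<longleftrightarrow> positive_op (op_of_matrix T)"
proof -
  have q: "cinner v (op_of_matrix T *\<^sub>V v) = (\<Sum>i\<in>UNIV. \<Sum>j\<in>UNIV. cinner (v $ i) (T i j *\<^sub>V v $ j))" for v
    by (simp add: op_of_matrix_def cblinfun_sum_apply cinner_sum_right cinner_adj_right)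
  show ?thesis
  proof
    assume "block_positive UNIV T"
    then show "positive_op (op_of_matrix T)" by (simp add: block_positive_def positive_op_def q)
  next
    assume P: "positive_op (op_of_matrix T)"
    show "block_positive UNIV T" unfolding block_positive_def
    proof
      fix \<xi>
      show "(\<Sum>i\<in>UNIV. \<Sum>j\<in>UNIV. cinner (\<xi> i) (T i j *\<^sub>V \<xi> j)) \<in> \<real>\<^sub>\<ge>\<^sub>0"
        using P[unfolded positive_op_def, THEN spec, of "\<chi> i. \<xi> i"] by (simp add: q)
    qed
  qed
qed

lemma sum_cinner_square_nonneg:
  fixes w :: "'k \<Rightarrow> 'h::complex_inner"
  shows "(\<Sum>k\<in>K. cinner (w k) (w k)) \<in> \<real>\<^sub>\<ge>\<^sub>0"
  by (auto simp: cinner_self nonneg_Reals_of_real_iff simp flip: of_real_sum of_real_power intro!: sum_nonneg)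

lemma block_positive_gram:
  "block_positive I (\<lambda>i j. adj (V i) o\<^sub>C V j)"
  unfolding block_positive_def
proof
  fix \<xi>
  have "(\<Sum>i\<in>I. \<Sum>j\<in>I. cinner (\<xi> i) ((adj (V i) o\<^sub>C V j) *\<^sub>V \<xi> j))
      = cinner (\<Sum>i\<in>I. V i *\<^sub>V \<xi> i) (\<Sum>i\<in>I. V i *\<^sub>V \<xi> i)"
    unfolding cinner_sum_left cinner_sum_right by (subst sum.swap) (simp add: cinner_adj_right)
  also have "\<dots> \<in> \<real>\<^sub>\<ge>\<^sub>0" using sum_cinner_square_nonneg[of "\<lambda>_. \<Sum>i\<in>I. V i *\<^sub>V \<xi> i" "{()}"] by simp
  finally show "(\<Sum>i\<in>I. \<Sum>j\<in>I. cinner (\<xi> i) ((adj (V i) o\<^sub>C V j) *\<^sub>V \<xi> j)) \<in> \<real>\<^sub>\<ge>\<^sub>0" .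
qed

lemma block_positive_add:
  assumes "block_positive I S" "block_positive I T"
  shows "block_positive I (\<lambda>i j. S i j + T i j)"
  unfolding block_positive_def
proof
  fix \<xi>
  show "(\<Sum>i\<in>I. \<Sum>j\<in>I. cinner (\<xi> i) ((S i j + T i j) *\<^sub>V \<xi> j)) \<in> \<real>\<^sub>\<ge>\<^sub>0"
    unfolding cblinfun_apply_simps cinner_add_right sum.distrib
    using assms unfolding block_positive_def by (intro nonneg_Reals_add_I) blast+
qed

lemma block_positive_sum:
  assumes "\<And>k. k \<in> K \<Longrightarrow> block_positive I (T k)"
  shows "block_positive I (\<lambda>i j. \<Sum>k\<in>K. T k i j)"
  using assms
proof (induction K rule: infinite_finite_induct)
  case (insert k K)
  then show ?case using block_positive_add[of I "T k"] by simp
qed (simp_all add: block_positive_def)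

text \<open>The columns of the square root of a positive operator matrix factor it as a Gram matrix.\<close>

lemma block_positive_factorization:
  fixes T :: "'i::finite \<Rightarrow> 'i \<Rightarrow> ('h::chilbert_space, 'h) cblinfun"
  assumes "block_positive UNIV T"
  obtains V :: "'i \<Rightarrow> ('h, 'h ^ 'i) cblinfun" where "\<And>i j. T i j = adj (V i) o\<^sub>C V j"
proof -
  obtain S where S: "adj S = S" "S o\<^sub>C S = op_of_matrix T"
    using positive_op_sqrt[OF unital_cstar_algebra_UNIV, of "op_of_matrix T"] assms
    by (auto simp: block_positive_iff_positive_op)
  have "T i j = adj (S o\<^sub>C adj (coord i)) o\<^sub>C (S o\<^sub>C adj (coord j))" for i j
    using entry_op_of_matrix[of T i j] unfolding S(2)[symmetric] entry_def
    by (simp add: adj_ccompose S(1) ccompose_assoc)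
  then show thesis by (rule that)
qed

text \<open>A square root with entries in \<open>C\<close> exhibits \<open>T\<close> as \<open>S\<^sup>*S\<close> over \<open>C\<close>, an identity that \<open>\<pi>\<close> preserves entrywise.\<close>

lemma star_representation_block_positive:
  fixes T :: "'i::finite \<Rightarrow> 'i \<Rightarrow> ('l::chilbert_space, 'l) cblinfun"
  assumes C: "unital_cstar_algebra C" and \<pi>: "star_representation C \<pi>"
    and T: "\<And>i j. T i j \<in> C" "block_positive UNIV T"
  shows "block_positive UNIV (\<lambda>i j. \<pi> (T i j))"
proof -
  obtain S where S: "\<And>i j. entry S i j \<in> C" "adj S = S" "S o\<^sub>C S = op_of_matrix T"
    using positive_op_sqrt[OF unital_cstar_algebra_matrices[OF C], of "op_of_matrix T"] T
    by (auto simp: block_positive_iff_positive_op entry_op_of_matrix)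
  have lin: "\<pi> (sum f K) = (\<Sum>k\<in>K. \<pi> (f k))" if "\<And>k. f k \<in> C" for f :: "'i \<Rightarrow> _" and K
  proof -
    have "\<pi> 0 = \<pi> (0 *\<^sub>C 0)" by simp
    also have "\<dots> = 0 *\<^sub>C \<pi> 0"
      using \<pi> unital_cstar_algebraD(6)[OF C] unfolding star_representation_def clinear_on_def by blast
    finally have "\<pi> 0 = 0" by simp
    moreover have "\<pi> (s + t) = \<pi> s + \<pi> t" if "s \<in> C" "t \<in> C" for s t
      using \<pi> that unfolding star_representation_def clinear_on_def by blast
    ultimately show ?thesis using that
      by (induction K rule: infinite_finite_induct) (auto simp: unital_cstar_algebraD[OF C])
  qed
  have mult: "a \<in> C \<Longrightarrow> b \<in> C \<Longrightarrow> \<pi> (a o\<^sub>C b) = \<pi> a o\<^sub>C \<pi> b" "a \<in> C \<Longrightarrow> \<pi> (adj a) = adj (\<pi> a)" for a b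
    using \<pi> unfolding star_representation_def by blast+
  have "\<pi> (T i j) = (\<Sum>k\<in>UNIV. adj (\<pi> (entry S k i)) o\<^sub>C \<pi> (entry S k j))" for i j
  proof -
    have "T i j = (\<Sum>k\<in>UNIV. adj (entry S k i) o\<^sub>C entry S k j)"
      using entry_op_of_matrix[of T i j] S(2,3)
      by (metis (no_types, lifting) entry_adj entry_ccompose sum.cong)
    then show ?thesis
      using S(1) mult(1)[OF unital_cstar_algebraD(5)[OF C]] mult(2)
      by (simp add: lin unital_cstar_algebraD(4,5)[OF C])
  qed
  moreover have "block_positive UNIV (\<lambda>i j. \<Sum>k\<in>UNIV. adj (\<pi> (entry S k i)) o\<^sub>C \<pi> (entry S k j))"
    by (rule block_positive_sum) (rule block_positive_gram)
  ultimately show ?thesis by simp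
qed

section \<open>Countable families of vectors inside \<open>\<ell>\<^sup>2\<close> of an infinite set\<close>

lift_definition ket :: "'i \<Rightarrow> 'i ell2" is "\<lambda>i j. if j = i then 1 else 0"
  by (rule finite_nonzero_values_imp_summable_on) (rule finite_subset[where B = "{i}" for i], auto)

lemma cinner_ket: "cinner (ket i) f = Rep_ell2 f i"
proof -
  have "cinner (ket i) f = (\<Sum>\<^sub>\<infinity>j\<in>{i}. Rep_ell2 f j)"
    unfolding cinner_ell2.rep_eq by (rule infsum_cong_neutral) (auto simp: ket.rep_eq)
  then show ?thesis by simp
qed

text \<open>Members of the family may vanish; the others are orthonormal. The operator is the adjoint of
  the map that sends \<open>g\<close> to its coefficients \<open>\<langle>\<beta>\<^sub>c, g\<rangle>\<close>, which is bounded by Bessel's inequality.\<close>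

lemma orthonormal_family_operator:
  fixes \<beta> :: "'c \<Rightarrow> 'h::chilbert_space"
  assumes on: "\<And>c d. cinner (\<beta> c) (\<beta> d) = (if c = d \<and> \<beta> c \<noteq> 0 then 1 else 0)"
  obtains U :: "('c ell2, 'h) cblinfun"
  where "\<And>c. U *\<^sub>V ket c = \<beta> c" "adj U o\<^sub>C U = coord_proj {c. \<beta> c \<noteq> 0}"
proof -
  have bessel: "L2_set (\<lambda>c. cmod (cinner (\<beta> c) g)) F \<le> norm g" if F: "finite F" for F g
  proof -
    let ?a = "\<lambda>c. cinner (\<beta> c) g"
    define u where "u = (\<Sum>c\<in>F. ?a c *\<^sub>C \<beta> c)"
    define q where "q = (\<Sum>c\<in>F. (cmod (?a c))\<^sup>2)"
    have sq: "cnj z * z = complex_of_real ((cmod z)\<^sup>2)" for z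
      using complex_norm_square[of z] by (simp add: mult.commute)
    have "cinner u g = complex_of_real q"
      by (simp add: u_def q_def cinner_sum_left cinner_scaleC_left sq)
    then have gu: "Re (cinner g u) = q" using cinner_commute[of g u] by simp
    have "cinner u u = (\<Sum>c\<in>F. \<Sum>d\<in>F. if d = c then cnj (?a c) * ?a c else 0)"
      unfolding u_def cinner_sum_left cinner_sum_right
      by (intro sum.cong refl) (auto simp: cinner_scaleC_left cinner_scaleC_right on)
    also have "\<dots> = complex_of_real q" using F by (simp add: sum.delta sq q_def)
    finally have "(norm u)\<^sup>2 = q" unfolding cinner_self of_real_eq_iff .
    then have "q \<le> (norm g)\<^sup>2"
      using norm_diff_square[of g u] gu zero_le_power2[of "norm (g - u)"] by linarith
    then show ?thesis unfolding L2_set_def q_def by (simp add: real_le_lsqrt sum_nonneg)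
  qed
  note bessel' = square_summable_if_bounded[OF bessel]
  define F where "F g = Abs_ell2 (\<lambda>c. cinner (\<beta> c) g)" for g
  have F: "Rep_ell2 (F g) c = cinner (\<beta> c) g" for g c
    unfolding F_def using bessel'(1)[of g] by (simp add: Abs_ell2_inverse)
  have nF: "norm (F g) \<le> norm g" for g
    unfolding norm_ell2.rep_eq F by (rule bessel'(2))
  have lin: "F (g + h) = F g + F h" "F (c *\<^sub>C g) = c *\<^sub>C F g" for g h c
    by (rule ell2_eqI, simp add: F plus_ell2.rep_eq scaleC_ell2.rep_eq cinner_add_right cinner_scaleC_right)+
  have "bounded_linear F"
    by (rule bounded_linear_intro[where K = 1]) (simp_all add: lin nF flip: scaleC_of_real)
  then have A: "cblinfun_apply (Abs_cblinfun F) = F"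
    by (simp add: Abs_cblinfun_inverse lin)
  define U where "U = adj (Abs_cblinfun F)"
  have U: "U *\<^sub>V ket c = \<beta> c" for c
  proof (rule cinner_eqI)
    show "cinner z (U *\<^sub>V ket c) = cinner z (\<beta> c)" for z
      using cinner_commute[of z "\<beta> c"] cinner_commute[of "F z" "ket c"]
      by (simp add: U_def cinner_adj_right A cinner_ket F)
  qed
  have "(adj U o\<^sub>C U) *\<^sub>V f = coord_proj {c. \<beta> c \<noteq> 0} *\<^sub>V f" for f
  proof (rule ell2_eqI)
    fix c
    have "adj U *\<^sub>V \<beta> c = (if \<beta> c = 0 then 0 else ket c)"
      by (rule ell2_eqI) (simp add: U_def A F on ket.rep_eq zero_ell2.rep_eq)
    then have "cinner (adj U *\<^sub>V U *\<^sub>V ket c) f = (if \<beta> c = 0 then 0 else Rep_ell2 f c)"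
      by (simp add: U cinner_ket)
    then show "Rep_ell2 ((adj U o\<^sub>C U) *\<^sub>V f) c = Rep_ell2 (coord_proj {c. \<beta> c \<noteq> 0} *\<^sub>V f) c"
      by (simp add: cinner_ket[symmetric, of "adj U *\<^sub>V U *\<^sub>V f" c] cinner_adj_left cinner_adj_right Rep_coord_proj)
  qed
  then have "adj U o\<^sub>C U = coord_proj {c. \<beta> c \<noteq> 0}" by (rule cblinfun_eqI)
  with U show thesis by (rule that)
qed

text \<open>Since \<open>sgn 0 = 0\<close>, a vector that depends linearly on its predecessors contributes \<open>0\<close>; no vectors
  have to be discarded or renumbered.\<close>

function gram_schmidt :: "(nat \<Rightarrow> 'h::complex_inner) \<Rightarrow> nat \<Rightarrow> 'h" where
  "gram_schmidt h n = sgn (h n - (\<Sum>m<n. cinner (gram_schmidt h m) (h n) *\<^sub>C gram_schmidt h m))"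
  by auto
termination by (relation "Wellfounded.measure snd") auto

declare gram_schmidt.simps [simp del]

lemma cinner_sgn_right: "cinner x (sgn y) = cinner x y / complex_of_real (norm y)"
  by (simp add: sgn_div_norm scaleC_of_real[symmetric] cinner_scaleC_right divide_inverse mult.commute)

lemma cinner_eq_0_commute: "cinner x y = 0 \<longleftrightarrow> cinner y x = 0"
  by (metis cinner_commute complex_cnj_zero)

lemma gram_schmidt_self: "cinner (gram_schmidt h n) (gram_schmidt h n) = (if gram_schmidt h n = 0 then 0 else 1)"
  by (simp add: cinner_self gram_schmidt.simps[of h n] norm_sgn sgn_zero_iff)

lemma gram_schmidt_orthogonal_less:
  "m < n \<Longrightarrow> cinner (gram_schmidt h m) (gram_schmidt h n) = 0"
proof (induction n arbitrary: m rule: less_induct)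
  case (less n)
  let ?b = "gram_schmidt h"
  have off: "cinner (?b m) (?b k) = 0" if "k < n" "k \<noteq> m" for k
  proof (cases "m < k")
    case False
    then have "cinner (?b k) (?b m) = 0" using less that by simp
    then show ?thesis by (subst cinner_eq_0_commute)
  qed (use less that in simp)
  have "(\<Sum>k<n. cinner (?b k) (h n) * cinner (?b m) (?b k))
      = (\<Sum>k<n. if k = m then cinner (?b m) (h n) * cinner (?b m) (?b m) else 0)"
    by (rule sum.cong) (auto simp: off)
  also have "\<dots> = cinner (?b m) (h n)"
    using less.prems by (simp add: gram_schmidt_self)
  finally show ?case
    by (simp add: gram_schmidt.simps[of h n] cinner_sgn_right cinner_diff_right cinner_sum_right
        cinner_scaleC_right)
qed

lemma gram_schmidt_orthonormal:
  "cinner (gram_schmidt h m) (gram_schmidt h n) = (if m = n \<and> gram_schmidt h m \<noteq> 0 then 1 else 0)"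
  using gram_schmidt_orthogonal_less[of m n h] gram_schmidt_orthogonal_less[of n m h]
    gram_schmidt_self[of h n] cinner_eq_0_commute[of "gram_schmidt h n" "gram_schmidt h m"]
  by (cases m n rule: linorder_cases) auto

lemma gram_schmidt_expansion:
  "\<exists>c \<gamma>. h n = c *\<^sub>C gram_schmidt h n + (\<Sum>m<n. \<gamma> m *\<^sub>C gram_schmidt h m)"
proof -
  let ?s = "\<Sum>m<n. cinner (gram_schmidt h m) (h n) *\<^sub>C gram_schmidt h m"
  have "y = complex_of_real (norm y) *\<^sub>C sgn y" for y :: 'a
    by (cases "y = 0") (simp_all add: scaleC_of_real sgn_div_norm)
  then have "h n - ?s = complex_of_real (norm (h n - ?s)) *\<^sub>C gram_schmidt h n"
    unfolding gram_schmidt.simps[of h n] .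
  then have "h n = complex_of_real (norm (h n - ?s)) *\<^sub>C gram_schmidt h n + ?s"
    unfolding diff_eq_eq .
  then show ?thesis by (intro exI)
qed

lemma gram_schmidt_perp:
  assumes "\<And>n. cinner (h n) g = 0"
  shows "cinner (gram_schmidt h n) g = 0"
proof (induction n rule: less_induct)
  case (less n)
  have "cinner g (h n) = 0" "cinner g (gram_schmidt h m) = 0" if "m < n" for m
    using less[OF that] assms[of n] by (simp_all add: cinner_eq_0_commute[of g])
  then have "cinner g (gram_schmidt h n) = 0"
    using assms[of n]
    by (simp add: gram_schmidt.simps[of h n] cinner_sgn_right cinner_diff_right cinner_sum_right
        cinner_scaleC_right cinner_eq_0_commute[of g "h n"])
  then show ?case by (subst cinner_eq_0_commute)
qed

text \<open>The closed span of a sequence has countable dimension, so it is isometric to \<open>\<ell>\<^sup>2(S)\<close> for a countable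
  subset \<open>S\<close> of the infinite type. The third property says that the range of \<open>U\<close> is not larger than this span.\<close>

lemma sequence_model:
  fixes h :: "nat \<Rightarrow> 'h::chilbert_space"
  obtains S and U :: "('c::infinite ell2, 'h) cblinfun"
  where "adj U o\<^sub>C U = coord_proj S" "\<And>n. U *\<^sub>V adj U *\<^sub>V h n = h n"
    "\<forall>g. (\<forall>n. cinner (h n) g = 0) \<longrightarrow> adj U *\<^sub>V g = 0"
proof -
  obtain \<iota> :: "nat \<Rightarrow> 'c" where \<iota>: "inj \<iota>"
    using infinite_countable_subset[OF infinite_UNIV] by blast
  define \<beta> where "\<beta> c = (if c \<in> range \<iota> then gram_schmidt h (inv \<iota> c) else 0)" for c
  have \<beta>\<iota>: "\<beta> (\<iota> n) = gram_schmidt h n" for n using \<iota> by (simp add: \<beta>_def)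
  have "cinner (\<beta> c) (\<beta> d) = (if c = d \<and> \<beta> c \<noteq> 0 then 1 else 0)" for c d
    using \<iota> by (auto simp: \<beta>_def gram_schmidt_orthonormal)
  then obtain U :: "('c ell2, 'h) cblinfun" where
    U: "\<And>c. U *\<^sub>V ket c = \<beta> c" "adj U o\<^sub>C U = coord_proj {c. \<beta> c \<noteq> 0}"
    by (rule orthonormal_family_operator) (rule that)
  have "U *\<^sub>V adj U *\<^sub>V \<beta> c = \<beta> c" for c
  proof -
    have "U o\<^sub>C (adj U o\<^sub>C U) = U" unfolding U(2) by (rule partial_isometry_left[OF U(2)])
    from arg_cong[OF this, of "\<lambda>T. T *\<^sub>V ket c"] show ?thesis by (simp add: U(1))
  qed
  then have b: "U *\<^sub>V adj U *\<^sub>V gram_schmidt h n = gram_schmidt h n" for n by (metis \<beta>\<iota>)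
  have "U *\<^sub>V adj U *\<^sub>V h n = h n" for n
  proof -
    obtain c \<gamma> where c: "h n = c *\<^sub>C gram_schmidt h n + (\<Sum>m<n. \<gamma> m *\<^sub>C gram_schmidt h m)"
      using gram_schmidt_expansion by blast
    have lin: "T *\<^sub>V (\<Sum>m\<in>M. f m) = (\<Sum>m\<in>M. T *\<^sub>V f m)" for T :: "('h, 'h) cblinfun" and M :: "nat set" and f
      by (induction M rule: infinite_finite_induct) (simp_all add: cblinfun_apply_linear)
    have "(U o\<^sub>C adj U) *\<^sub>V h n = h n"
      unfolding c cblinfun_apply_linear lin by (simp add: b)
    then show ?thesis by simp
  qed
  moreover have "\<forall>g. (\<forall>n. cinner (h n) g = 0) \<longrightarrow> adj U *\<^sub>V g = 0"
  proof (intro allI impI)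
    fix g assume that: "\<forall>n. cinner (h n) g = 0"
    show "adj U *\<^sub>V g = 0"
    proof (rule ell2_eqI)
      fix c
      have "cinner (\<beta> c) g = 0" using gram_schmidt_perp[of h g] that by (simp add: \<beta>_def)
      then have "cinner (ket c) (adj U *\<^sub>V g) = 0" by (simp add: cinner_adj_right U(1))
      then show "Rep_ell2 (adj U *\<^sub>V g) c = Rep_ell2 0 c" by (simp add: cinner_ket zero_ell2.rep_eq)
    qed
  qed
  ultimately show thesis by (rule that[OF U(2)])
qed

text \<open>The adjoint of \<open>A - B\<close> maps into the orthogonal complement of the sequence, where \<open>U\<^sup>*\<close> vanishes.\<close>

lemma ccompose_eq_if_eq_on_sequence:
  fixes A B :: "('h::chilbert_space, 'k::chilbert_space) cblinfun"
  assumes perp: "\<forall>g. (\<forall>n. cinner (h n) g = 0) \<longrightarrow> adj U *\<^sub>V g = 0"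
    and eq: "\<And>n. A *\<^sub>V h n = B *\<^sub>V h n"
  shows "A o\<^sub>C U = B o\<^sub>C U"
proof -
  have "adj U *\<^sub>V adj (A - B) *\<^sub>V g = 0" for g
    by (rule perp[rule_format]) (simp add: cinner_adj_right eq)
  then have "adj ((A - B) o\<^sub>C U) = 0"
    unfolding adj_ccompose by (intro cblinfun_eqI) simp
  then have "(A - B) o\<^sub>C U = 0" by (metis adj_adj adj_simps(1))
  then show ?thesis by (simp add: ccompose_linear)
qed

section \<open>Compressing bi-isometries to small subspaces\<close>

lemma countable_enumeration:
  assumes "countable A" "A \<noteq> {}"
  shows "\<exists>f :: nat \<Rightarrow> 'a. range f = A"
  using range_from_nat_into[OF assms(2,1)] by blast

text \<open>Let \<open>H\<^sub>0\<close> be the closed span of \<open>h\<close> and \<open>K\<^sub>0\<close> that of all \<open>V\<^sub>a\<^sub>,\<^sub>x h\<^sub>n\<close>. By construction \<open>V\<close> maps \<open>H\<^sub>0\<close> to \<open>K\<^sub>0\<close>,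
  and the invariance of \<open>h\<close> makes \<open>H\<^sub>0\<close> invariant under the \<open>V\<^sup>*V\<close>. Both spaces have countable dimension,
  so that the restriction of \<open>V\<close> lives on subsets of the cardinal \<open>'c\<close> up to unitary equivalence.\<close>

lemma compress_bi_isometry:
  fixes V :: "'x::finite \<Rightarrow> 'x \<Rightarrow> ('h::chilbert_space, 'k::chilbert_space) cblinfun"
    and h :: "nat \<Rightarrow> 'h"
  assumes V: "bi_isometry cid cid V"
    and inv: "\<And>n a x b y. \<exists>m. h m = adj (V a x) *\<^sub>V V b y *\<^sub>V h n"
  obtains d :: "('x, 'c::infinite) biiso_data" and U
  where "d \<in> bi_isometries" "adj U o\<^sub>C U = coord_proj (fst d)" "\<And>n. U *\<^sub>V adj U *\<^sub>V h n = h n"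
    "\<And>a x b y. adj (V a x) o\<^sub>C V b y o\<^sub>C U = U o\<^sub>C (adj (biiso_op d a x) o\<^sub>C biiso_op d b y)"
proof -
  obtain S and U :: "('c ell2, 'h) cblinfun" where
    U: "adj U o\<^sub>C U = coord_proj S" "\<And>n. U *\<^sub>V adj U *\<^sub>V h n = h n"
      "\<forall>g. (\<forall>n. cinner (h n) g = 0) \<longrightarrow> adj U *\<^sub>V g = 0"
    by (rule sequence_model[of h]) (rule that)
  have "countable (range (\<lambda>(n :: nat, a, x). V a x *\<^sub>V h n))"
  proof (rule countable_image)
    have "countable ((UNIV :: nat set) \<times> (UNIV :: ('x \<times> 'x) set))"
      by (rule countable_SIGMA) (simp_all add: countable_finite)
    then show "countable (UNIV :: (nat \<times> 'x \<times> 'x) set)" unfolding UNIV_Times_UNIV .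
  qed
  then obtain k :: "nat \<Rightarrow> 'k" where k: "range k = range (\<lambda>(n :: nat, a, x). V a x *\<^sub>V h n)"
    using countable_enumeration[of "range (\<lambda>(n :: nat, a, x). V a x *\<^sub>V h n)"] by auto
  have k': "\<exists>m. V a x *\<^sub>V h n = k m" for a x n
  proof -
    have "V a x *\<^sub>V h n \<in> range k" unfolding k by (intro image_eqI[of _ _ "(n, a, x)"]) simp_all
    then show ?thesis by blast
  qed
  obtain T and W :: "('c ell2, 'k) cblinfun" where
    W: "adj W o\<^sub>C W = coord_proj T" "\<And>n. W *\<^sub>V adj W *\<^sub>V k n = k n"
      "\<forall>g. (\<forall>n. cinner (k n) g = 0) \<longrightarrow> adj W *\<^sub>V g = 0"
    by (rule sequence_model[of k]) (rule that)
  define V' where "V' a x = adj W o\<^sub>C V a x o\<^sub>C U" for a x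
  have WV: "W o\<^sub>C adj W o\<^sub>C V a x o\<^sub>C U = V a x o\<^sub>C U" for a x
  proof (rule ccompose_eq_if_eq_on_sequence[OF U(3)])
    show "(W o\<^sub>C adj W o\<^sub>C V a x) *\<^sub>V h n = V a x *\<^sub>V h n" for n
      using k'[of a x n] W(2) by auto
  qed
  have UE: "U o\<^sub>C adj U o\<^sub>C (adj (V a x) o\<^sub>C V b y) o\<^sub>C U = adj (V a x) o\<^sub>C V b y o\<^sub>C U" for a x b y
  proof (rule ccompose_eq_if_eq_on_sequence[OF U(3)])
    fix n
    obtain m where "h m = adj (V a x) *\<^sub>V V b y *\<^sub>V h n" using inv by blast
    then show "(U o\<^sub>C adj U o\<^sub>C (adj (V a x) o\<^sub>C V b y)) *\<^sub>V h n = (adj (V a x) o\<^sub>C V b y) *\<^sub>V h n"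
      using U(2)[of m] by simp
  qed
  have VV: "adj (V' a x) o\<^sub>C V' b y = adj U o\<^sub>C (adj (V a x) o\<^sub>C V b y) o\<^sub>C U" for a x b y
    unfolding V'_def using WV[of b y] by (simp add: adj_ccompose ccompose_assoc)
  have sums: "(\<Sum>i\<in>UNIV. adj (V' (\<alpha> i) (\<beta> i)) o\<^sub>C V' (\<gamma> i) (\<delta> i)) = (if P then coord_proj S else 0)"
    if "(\<Sum>i\<in>UNIV. adj (V (\<alpha> i) (\<beta> i)) o\<^sub>C V (\<gamma> i) (\<delta> i)) = (if P then cid else 0)"
    for \<alpha> \<beta> \<gamma> \<delta> :: "'x \<Rightarrow> 'x" and P
    unfolding VV by (simp add: that U(1) flip: ccompose_sum)
  have WU: "coord_proj T o\<^sub>C adj W = adj W" "U o\<^sub>C coord_proj S = U"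
    using arg_cong[OF partial_isometry_left[OF W(1)], of adj] partial_isometry_left[OF U(1)]
    by (simp_all add: adj_ccompose adj_coord_proj)
  have "coord_proj T o\<^sub>C V' a x o\<^sub>C coord_proj S = V' a x" for a x
  proof -
    have "coord_proj T o\<^sub>C V' a x o\<^sub>C coord_proj S
        = (coord_proj T o\<^sub>C adj W) o\<^sub>C V a x o\<^sub>C (U o\<^sub>C coord_proj S)"
      by (simp only: V'_def ccompose_assoc)
    then show ?thesis by (simp add: WU V'_def)
  qed
  then have "(S, T, V') \<in> bi_isometries"
    using V sums[of "\<lambda>a. a" "\<lambda>_. x" "\<lambda>a. a" "\<lambda>_. x'" "x = x'" for x x']
      sums[of "\<lambda>_. a" "\<lambda>y. y" "\<lambda>_. a'" "\<lambda>y. y" "a = a'" for a a']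
    by (simp add: bi_isometries_def bi_isometry_def)
  moreover have "adj (V a x) o\<^sub>C V b y o\<^sub>C U = U o\<^sub>C (adj (V' a x) o\<^sub>C V' b y)" for a x b y
    using UE[of a x b y] by (simp add: VV ccompose_assoc)
  ultimately show thesis
    using that[of "(S, T, V')" U] U by (simp add: biiso_op_def)
qed

section \<open>The representatives inside the universal bi-isometry\<close>

lemma norm_src_component_le:
  fixes f :: "('x::finite, 'c) src ell2"
  shows "norm (src_component d f) \<le> norm f"
proof (cases "d \<in> biiso_reps")
  case True
  then have "(norm (src_component d f))\<^sup>2 \<le> (norm f)\<^sup>2"
    using norm_src_component_sum[of "{d}" f] by simp
  then show ?thesis by (rule power2_le_imp_le) simp
next
  case False
  then have "src_component d f = 0"
    by (intro ell2_eqI) (simp add: src_component.rep_eq zero_ell2.rep_eq)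
  then show ?thesis by simp
qed

lift_definition src_op :: "('x::finite, 'c) biiso_data \<Rightarrow> (('x, 'c) src ell2, 'c ell2) cblinfun"
  is src_component
  by (auto intro!: bounded_linear_intro[where K = 1]
      simp: src_component_linear norm_src_component_le simp flip: scaleC_of_real)

lemma src_component_ket:
  assumes "d \<in> biiso_reps" "s \<in> fst d"
  shows "src_component d' (ket (Abs_src (d, s))) = (if d' = d then ket s else 0)"
  by (rule ell2_eqI)
    (use assms in \<open>auto simp: src_component.rep_eq ket.rep_eq zero_ell2.rep_eq Abs_src_inject\<close>)

text \<open>The adjoint of the projection to a component is the inclusion of that component in the Hilbert sum.\<close>

lemma src_component_adj_src_op:
  assumes "d \<in> biiso_reps"
  shows "src_component d (adj (src_op d') *\<^sub>V k) = (if d = d' then coord_proj (fst d) *\<^sub>V k else 0)"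
proof (rule ell2_eqI)
  fix s
  have "Rep_ell2 (adj (src_op d') *\<^sub>V k) (Abs_src (d, s)) = (if d = d' then Rep_ell2 k s else 0)"
    if "s \<in> fst d"
    using src_component_ket[OF assms that, of d']
    by (simp add: cinner_ket[symmetric] cinner_adj_right src_op.rep_eq)
  then show "Rep_ell2 (src_component d (adj (src_op d') *\<^sub>V k)) s
      = Rep_ell2 (if d = d' then coord_proj (fst d) *\<^sub>V k else 0) s"
    using assms by (auto simp: src_component.rep_eq Rep_coord_proj zero_ell2.rep_eq)
qed

lemma src_op_adj_src_op:
  "d \<in> biiso_reps \<Longrightarrow> src_op d o\<^sub>C adj (src_op d) = coord_proj (fst d)"
  by (rule cblinfun_eqI) (simp add: src_op.rep_eq src_component_adj_src_op)

lemma e_X_adj_src_op: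
  fixes d :: "('x::finite, 'c::infinite) biiso_data"
  assumes d: "d \<in> biiso_reps"
  shows "e_X x x' a a' o\<^sub>C adj (src_op d)
    = adj (src_op d) o\<^sub>C (adj (biiso_op d a x) o\<^sub>C biiso_op d a' x')"
proof (intro cblinfun_eqI cinner_eqI)
  fix k and f :: "('x, 'c) src ell2"
  let ?g = "adj (src_op d) *\<^sub>V k"
  let ?w = "\<lambda>c. cinner (biiso_op c a x *\<^sub>V src_component c f) (biiso_op c a' x' *\<^sub>V src_component c ?g)"
  have supp: "biiso_op d a' x' *\<^sub>V coord_proj (fst d) *\<^sub>V k = biiso_op d a' x' *\<^sub>V k"
    using arg_cong[OF bi_isometries_support(2)[of "fst d" "fst (snd d)" "snd (snd d)" a' x'],
        of "\<lambda>A. A *\<^sub>V k"] biiso_reps_subset[OF d]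
    by (simp add: biiso_op_def)
  have "(?w has_sum ?w d) biiso_reps"
    by (rule has_sum_finite_neutralI[where B = "{d}"])
      (use d in \<open>auto simp: src_component_adj_src_op cblinfun_apply_linear\<close>)
  then have "cinner (univ_biiso a x *\<^sub>V f) (univ_biiso a' x' *\<^sub>V ?g) = ?w d"
    using cinner_univ_biiso has_sum_unique by blast
  then show "cinner f ((e_X x x' a a' o\<^sub>C adj (src_op d)) *\<^sub>V k)
      = cinner f ((adj (src_op d) o\<^sub>C (adj (biiso_op d a x) o\<^sub>C biiso_op d a' x')) *\<^sub>V k)"
    by (simp add: e_X_def cinner_adj_right src_component_adj_src_op[OF d] supp src_op.rep_eq)
qed

text \<open>\<open>Z\<close> is the unitary equivalence with the representative of \<open>d\<close>, followed by the inclusion of that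
  summand.\<close>

lemma bi_isometry_inside_universal:
  fixes d :: "('x::finite, 'c::infinite) biiso_data"
  assumes d: "d \<in> bi_isometries"
  obtains Z :: "('c ell2, ('x, 'c) src ell2) cblinfun"
  where "adj Z o\<^sub>C Z = coord_proj (fst d)"
    "\<And>x x' a a'. e_X x x' a a' o\<^sub>C Z = Z o\<^sub>C (adj (biiso_op d a x) o\<^sub>C biiso_op d a' x')"
proof -
  obtain r where r: "r \<in> biiso_reps" "unitarily_equivalent d r"
    using biiso_reps_unique[OF d] by blast
  obtain S T V S' T' V' where eq: "d = (S, T, V)" "r = (S', T', V')" by (metis prod_cases3)
  obtain U W where UW: "adj U o\<^sub>C U = coord_proj S" "U o\<^sub>C adj U = coord_proj S'"
      "adj W o\<^sub>C W = coord_proj T" "W o\<^sub>C adj W = coord_proj T'"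
    and I: "\<And>a x. W o\<^sub>C V a x = V' a x o\<^sub>C U"
    using r(2) by (auto simp: unitarily_equivalent_def eq)
  note suppV = bi_isometries_support[OF d[unfolded eq]]
    and suppV' = bi_isometries_support[OF biiso_reps_subset[OF r(1), unfolded eq]]
  have V'W: "adj (V' a x) o\<^sub>C W = U o\<^sub>C adj (V a x)" for a x
  proof -
    have "V' a x = W o\<^sub>C V a x o\<^sub>C adj U" by (metis I UW(2) ccompose_assoc suppV'(2))
    then have "adj (V' a x) o\<^sub>C W = U o\<^sub>C (adj (V a x) o\<^sub>C coord_proj T)"
      by (simp add: adj_ccompose ccompose_assoc UW(3))
    also have "adj (V a x) o\<^sub>C coord_proj T = adj (V a x)"
      using arg_cong[OF suppV(1)[of a x], of adj] by (simp add: adj_ccompose adj_coord_proj)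
    finally show ?thesis .
  qed
  have VVU: "adj (V' a x) o\<^sub>C V' b y o\<^sub>C U = U o\<^sub>C (adj (V a x) o\<^sub>C V b y)" for a x b y
    by (metis I V'W ccompose_assoc)
  let ?Z = "adj (src_op r) o\<^sub>C U"
  have "adj ?Z o\<^sub>C ?Z = adj U o\<^sub>C (src_op r o\<^sub>C adj (src_op r)) o\<^sub>C U"
    by (simp add: adj_ccompose ccompose_assoc)
  also have "\<dots> = coord_proj S"
    using src_op_adj_src_op[OF r(1)] partial_isometry_right[OF UW(2)]
    by (simp add: eq ccompose_assoc UW(1))
  finally have "adj ?Z o\<^sub>C ?Z = coord_proj (fst d)" by (simp add: eq)
  moreover have "e_X x x' a a' o\<^sub>C ?Z = ?Z o\<^sub>C (adj (biiso_op d a x) o\<^sub>C biiso_op d a' x')" for x x' a a'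
    using arg_cong[OF e_X_adj_src_op[OF r(1), of x x' a a'], of "\<lambda>T. T o\<^sub>C U"] VVU[of a x a' x']
    by (simp add: ccompose_assoc biiso_op_def eq)
  ultimately show thesis by (rule that)
qed

section \<open>The C*-algebra generated by the universal bi-isometry\<close>

text \<open>The factor \<open>\<sigma>\<close> is the identity for linear and conjugation for antilinear maps, such as the adjoint.\<close>

lemma closed_span_map:
  fixes f :: "('a::chilbert_space, 'b::chilbert_space) cblinfun \<Rightarrow> ('d::chilbert_space, 'e::chilbert_space) cblinfun"
  assumes x: "x \<in> closure (cspan G)" and A: "csubspace A" "closed A" and G: "\<And>g. g \<in> G \<Longrightarrow> f g \<in> A"
    and f: "bounded_linear f" "\<And>c x. f (c *\<^sub>C x) = \<sigma> c *\<^sub>C f x"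
  shows "f x \<in> A"
proof -
  have "csubspace (f -` A)"
    using A(1) by (intro complex_vector.subspaceI)
      (auto simp: f(2) linear_simps[OF f(1)] complex_vector.subspace_0 complex_vector.subspace_add
        complex_vector.subspace_scale)
  then have "cspan G \<subseteq> f -` A" using G by (intro complex_vector.span_minimal) auto
  moreover have "closed (f -` A)"
    using A(2) by (rule closed_vimage) (rule bounded_linear.continuous_on[OF f(1) continuous_on_id])
  ultimately have "closure (cspan G) \<subseteq> f -` A" by (rule closure_minimal)
  then show ?thesis using x by blast
qed

lemma csubspace_closure_cspan:
  fixes G :: "('a::chilbert_space, 'b::chilbert_space) cblinfun set"
  shows "csubspace (closure (cspan G))"
proof (rule complex_vector.subspaceI)
  show "0 \<in> closure (cspan G)"
    using complex_vector.span_zero closure_subset by blast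
  show "c *\<^sub>C x \<in> closure (cspan G)" if "x \<in> closure (cspan G)" for c and x :: "('a, 'b) cblinfun"
  proof -
    have "(\<lambda>x. c *\<^sub>C x) ` closure (cspan G) \<subseteq> closure ((\<lambda>x. c *\<^sub>C x) ` cspan G)"
      by (rule closure_bounded_linear_image_subset[OF bounded_linear_scaleC_cblinfun])
    also have "\<dots> \<subseteq> closure (cspan G)"
      by (intro closure_mono) (auto intro: complex_vector.span_scale)
    finally show ?thesis using that by blast
  qed
  fix x y assume "x \<in> closure (cspan G)" "y \<in> closure (cspan G)"
  then obtain X Y where X: "\<And>n. X n \<in> cspan G" "X \<longlonglongrightarrow> x" and Y: "\<And>n. Y n \<in> cspan G" "Y \<longlonglongrightarrow> y"
    unfolding closure_sequential by blast
  then show "x + y \<in> closure (cspan G)"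
    unfolding closure_sequential
    by (intro exI[of _ "\<lambda>n. X n + Y n"]) (auto intro: tendsto_add complex_vector.span_add)
qed

lemma tro_hull: "tro (tro hull G)"
  by (rule hull_in) (auto simp: tro_def complex_vector.subspace_def)

lemma unital_cstar_algebra_right_cstar_algebra:
  assumes W: "tro W" and id: "cid \<in> right_cstar_algebra W"
  shows "unital_cstar_algebra (right_cstar_algebra W)"
proof -
  let ?G = "{adj S o\<^sub>C T | S T. S \<in> W \<and> T \<in> W}"
  have sub: "csubspace (right_cstar_algebra W)" "closed (right_cstar_algebra W)"
    by (simp_all add: right_cstar_algebra_def csubspace_closure_cspan)
  have gen: "g \<in> right_cstar_algebra W" if "g \<in> ?G" for g
    unfolding right_cstar_algebra_def
    using that complex_vector.span_superset[of ?G] closure_subset[of "cspan ?G"] by blast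
  have 1: "g o\<^sub>C T \<in> right_cstar_algebra W" if "g \<in> ?G" "T \<in> right_cstar_algebra W" for g T
    using that(2)[unfolded right_cstar_algebra_def] sub
  proof (rule closed_span_map[where f = "\<lambda>T. g o\<^sub>C T" and \<sigma> = "\<lambda>c. c"])
    fix h assume "h \<in> ?G"
    then obtain S T S' T' where ST: "g = adj S o\<^sub>C T" "h = adj S' o\<^sub>C T'"
      "S \<in> W" "T \<in> W" "S' \<in> W" "T' \<in> W" using \<open>g \<in> ?G\<close> by auto
    then have "T o\<^sub>C adj S' o\<^sub>C T' \<in> W" using W by (auto simp: tro_def)
    then have "adj S o\<^sub>C (T o\<^sub>C adj S' o\<^sub>C T') \<in> ?G" using ST by blast
    then show "g o\<^sub>C h \<in> right_cstar_algebra W" using gen by (simp add: ST ccompose_assoc)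
  qed (simp_all add: bounded_linear_ccompose_left ccompose_linear)
  have "S o\<^sub>C T \<in> right_cstar_algebra W"
    if "S \<in> right_cstar_algebra W" "T \<in> right_cstar_algebra W" for S T
    using that(1)[unfolded right_cstar_algebra_def] sub 1[OF _ that(2)]
    by (rule closed_span_map[where f = "\<lambda>S. S o\<^sub>C T" and \<sigma> = "\<lambda>c. c"])
      (simp_all add: bounded_linear_ccompose_right ccompose_linear)
  moreover have "adj T \<in> right_cstar_algebra W" if "T \<in> right_cstar_algebra W" for T
    using that[unfolded right_cstar_algebra_def] sub
  proof (rule closed_span_map[where f = adj and \<sigma> = cnj])
    fix g assume "g \<in> ?G"
    then obtain S T where ST: "g = adj S o\<^sub>C T" "S \<in> W" "T \<in> W" by auto
    then have "adj T o\<^sub>C S \<in> ?G" by blast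
    then show "adj g \<in> right_cstar_algebra W" using gen by (simp add: ST adj_ccompose)
  qed (simp_all add: bounded_linear_adj adj_linear)
  ultimately show ?thesis using sub id unfolding unital_cstar_algebra_def by blast
qed

lemma univ_biiso_in_V_X: "univ_biiso a x \<in> V_X"
  unfolding V_X_def using hull_subset[of "{univ_biiso a x | a x. True}" tro] by blast

lemma e_X_in_C_X: "e_X x x' a a' \<in> C_X"
proof -
  let ?G = "{adj S o\<^sub>C T | S T. S \<in> V_X \<and> T \<in> V_X}"
  have "e_X x x' a a' \<in> ?G" unfolding e_X_def using univ_biiso_in_V_X by blast
  then show ?thesis
    unfolding C_X_def right_cstar_algebra_def
    using complex_vector.span_superset[of ?G] closure_subset[of "cspan ?G"] by blast
qed

lemma adj_e_X: "adj (e_X x x' a a') = e_X x' x a' a"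
  by (simp add: e_X_def adj_ccompose)

lemma sum_e_X:
  "(\<Sum>a\<in>UNIV. e_X x x' a a) = (if x = x' then cid else 0)"
  "(\<Sum>x\<in>UNIV. e_X x x a a') = (if a = a' then cid else 0)"
  using bi_isometry_univ_biiso unfolding bi_isometry_def e_X_def by blast+

lemma unital_cstar_algebra_C_X: "unital_cstar_algebra (C_X :: ('x::finite, 'c::infinite) univ_op set)"
  unfolding C_X_def
proof (rule unital_cstar_algebra_right_cstar_algebra)
  show "tro (V_X :: (('x, 'c) src ell2, ('x, 'c) tgt ell2) cblinfun set)"
    unfolding V_X_def by (rule tro_hull)
  have "csubspace (C_X :: ('x, 'c) univ_op set)"
    by (simp add: C_X_def right_cstar_algebra_def csubspace_closure_cspan)
  then have "(\<Sum>a\<in>UNIV. e_X x x a a) \<in> (C_X :: ('x, 'c) univ_op set)" for x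
    by (intro complex_vector.subspace_sum e_X_in_C_X)
  then show "cid \<in> right_cstar_algebra (V_X :: (('x, 'c) src ell2, ('x, 'c) tgt ell2) cblinfun set)"
    by (simp add: sum_e_X C_X_def)
qed

lemma T_X_subset_C_X: "T_X \<subseteq> C_X"
  unfolding T_X_def
  using unital_cstar_algebraD(1)[OF unital_cstar_algebra_C_X] e_X_in_C_X
  by (intro complex_vector.span_minimal) auto

lemma e_X_in_T_X: "e_X x x' a a' \<in> T_X"
  unfolding T_X_def by (rule complex_vector.span_base) blast

lemma csubspace_T_X: "csubspace T_X"
  unfolding T_X_def by (rule complex_vector.subspace_span)

lemma cid_in_T_X: "cid \<in> (T_X :: ('x::finite, 'c::infinite) univ_op set)"
proof -
  have "(\<Sum>a\<in>UNIV. e_X x x a a) \<in> (T_X :: ('x, 'c) univ_op set)" for x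
    by (intro complex_vector.subspace_sum csubspace_T_X e_X_in_T_X)
  then show ?thesis by (simp add: sum_e_X)
qed

text \<open>The closed right \<open>D\<close>-module \<open>M\<close> generated by the \<open>v\<^sub>a\<^sub>,\<^sub>x\<close> satisfies \<open>M\<^sup>*M \<subseteq> D\<close>, since \<open>v\<^sup>*v\<close> has its entries in \<open>D\<close>.
  Hence \<open>M M\<^sup>*M \<subseteq> M D \<subseteq> M\<close>, so \<open>M\<close> is a ternary ring of operators and contains \<open>V_X\<close>; then \<open>C_X\<close> is
  contained in the closed span of \<open>M\<^sup>*M\<close>.\<close>

lemma C_X_minimal:
  fixes D :: "('x::finite, 'c::infinite) univ_op set"
  assumes D: "unital_cstar_algebra D" and e: "\<And>x x' a a'. e_X x x' a a' \<in> D"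
  shows "C_X \<subseteq> D"
proof -
  note DD = unital_cstar_algebraD[OF D]
  let ?v = "univ_biiso :: 'x \<Rightarrow> 'x \<Rightarrow> (('x, 'c) src ell2, ('x, 'c) tgt ell2) cblinfun"
  let ?G = "{?v a x o\<^sub>C d | a x d. d \<in> D}"
  define M where "M = closure (cspan ?G)"
  have M: "csubspace M" "closed M" by (simp_all add: M_def csubspace_closure_cspan)
  have gen: "?v a x o\<^sub>C d \<in> M" if "d \<in> D" for a x d
  proof -
    have "?v a x o\<^sub>C d \<in> ?G" using that by blast
    then show ?thesis
      unfolding M_def using complex_vector.span_superset[of ?G] closure_subset[of "cspan ?G"] by blast
  qed
  have MD: "S o\<^sub>C T \<in> M" if "S \<in> M" "T \<in> D" for S T
    using that(1)[unfolded M_def] M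
  proof (rule closed_span_map[where f = "\<lambda>S. S o\<^sub>C T" and \<sigma> = "\<lambda>c. c"])
    fix g assume "g \<in> ?G"
    then show "g o\<^sub>C T \<in> M" using gen DD(4) that(2) by (auto simp: ccompose_assoc)
  qed (simp_all add: bounded_linear_ccompose_right ccompose_linear)
  have vM: "adj (?v a x) o\<^sub>C S \<in> D" if "S \<in> M" for a x S
    using that[unfolded M_def] DD(1,2)
  proof (rule closed_span_map[where f = "\<lambda>S. adj (?v a x) o\<^sub>C S" and \<sigma> = "\<lambda>c. c"])
    fix g assume "g \<in> ?G"
    then obtain b y d where g: "g = ?v b y o\<^sub>C d" "d \<in> D" by blast
    then have "e_X x y a b o\<^sub>C d \<in> D" using e DD(4) by blast
    then show "adj (?v a x) o\<^sub>C g \<in> D" by (simp add: g e_X_def ccompose_assoc)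
  qed (simp_all add: bounded_linear_ccompose_left ccompose_linear)
  have MM: "adj S o\<^sub>C R \<in> D" if "S \<in> M" "R \<in> M" for S R
    using that(1)[unfolded M_def] DD(1,2)
  proof (rule closed_span_map[where f = "\<lambda>S. adj S o\<^sub>C R" and \<sigma> = cnj])
    fix g assume "g \<in> ?G"
    then obtain b y d where g: "g = ?v b y o\<^sub>C d" "d \<in> D" by blast
    then have "adj d o\<^sub>C (adj (?v b y) o\<^sub>C R) \<in> D" using vM[OF that(2)] DD(4,5) by blast
    then show "adj g o\<^sub>C R \<in> D" by (simp add: g adj_ccompose ccompose_assoc)
  next
    show "bounded_linear (\<lambda>S. adj S o\<^sub>C R)"
      by (rule bounded_linear_compose[OF bounded_linear_ccompose_right[of R] bounded_linear_adj])
  qed (simp_all add: adj_linear ccompose_linear)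
  have "tro M"
    using M MD[OF _ MM] by (auto simp: tro_def ccompose_assoc)
  moreover have "?v a x \<in> M" for a x
    using gen[OF DD(3)] by simp
  ultimately have V: "V_X \<subseteq> M"
    unfolding V_X_def by (intro hull_minimal) auto
  show ?thesis
  proof
    fix t assume "t \<in> (C_X :: ('x, 'c) univ_op set)"
    then show "t \<in> D"
      unfolding C_X_def right_cstar_algebra_def
      by (rule closed_span_map[where f = "\<lambda>t. t" and \<sigma> = "\<lambda>c. c", OF _ DD(1,2)])
        (use MM V in \<open>auto simp: bounded_linear_ident\<close>)
  qed
qed

section \<open>Representations from bistochastic operator matrices\<close>

lemma norm_partial_isometry:
  assumes "adj U o\<^sub>C U = coord_proj S"
  shows "norm U \<le> 1"
proof (rule norm_cblinfun_le)
  fix f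
  have "(norm (U *\<^sub>V f))\<^sup>2 = cmod (cinner f ((adj U o\<^sub>C U) *\<^sub>V f))"
    by (simp add: cinner_adj_right cinner_self norm_power)
  also have "\<dots> \<le> norm f * norm (coord_proj S *\<^sub>V f)" unfolding assms by (rule cauchy_schwarz_cinner)
  also have "\<dots> \<le> norm f * norm f"
    by (simp add: coord_proj.rep_eq norm_ell2_restrict mult_left_mono)
  finally have "(norm (U *\<^sub>V f))\<^sup>2 \<le> (norm f)\<^sup>2" by (simp only: power2_eq_square)
  then show "norm (U *\<^sub>V f) \<le> 1 * norm f" using power2_le_imp_le norm_ge_zero by fastforce
qed simp

definition intertwiners ::
  "('x \<Rightarrow> 'x \<Rightarrow> 'x \<Rightarrow> 'x \<Rightarrow> ('h::chilbert_space, 'h) cblinfun) \<Rightarrow> (('x::finite, 'c::infinite) src ell2, 'h) cblinfun set"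
  where "intertwiners E = {Y. \<forall>x x' a a'. Y o\<^sub>C e_X x x' a a' = E x x' a a' o\<^sub>C Y}"

text \<open>The vectors \<open>word w n\<close>, the images of the \<open>q\<^sub>n\<close> under all products of the \<open>V\<^sup>*V\<close>, form a countable
  invariant set. With \<open>U\<close> and \<open>Z\<close> the embeddings of the compressed bi-isometry into \<open>H\<close> and into the
  universal space, \<open>Y = U Z\<^sup>*\<close> moves its universal copy into \<open>H\<close>.\<close>

lemma bi_isometry_intertwiner:
  fixes V :: "'x::finite \<Rightarrow> 'x \<Rightarrow> ('h::chilbert_space, 'k::chilbert_space) cblinfun" and q :: "nat \<Rightarrow> 'h"
  assumes V: "bi_isometry cid cid V"
  shows "\<exists>Y :: (('x, 'c::infinite) src ell2, 'h) cblinfun \<in> intertwiners (\<lambda>x x' a a'. adj (V a x) o\<^sub>C V a' x').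
    norm Y \<le> 1 \<and> (\<forall>n. Y *\<^sub>V adj Y *\<^sub>V q n = q n)"
proof -
  let ?E = "\<lambda>x x' a a'. adj (V a x) o\<^sub>C V a' x'"
  define word where "word w n = foldr (\<lambda>(x, x', a, a') v. ?E x x' a a' *\<^sub>V v) w (q n)" for w n
  have "countable (range (\<lambda>(w, n). word w n))"
  proof (rule countable_image)
    have "countable (lists (UNIV :: ('x \<times> 'x \<times> 'x \<times> 'x) set))"
      by (intro countable_lists countable_finite) simp
    then have "countable ((UNIV :: ('x \<times> 'x \<times> 'x \<times> 'x) list set) \<times> (UNIV :: nat set))"
      by (intro countable_SIGMA) (simp_all add: lists_UNIV)
    then show "countable (UNIV :: (('x \<times> 'x \<times> 'x \<times> 'x) list \<times> nat) set)" unfolding UNIV_Times_UNIV .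
  qed
  then obtain h :: "nat \<Rightarrow> 'h" where h: "range h = range (\<lambda>(w, n). word w n)"
    using countable_enumeration[of "range (\<lambda>(w, n). word w n)"] by auto
  have wh: "\<exists>m. h m = word w n" for w n
  proof -
    have "word w n \<in> range h" unfolding h by (intro image_eqI[of _ _ "(w, n)"]) simp_all
    then show ?thesis by (metis rangeE)
  qed
  have "\<exists>m. h m = adj (V a x) *\<^sub>V V b y *\<^sub>V h n" for n a x b y
  proof -
    have "h n \<in> range (\<lambda>(w, n). word w n)" using h by blast
    then obtain w k where "h n = word w k" by auto
    then show ?thesis using wh[of "(x, y, a, b) # w" k] by (simp add: word_def)
  qed
  then obtain d :: "('x, 'c) biiso_data" and U where
    d: "d \<in> bi_isometries" and U: "adj U o\<^sub>C U = coord_proj (fst d)" "\<And>n. U *\<^sub>V adj U *\<^sub>V h n = h n"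
    "\<And>a x b y. adj (V a x) o\<^sub>C V b y o\<^sub>C U = U o\<^sub>C (adj (biiso_op d a x) o\<^sub>C biiso_op d b y)"
    by (rule compress_bi_isometry[OF V]) (rule that)
  obtain Z :: "('c ell2, ('x, 'c) src ell2) cblinfun" where
    Z: "adj Z o\<^sub>C Z = coord_proj (fst d)"
    "\<And>x x' a a'. e_X x x' a a' o\<^sub>C Z = Z o\<^sub>C (adj (biiso_op d a x) o\<^sub>C biiso_op d a' x')"
    by (rule bi_isometry_inside_universal[OF d]) (rule that)
  let ?Y = "U o\<^sub>C adj Z"
  have "?Y \<in> intertwiners ?E"
    unfolding intertwiners_def
  proof (safe)
    fix x x' a a'
    have "adj Z o\<^sub>C e_X x x' a a' = (adj (biiso_op d a x) o\<^sub>C biiso_op d a' x') o\<^sub>C adj Z"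
      using arg_cong[OF Z(2)[of x' x a' a], of adj] by (simp add: adj_ccompose adj_e_X)
    then show "?Y o\<^sub>C e_X x x' a a' = ?E x x' a a' o\<^sub>C ?Y"
      using arg_cong[OF U(3)[of a x a' x'], of "\<lambda>T. T o\<^sub>C adj Z"] by (simp add: ccompose_assoc)
  qed
  moreover have "norm ?Y \<le> 1"
  proof -
    have "norm (adj Z) \<le> 1" using norm_adj_le[of Z] norm_partial_isometry[OF Z(1)] by linarith
    then have "norm U * norm (adj Z) \<le> 1 * 1"
      using norm_partial_isometry[OF U(1)] by (intro mult_mono) auto
    then show ?thesis using norm_ccompose[of U "adj Z"] by linarith
  qed
  moreover have "?Y *\<^sub>V adj ?Y *\<^sub>V q n = q n" for n
  proof -
    have "?Y o\<^sub>C adj ?Y = U o\<^sub>C (adj Z o\<^sub>C Z) o\<^sub>C adj U" by (simp add: adj_ccompose ccompose_assoc)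
    also have "\<dots> = U o\<^sub>C adj U" by (simp add: Z(1) partial_isometry_left[OF U(1)])
    finally have "?Y o\<^sub>C adj ?Y = U o\<^sub>C adj U" .
    moreover obtain m where "h m = q n" using wh[of "[]" n] by (auto simp: word_def)
    ultimately show ?thesis using U(2)[of m] by (metis cblinfun_apply_simps(7))
  qed
  ultimately show ?thesis by blast
qed

lemma bistochastic_intertwiner:
  fixes q :: "nat \<Rightarrow> 'h::chilbert_space"
  assumes E: "bistochastic E"
  shows "\<exists>Y :: (('x::finite, 'c::infinite) src ell2, 'h) cblinfun \<in> intertwiners E.
    norm Y \<le> 1 \<and> (\<forall>n. Y *\<^sub>V adj Y *\<^sub>V q n = q n)"
proof -
  obtain V :: "'x \<times> 'x \<Rightarrow> ('h, 'h ^ ('x \<times> 'x)) cblinfun" where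
    V: "\<And>i j. xa_matrix E i j = adj (V i) o\<^sub>C V j"
    using block_positive_factorization[of "xa_matrix E"] E unfolding bistochastic_def by blast
  have E_eq: "E x x' a a' = adj (V (x, a)) o\<^sub>C V (x', a')" for x x' a a'
    using V[of "(x, a)" "(x', a')"] by (simp add: xa_matrix_def)
  have "bi_isometry cid cid (\<lambda>a x. V (x, a))"
    using E unfolding bistochastic_def bi_isometry_def E_eq by simp
  from bi_isometry_intertwiner[OF this, of q] show ?thesis
    unfolding E_eq[symmetric] .
qed

text \<open>The condition on the adjoints is what makes the relation compatible with the involution: the adjoint
  of an intertwiner goes in the opposite direction.\<close>

definition intertwined ::
  "('x \<Rightarrow> 'x \<Rightarrow> 'x \<Rightarrow> 'x \<Rightarrow> ('h::chilbert_space, 'h) cblinfun) \<Rightarrow> ('x::finite, 'c::infinite) univ_op \<Rightarrow> ('h, 'h) cblinfun \<Rightarrow> bool"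
  where "intertwined E t s \<longleftrightarrow> (\<forall>Y\<in>intertwiners E. Y o\<^sub>C t = s o\<^sub>C Y \<and> Y o\<^sub>C adj t = adj s o\<^sub>C Y)"

text \<open>If \<open>q\<close> is fixed by \<open>Y Y\<^sup>*\<close>, then \<open>s q = s Y Y\<^sup>* q = Y t Y\<^sup>* q\<close>.\<close>

lemma intertwined_norm_le:
  fixes E :: "'x::finite \<Rightarrow> 'x \<Rightarrow> 'x \<Rightarrow> 'x \<Rightarrow> ('h::chilbert_space, 'h) cblinfun"
    and t :: "('x, 'c::infinite) univ_op"
  assumes E: "bistochastic E" and st: "intertwined E t s"
  shows "norm s \<le> norm t"
proof (rule norm_cblinfun_le)
  fix q
  obtain Y :: "(('x, 'c) src ell2, 'h) cblinfun" where Y: "Y \<in> intertwiners E" "norm Y \<le> 1" "Y *\<^sub>V adj Y *\<^sub>V q = q"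
    using bistochastic_intertwiner[OF E, of "\<lambda>_. q"] by blast
  have "s *\<^sub>V q = (s o\<^sub>C Y) *\<^sub>V adj Y *\<^sub>V q" by (simp add: Y(3))
  also have "\<dots> = (Y o\<^sub>C t) *\<^sub>V adj Y *\<^sub>V q" using st Y(1) by (simp add: intertwined_def)
  finally have "s *\<^sub>V q = (Y o\<^sub>C (t o\<^sub>C adj Y)) *\<^sub>V q" by simp
  moreover have "norm (Y o\<^sub>C (t o\<^sub>C adj Y)) \<le> 1 * (norm t * 1)"
    using norm_adj_le[of Y] Y(2)
    by (intro order_trans[OF norm_ccompose] mult_mono) (auto intro: order_trans)
  ultimately show "norm (s *\<^sub>V q) \<le> norm t * norm q"
    using norm_cblinfun[of "Y o\<^sub>C (t o\<^sub>C adj Y)" q] by (simp add: order_trans mult_right_mono)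
qed simp

lemma intertwined_operations:
  fixes E :: "'x::finite \<Rightarrow> 'x \<Rightarrow> 'x \<Rightarrow> 'x \<Rightarrow> ('h::chilbert_space, 'h) cblinfun"
    and t t' :: "('x, 'c::infinite) univ_op"
  assumes "intertwined E t s" "intertwined E t' s'"
  shows "intertwined E (t + t') (s + s')" "intertwined E (t - t') (s - s')" "intertwined E (c *\<^sub>C t) (c *\<^sub>C s)"
    "intertwined E (t o\<^sub>C t') (s o\<^sub>C s')" "intertwined E (adj t) (adj s)"
proof -
  note ts = assms[unfolded intertwined_def, rule_format]
  show "intertwined E (t + t') (s + s')" "intertwined E (t - t') (s - s')" "intertwined E (c *\<^sub>C t) (c *\<^sub>C s)"
    "intertwined E (adj t) (adj s)"
    using ts unfolding intertwined_def by (auto simp: adj_linear ccompose_linear)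
  show "intertwined E (t o\<^sub>C t') (s o\<^sub>C s')"
    unfolding intertwined_def adj_ccompose
  proof (intro ballI conjI)
    fix Y :: "(('x, 'c) src ell2, 'h) cblinfun" assume Y: "Y \<in> intertwiners E"
    show "Y o\<^sub>C (t o\<^sub>C t') = s o\<^sub>C s' o\<^sub>C Y" "Y o\<^sub>C (adj t' o\<^sub>C adj t) = adj s' o\<^sub>C adj s o\<^sub>C Y"
      using ts[OF Y] by (metis ccompose_assoc)+
  qed
qed

lemma intertwined_unique:
  assumes E: "bistochastic E" and "intertwined E t s" "intertwined E t s'"
  shows "s = s'"
  using intertwined_norm_le[OF E intertwined_operations(2)[OF assms(2,3)]] by simp

lemma intertwined_cid: "intertwined E cid cid"
  by (simp add: intertwined_def)

lemma intertwined_zero: "intertwined E 0 0"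
  by (simp add: intertwined_def)

lemma intertwined_e_X:
  assumes E: "bistochastic E"
  shows "intertwined E (e_X x x' a a') (E x x' a a')"
proof -
  have "adj (op_of_matrix (xa_matrix E)) = op_of_matrix (xa_matrix E)"
    using E by (intro positive_op_selfadjoint) (simp add: bistochastic_def flip: block_positive_iff_positive_op)
  then have "adj (xa_matrix E (x, a) (x', a')) = xa_matrix E (x', a') (x, a)"
    by (metis entry_adj entry_op_of_matrix)
  then have "adj (E x x' a a') = E x' x a' a" by (simp add: xa_matrix_def)
  then show ?thesis by (simp add: intertwined_def intertwiners_def adj_e_X)
qed

text \<open>The operators with a partner contain the generators, are closed under the algebraic operations, and
  are closed in norm because a norm convergent sequence has Cauchy partners. So they contain \<open>C_X\<close>.\<close>

lemma intertwined_exists: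
  fixes E :: "'x::finite \<Rightarrow> 'x \<Rightarrow> 'x \<Rightarrow> 'x \<Rightarrow> ('h::chilbert_space, 'h) cblinfun"
    and t :: "('x, 'c::infinite) univ_op"
  assumes E: "bistochastic E" and t: "t \<in> C_X"
  shows "\<exists>s. intertwined E t s"
proof -
  let ?D = "{t :: ('x, 'c) univ_op. \<exists>s. intertwined E t s}"
  have "closed ?D"
    unfolding closed_sequential_limits
  proof (intro allI impI, elim conjE)
    fix T and t :: "('x, 'c) univ_op"
    assume "\<forall>n. T n \<in> ?D" and T: "T \<longlonglongrightarrow> t"
    then obtain S where S: "\<And>n. intertwined E (T n) (S n)" by auto metis
    have "Cauchy S"
    proof (rule metric_CauchyI)
      fix e :: real assume "e > 0"
      then obtain M where "\<And>m n. m \<ge> M \<Longrightarrow> n \<ge> M \<Longrightarrow> dist (T m) (T n) < e"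
        using metric_CauchyD[OF LIMSEQ_imp_Cauchy[OF T]] by blast
      moreover have "dist (S m) (S n) \<le> dist (T m) (T n)" for m n
        unfolding dist_norm by (rule intertwined_norm_le[OF E intertwined_operations(2)[OF S S]])
      ultimately show "\<exists>M. \<forall>m\<ge>M. \<forall>n\<ge>M. dist (S m) (S n) < e"
        by (meson order_le_less_trans)
    qed
    then obtain s where s: "S \<longlonglongrightarrow> s" using Cauchy_convergent convergent_def by blast
    have "Y o\<^sub>C t = s o\<^sub>C Y \<and> Y o\<^sub>C adj t = adj s o\<^sub>C Y" if Y: "Y \<in> intertwiners E"
      for Y :: "(('x, 'c) src ell2, 'h) cblinfun"
    proof
      have "(\<lambda>n. Y o\<^sub>C T n) \<longlonglongrightarrow> Y o\<^sub>C t" "(\<lambda>n. S n o\<^sub>C Y) \<longlonglongrightarrow> s o\<^sub>C Y"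
        "(\<lambda>n. Y o\<^sub>C adj (T n)) \<longlonglongrightarrow> Y o\<^sub>C adj t" "(\<lambda>n. adj (S n) o\<^sub>C Y) \<longlonglongrightarrow> adj s o\<^sub>C Y"
        by (intro tendsto_ccompose tendsto_const T s bounded_linear.tendsto[OF bounded_linear_adj])+
      moreover have "Y o\<^sub>C T n = S n o\<^sub>C Y" "Y o\<^sub>C adj (T n) = adj (S n) o\<^sub>C Y" for n
        using S Y by (auto simp: intertwined_def)
      ultimately show "Y o\<^sub>C t = s o\<^sub>C Y" "Y o\<^sub>C adj t = adj s o\<^sub>C Y"
        using LIMSEQ_unique by auto
    qed
    then show "t \<in> ?D" by (auto simp: intertwined_def)
  qed
  moreover have "csubspace ?D"
    by (rule complex_vector.subspaceI) (use intertwined_zero intertwined_operations(1,3) in blast)+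
  moreover have "cid \<in> ?D" using intertwined_cid by blast
  moreover have "S o\<^sub>C T \<in> ?D" if "S \<in> ?D" "T \<in> ?D" for S T using that intertwined_operations(4) by blast
  moreover have "adj T \<in> ?D" if "T \<in> ?D" for T using that intertwined_operations(5) by blast
  ultimately have "unital_cstar_algebra ?D" unfolding unital_cstar_algebra_def by blast
  then have "C_X \<subseteq> ?D"
    by (rule C_X_minimal) (use intertwined_e_X[OF E] in blast)
  then show ?thesis using t by blast
qed

definition induced_rep ::
  "('x \<Rightarrow> 'x \<Rightarrow> 'x \<Rightarrow> 'x \<Rightarrow> ('h::chilbert_space, 'h) cblinfun) \<Rightarrow> ('x::finite, 'c::infinite) univ_op \<Rightarrow> ('h, 'h) cblinfun"
  where "induced_rep E t = (THE s. intertwined E t s)"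

lemma induced_rep_eq:
  assumes "bistochastic E" "intertwined E t s"
  shows "induced_rep E t = s"
  unfolding induced_rep_def using assms intertwined_unique by (intro the_equality) blast+

lemma intertwined_induced_rep:
  assumes "bistochastic E" "t \<in> C_X"
  shows "intertwined E t (induced_rep E t)"
  using intertwined_exists[OF assms] induced_rep_eq[OF assms(1)] by blast

lemma induced_rep_e_X: "bistochastic E \<Longrightarrow> induced_rep E (e_X x x' a a') = E x x' a a'"
  using induced_rep_eq intertwined_e_X by blast

lemma induced_rep_cid: "bistochastic E \<Longrightarrow> induced_rep E cid = cid"
  using induced_rep_eq intertwined_cid by blast

lemma star_representation_induced_rep:
  assumes E: "bistochastic E"
  shows "star_representation C_X (induced_rep E)"
proof -
  note i = intertwined_induced_rep[OF E]
  show ?thesis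
    unfolding star_representation_def clinear_on_def
    by (intro conjI ballI allI; rule induced_rep_eq[OF E]) (blast intro: intertwined_operations i)+
qed

text \<open>An intertwiner adapted to the test vectors \<open>\<xi>\<close> transports them to the vectors \<open>Y\<^sup>* \<xi>\<close>, at which the form
  of \<open>T\<close> is known to be non-negative.\<close>

lemma block_positive_induced_rep:
  fixes T :: "nat \<Rightarrow> nat \<Rightarrow> ('x::finite, 'c::infinite) univ_op"
    and E :: "'x \<Rightarrow> 'x \<Rightarrow> 'x \<Rightarrow> 'x \<Rightarrow> ('h::chilbert_space, 'h) cblinfun"
  assumes E: "bistochastic E" and T: "\<And>i j. i \<in> I \<Longrightarrow> j \<in> I \<Longrightarrow> T i j \<in> C_X" "block_positive I T"
  shows "block_positive I (\<lambda>i j. induced_rep E (T i j))"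
  unfolding block_positive_def
proof
  fix \<xi> :: "nat \<Rightarrow> 'h"
  obtain Y :: "(('x, 'c) src ell2, 'h) cblinfun" where Y: "Y \<in> intertwiners E" "\<And>n. Y *\<^sub>V adj Y *\<^sub>V \<xi> n = \<xi> n"
    using bistochastic_intertwiner[OF E, of \<xi>] by blast
  have "cinner (\<xi> i) (induced_rep E (T i j) *\<^sub>V \<xi> j) = cinner (adj Y *\<^sub>V \<xi> i) (T i j *\<^sub>V adj Y *\<^sub>V \<xi> j)"
    if "i \<in> I" "j \<in> I" for i j
  proof -
    have "induced_rep E (T i j) *\<^sub>V \<xi> j = (induced_rep E (T i j) o\<^sub>C Y) *\<^sub>V adj Y *\<^sub>V \<xi> j"
      by (simp add: Y(2))
    also have "\<dots> = (Y o\<^sub>C T i j) *\<^sub>V adj Y *\<^sub>V \<xi> j"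
      using intertwined_induced_rep[OF E T(1)[OF that]] Y(1) by (simp add: intertwined_def)
    finally show ?thesis by (simp add: cinner_adj_left)
  qed
  then have "(\<Sum>i\<in>I. \<Sum>j\<in>I. cinner (\<xi> i) (induced_rep E (T i j) *\<^sub>V \<xi> j))
      = (\<Sum>i\<in>I. \<Sum>j\<in>I. cinner (adj Y *\<^sub>V \<xi> i) (T i j *\<^sub>V adj Y *\<^sub>V \<xi> j))"
    by (intro sum.cong refl)
  also have "\<dots> \<in> \<real>\<^sub>\<ge>\<^sub>0"
    using T(2)[unfolded block_positive_def, THEN spec, of "\<lambda>i. adj Y *\<^sub>V \<xi> i"] .
  finally show "(\<Sum>i\<in>I. \<Sum>j\<in>I. cinner (\<xi> i) (induced_rep E (T i j) *\<^sub>V \<xi> j)) \<in> \<real>\<^sub>\<ge>\<^sub>0" .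
qed

section \<open>Completely positive maps on the operator system\<close>

lemma clinear_on_zero:
  assumes "csubspace S" "clinear_on S \<phi>"
  shows "\<phi> 0 = 0"
proof -
  have "\<phi> (0 *\<^sub>C 0) = 0 *\<^sub>C \<phi> 0"
    using assms complex_vector.subspace_0[OF assms(1)] unfolding clinear_on_def by blast
  then show ?thesis by simp
qed

lemma clinear_on_sum:
  assumes S: "csubspace S" and \<phi>: "clinear_on S \<phi>" and f: "\<And>i. i \<in> I \<Longrightarrow> f i \<in> S"
  shows "\<phi> (sum f I) = (\<Sum>i\<in>I. \<phi> (f i))"
  using f
proof (induction I rule: infinite_finite_induct)
  case (insert i I)
  then have "sum f I \<in> S" by (intro complex_vector.subspace_sum[OF S]) simp
  then have "\<phi> (f i + sum f I) = \<phi> (f i) + \<phi> (sum f I)"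
    using \<phi> insert.prems unfolding clinear_on_def by simp
  then show ?case using insert by simp
qed (simp_all add: clinear_on_zero[OF S \<phi>])

lemma clinear_on_T_X_eqI:
  assumes lin: "clinear_on T_X \<phi>" "clinear_on T_X \<psi>"
    and eq: "\<And>x x' a a'. \<phi> (e_X x x' a a') = \<psi> (e_X x x' a a')" and t: "t \<in> T_X"
  shows "\<phi> t = \<psi> t"
proof -
  let ?D = "{t \<in> T_X. \<phi> t = \<psi> t}"
  have "csubspace ?D"
    using lin clinear_on_zero[OF csubspace_T_X lin(1)] clinear_on_zero[OF csubspace_T_X lin(2)]
    by (intro complex_vector.subspaceI)
      (auto simp: clinear_on_def intro: complex_vector.subspace_0 complex_vector.subspace_add
        complex_vector.subspace_scale csubspace_T_X)
  then have "cspan {e_X x x' a a' | x x' a a'. True} \<subseteq> ?D"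
    using eq e_X_in_T_X by (intro complex_vector.span_minimal) auto
  then show ?thesis using t by (auto simp: T_X_def)
qed

lemma sum_e_X_image:
  assumes "clinear_on T_X \<phi>"
  shows "(\<Sum>a\<in>UNIV. \<phi> (e_X x x' a a)) = (if x = x' then \<phi> cid else 0)"
    "(\<Sum>x\<in>UNIV. \<phi> (e_X x x a a')) = (if a = a' then \<phi> cid else 0)"
proof -
  note sum = clinear_on_sum[OF csubspace_T_X assms, of UNIV, symmetric]
  have if_\<phi>: "\<phi> (if P then cid else 0) = (if P then \<phi> cid else 0)" for P
    using clinear_on_zero[OF csubspace_T_X assms] by simp
  show "(\<Sum>a\<in>UNIV. \<phi> (e_X x x' a a)) = (if x = x' then \<phi> cid else 0)"
    using sum[of "\<lambda>a. e_X x x' a a"] by (simp only: e_X_in_T_X sum_e_X if_\<phi>)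
  show "(\<Sum>x\<in>UNIV. \<phi> (e_X x x a a')) = (if a = a' then \<phi> cid else 0)"
    using sum[of "\<lambda>x. e_X x x a a'"] by (simp only: e_X_in_T_X sum_e_X if_\<phi>)
qed

lemma clinear_on_subset: "clinear_on S \<phi> \<Longrightarrow> S' \<subseteq> S \<Longrightarrow> clinear_on S' \<phi>"
  unfolding clinear_on_def by blast

lemma block_positive_reindex:
  fixes T :: "'i \<Rightarrow> 'i \<Rightarrow> ('h::chilbert_space, 'h) cblinfun"
  assumes f: "bij_betw f (J :: 'j set) I"
  shows "block_positive I T \<longleftrightarrow> block_positive J (\<lambda>i j. T (f i) (f j))"
proof -
  have re: "(\<Sum>i\<in>I. \<Sum>j\<in>I. cinner (\<xi> i) (T i j *\<^sub>V \<xi> j))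
      = (\<Sum>i\<in>J. \<Sum>j\<in>J. cinner (\<xi> (f i)) (T (f i) (f j) *\<^sub>V \<xi> (f j)))" for \<xi>
    unfolding sum.reindex_bij_betw[OF f, symmetric] ..
  show ?thesis
  proof
    assume P: "block_positive J (\<lambda>i j. T (f i) (f j))"
    show "block_positive I T" unfolding block_positive_def re
      using P[unfolded block_positive_def, THEN spec, of "\<lambda>i. \<xi> (f i)" for \<xi>] by blast
  next
    assume P: "block_positive I T"
    show "block_positive J (\<lambda>i j. T (f i) (f j))" unfolding block_positive_def
    proof
      fix \<zeta> :: "'j \<Rightarrow> 'h"
      define \<xi> where "\<xi> i = \<zeta> (inv_into J f i)" for i
      have \<xi>: "\<xi> (f i) = \<zeta> i" if "i \<in> J" for i
        using f that by (simp add: \<xi>_def bij_betw_def)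
      have "(\<Sum>i\<in>J. \<Sum>j\<in>J. cinner (\<zeta> i) (T (f i) (f j) *\<^sub>V \<zeta> j))
          = (\<Sum>i\<in>J. \<Sum>j\<in>J. cinner (\<xi> (f i)) (T (f i) (f j) *\<^sub>V \<xi> (f j)))"
        by (intro sum.cong refl) (simp add: \<xi>)
      also have "\<dots> \<in> \<real>\<^sub>\<ge>\<^sub>0"
        using P[unfolded block_positive_def, THEN spec, of \<xi>] unfolding re .
      finally show "(\<Sum>i\<in>J. \<Sum>j\<in>J. cinner (\<zeta> i) (T (f i) (f j) *\<^sub>V \<zeta> j)) \<in> \<real>\<^sub>\<ge>\<^sub>0" .
    qed
  qed
qed

lemma block_positive_conjugate:
  assumes "block_positive I T"
  shows "block_positive I (\<lambda>i j. adj R o\<^sub>C T i j o\<^sub>C R)"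
  unfolding block_positive_def
proof
  fix \<xi>
  show "(\<Sum>i\<in>I. \<Sum>j\<in>I. cinner (\<xi> i) ((adj R o\<^sub>C T i j o\<^sub>C R) *\<^sub>V \<xi> j)) \<in> \<real>\<^sub>\<ge>\<^sub>0"
    using assms[unfolded block_positive_def, THEN spec, of "\<lambda>i. R *\<^sub>V \<xi> i"]
    by (simp add: cinner_adj_right)
qed

lemma block_positive_diagonal:
  assumes "block_positive I T" "finite I" "k \<in> I"
  shows "cinner \<xi> (T k k *\<^sub>V \<xi>) \<in> \<real>\<^sub>\<ge>\<^sub>0"
proof -
  let ?\<zeta> = "\<lambda>i. if i = k then \<xi> else 0"
  have "(\<Sum>i\<in>I. \<Sum>j\<in>I. cinner (?\<zeta> i) (T i j *\<^sub>V ?\<zeta> j))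
      = (\<Sum>i\<in>I. \<Sum>j\<in>I. if j = k then (if i = k then cinner \<xi> (T k k *\<^sub>V \<xi>) else 0) else 0)"
    by (intro sum.cong refl) (auto simp: cblinfun_apply_linear)
  also have "\<dots> = cinner \<xi> (T k k *\<^sub>V \<xi>)" using assms(2,3) by simp
  finally show ?thesis using assms(1)[unfolded block_positive_def, THEN spec, of ?\<zeta>] by simp
qed

lemma block_positive_limit:
  fixes S T :: "'i \<Rightarrow> 'i \<Rightarrow> ('h::chilbert_space, 'h) cblinfun"
  assumes "\<And>e. e > 0 \<Longrightarrow> block_positive I (\<lambda>i j. S i j + complex_of_real e *\<^sub>C T i j)"
  shows "block_positive I S"
  unfolding block_positive_def
proof
  fix \<xi>
  let ?q = "\<lambda>T :: 'i \<Rightarrow> 'i \<Rightarrow> ('h, 'h) cblinfun. \<Sum>i\<in>I. \<Sum>j\<in>I. cinner (\<xi> i) (T i j *\<^sub>V \<xi> j)"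
  have pos: "?q S + complex_of_real e * ?q T \<in> \<real>\<^sub>\<ge>\<^sub>0" if "e > 0" for e
    using assms[OF that, unfolded block_positive_def, THEN spec, of \<xi>]
    by (simp add: cinner_add_right cinner_scaleC_right sum.distrib sum_distrib_left)
  have "?q S + complex_of_real (inverse (real (Suc n))) * ?q T \<in> \<real>\<^sub>\<ge>\<^sub>0" for n
    by (rule pos) simp
  moreover have "(\<lambda>n. ?q S + complex_of_real (inverse (real (Suc n))) * ?q T) \<longlonglongrightarrow> ?q S + complex_of_real 0 * ?q T"
    by (intro tendsto_intros LIMSEQ_inverse_real_of_nat)
  ultimately have "?q S + complex_of_real 0 * ?q T \<in> \<real>\<^sub>\<ge>\<^sub>0"
    by (rule closed_sequentially[OF closed_nonneg_Reals_complex])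
  then show "?q S \<in> \<real>\<^sub>\<ge>\<^sub>0" by simp
qed

lemma block_positive_e_X: "block_positive UNIV (xa_matrix e_X)"
proof -
  have eq: "xa_matrix e_X = (\<lambda>i j. adj (univ_biiso (snd i) (fst i)) o\<^sub>C univ_biiso (snd j) (fst j))"
    by (simp add: xa_matrix_def e_X_def fun_eq_iff)
  show ?thesis unfolding eq by (rule block_positive_gram)
qed

text \<open>Complete positivity is applied to the Gram matrix of the \<open>v\<^sub>a\<^sub>,\<^sub>x\<close>, after its index set has been numbered.\<close>

lemma cp_on_imp_block_positive:
  fixes \<phi> :: "('x::finite, 'c::infinite) univ_op \<Rightarrow> ('h::chilbert_space, 'h) cblinfun"
  assumes "cp_on T_X \<phi>"
  shows "block_positive UNIV (xa_matrix (\<lambda>x x' a a'. \<phi> (e_X x x' a a')))"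
proof -
  obtain f :: "nat \<Rightarrow> 'x \<times> 'x" where f: "bij_betw f {..<card (UNIV :: ('x \<times> 'x) set)} UNIV"
    using ex_bij_betw_nat_finite[of "UNIV :: ('x \<times> 'x) set"] by (auto simp: lessThan_atLeast0)
  let ?T = "\<lambda>i j. xa_matrix e_X (f i) (f j) :: ('x, 'c) univ_op"
  have "?T i j \<in> T_X" for i j
    by (simp add: xa_matrix_def e_X_in_T_X split: prod.split)
  moreover have "block_positive {..<card (UNIV :: ('x \<times> 'x) set)} ?T"
    using block_positive_e_X block_positive_reindex[OF f, of "xa_matrix e_X"] by blast
  ultimately have "block_positive {..<card (UNIV :: ('x \<times> 'x) set)} (\<lambda>i j. \<phi> (?T i j))"
    using assms[unfolded cp_on_def, THEN conjunct2, THEN spec, THEN spec, of _ ?T] by blast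
  then have "block_positive UNIV (\<lambda>i j. \<phi> (xa_matrix e_X i j))"
    using block_positive_reindex[OF f, of "\<lambda>i j. \<phi> (xa_matrix e_X i j)"] by simp
  moreover have "(\<lambda>i j. \<phi> (xa_matrix e_X i j)) = xa_matrix (\<lambda>x x' a a'. \<phi> (e_X x x' a a'))"
    by (simp add: xa_matrix_def fun_eq_iff)
  ultimately show ?thesis by simp
qed

text \<open>After scaling, \<open>P + e = c (1 - x)\<close> with \<open>\<parallel>x\<parallel> < 1\<close>, so \<open>(1 - x)\<^sup>-\<^sup>1\<close> exists as the fixed point of \<open>z \<mapsto> 1 + x z\<close>. The
  inverse of the square root \<open>R\<close> is \<open>R\<close> times the inverse of \<open>R\<^sup>2\<close>.\<close>

lemma inverse_square_root:
  fixes P :: "('h::chilbert_space, 'h) cblinfun"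
  assumes P: "positive_op P" and e: "e > 0"
  obtains R L where "adj R = R" "adj L = L" "R o\<^sub>C R = P + complex_of_real e *\<^sub>C cid"
    "L o\<^sub>C R = cid" "R o\<^sub>C L = cid"
proof -
  let ?P = "P + complex_of_real e *\<^sub>C cid"
  have q: "cinner \<xi> (?P *\<^sub>V \<xi>) = cinner \<xi> (P *\<^sub>V \<xi>) + complex_of_real (e * (norm \<xi>)\<^sup>2)" for \<xi>
    by (simp add: cinner_add_right cinner_scaleC_right cinner_self)
  have lower: "Re (cinner \<xi> (?P *\<^sub>V \<xi>)) \<ge> e * (norm \<xi>)\<^sup>2" for \<xi>
    using P unfolding q positive_op_def complex_nonneg_Reals_iff by simp
  have P': "positive_op ?P"
    unfolding positive_op_def q
    using P e by (intro allI nonneg_Reals_add_I) (auto simp: positive_op_def nonneg_Reals_of_real_iff)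
  have sa: "adj ?P = ?P" by (rule positive_op_selfadjoint[OF P'])
  \<comment> \<open>The summand \<open>e\<close> ensures \<open>e / c \<le> 1\<close>, so that \<open>sqrt (1 - e / c)\<close> is a contraction constant.\<close>
  define c where "c = norm ?P + e"
  have c: "c > 0" "norm ?P \<le> c" "e / c \<le> 1"
    using e by (simp_all add: c_def add_nonneg_pos)
  define x where "x = cid - complex_of_real (1 / c) *\<^sub>C ?P"
  have bound: "norm (x *\<^sub>V \<xi>) \<le> sqrt (1 - e / c) * norm \<xi>" for \<xi>
  proof -
    have x\<xi>: "x *\<^sub>V \<xi> = \<xi> - complex_of_real (1 / c) *\<^sub>C (?P *\<^sub>V \<xi>)" by (simp add: x_def)
    have "(norm (x *\<^sub>V \<xi>))\<^sup>2 \<le> (norm \<xi>)\<^sup>2 - Re (cinner \<xi> (?P *\<^sub>V \<xi>)) / c"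
      unfolding x\<xi> by (rule positive_op_contraction[OF P' c(2,1)])
    also have "\<dots> \<le> (norm \<xi>)\<^sup>2 - e * (norm \<xi>)\<^sup>2 / c"
      by (intro diff_left_mono divide_right_mono lower) (use c in simp)
    also have "\<dots> = (sqrt (1 - e / c) * norm \<xi>)\<^sup>2"
      using c(3) by (simp add: power_mult_distrib algebra_simps)
    finally show ?thesis by (rule power2_le_imp_le) (use c(3) in simp)
  qed
  have nx: "norm x \<le> sqrt (1 - e / c)"
    by (rule norm_cblinfun_le[OF _ bound]) (use c(3) in simp)
  have contr: "dist (cid + x o\<^sub>C z) (cid + x o\<^sub>C w) \<le> sqrt (1 - e / c) * dist z w" for z w
  proof -
    have "dist (cid + x o\<^sub>C z) (cid + x o\<^sub>C w) = norm (x o\<^sub>C (z - w))"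
      by (simp add: dist_norm ccompose_linear)
    also have "\<dots> \<le> norm x * norm (z - w)" by (rule norm_ccompose)
    also have "\<dots> \<le> sqrt (1 - e / c) * dist z w"
      unfolding dist_norm by (intro mult_right_mono nx) simp
    finally show ?thesis .
  qed
  have "\<exists>!z. cid + x o\<^sub>C z = z"
    by (rule banach_fix_type[of "sqrt (1 - e / c)"]) (use e c contr in auto)
  then obtain z where z: "cid + x o\<^sub>C z = z" by blast
  define Q where "Q = complex_of_real (1 / c) *\<^sub>C z"
  have PQ: "?P o\<^sub>C Q = cid"
  proof -
    have "cid - x = complex_of_real (1 / c) *\<^sub>C ?P" by (simp add: x_def)
    then have "?P o\<^sub>C Q = (cid - x) o\<^sub>C z" unfolding Q_def by (simp only: ccompose_linear(5,6))
    also have "\<dots> = z - x o\<^sub>C z" by (simp only: ccompose_linear(3) ccompose_simps)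
    also have "\<dots> = cid" unfolding diff_eq_eq by (rule z[symmetric])
    finally show ?thesis .
  qed
  then have QP: "adj Q o\<^sub>C ?P = cid" using sa by (metis adj_ccompose adj_simps(2))
  have "adj Q = adj Q o\<^sub>C (?P o\<^sub>C Q)" by (simp add: PQ)
  also have "\<dots> = Q" by (simp only: ccompose_assoc[symmetric] QP ccompose_simps)
  finally have Q: "adj Q = Q" .
  obtain R where R: "adj R = R" "R o\<^sub>C R = ?P"
    using positive_op_sqrt[OF unital_cstar_algebra_UNIV _ P'] by blast
  have 1: "(Q o\<^sub>C R) o\<^sub>C R = cid" using QP by (simp only: Q ccompose_assoc R)
  have 2: "R o\<^sub>C (R o\<^sub>C Q) = cid" using PQ by (simp only: ccompose_assoc[symmetric] R)
  have "Q o\<^sub>C R = (Q o\<^sub>C R) o\<^sub>C (R o\<^sub>C (R o\<^sub>C Q))" by (simp only: 2 ccompose_simps)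
  also have "\<dots> = R o\<^sub>C Q" by (simp only: 1 ccompose_assoc[symmetric] ccompose_simps)
  finally have QR: "Q o\<^sub>C R = R o\<^sub>C Q" .
  show thesis
  proof (rule that[of R "Q o\<^sub>C R"])
    show "adj (Q o\<^sub>C R) = Q o\<^sub>C R" by (simp add: adj_ccompose Q R QR)
    show "R o\<^sub>C (Q o\<^sub>C R) = cid" by (simp only: QR 2)
  qed (rule R 1)+
qed

text \<open>The bistochastic matrix used for the perturbation: its induced map is a unital completely positive
  map into \<open>B(H)\<close> for any \<open>H\<close>.\<close>

lemma bistochastic_uniform:
  fixes E :: "'x::finite \<Rightarrow> 'x \<Rightarrow> 'x \<Rightarrow> 'x \<Rightarrow> ('h::chilbert_space, 'h) cblinfun"
  assumes E: "\<And>x x' a a'. E x x' a a' =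
    (if x = x' \<and> a = a' then complex_of_real (1 / real (card (UNIV :: 'x set))) *\<^sub>C cid else 0)"
  shows "bistochastic E"
proof -
  let ?c = "complex_of_real (1 / real (card (UNIV :: 'x set)))"
  have "block_positive UNIV (xa_matrix E)"
    unfolding block_positive_def
  proof
    fix \<xi> :: "'x \<times> 'x \<Rightarrow> 'h"
    have "(\<Sum>i\<in>UNIV. \<Sum>j\<in>UNIV. cinner (\<xi> i) (xa_matrix E i j *\<^sub>V \<xi> j))
        = (\<Sum>i\<in>UNIV. \<Sum>j\<in>UNIV. if j = i then ?c * cinner (\<xi> i) (\<xi> i) else 0)"
      by (intro sum.cong refl) (auto simp: E xa_matrix_def cinner_scaleC_right split: prod.split)
    also have "\<dots> = ?c * (\<Sum>i\<in>UNIV. cinner (\<xi> i) (\<xi> i))" by (simp add: sum_distrib_left)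
    also have "\<dots> \<in> \<real>\<^sub>\<ge>\<^sub>0"
      by (intro nonneg_Reals_mult_I sum_cinner_square_nonneg) (simp add: nonneg_Reals_of_real_iff del: of_real_divide)
    finally show "(\<Sum>i\<in>UNIV. \<Sum>j\<in>UNIV. cinner (\<xi> i) (xa_matrix E i j *\<^sub>V \<xi> j)) \<in> \<real>\<^sub>\<ge>\<^sub>0" .
  qed
  moreover have "(\<Sum>i\<in>(UNIV :: 'x set). ?c *\<^sub>C cid) = (cid :: ('h, 'h) cblinfun)"
  proof (rule cblinfun_eqI)
    fix v :: 'h
    have "(\<Sum>i\<in>(UNIV :: 'x set). ?c *\<^sub>C v) = (\<Sum>i\<in>(UNIV :: 'x set). ?c) *\<^sub>C v"
      by (simp only: complex_vector.scale_sum_left)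
    then show "(\<Sum>i\<in>(UNIV :: 'x set). ?c *\<^sub>C cid) *\<^sub>V v = cid *\<^sub>V v"
      by (simp add: cblinfun_sum_apply)
  qed
  ultimately show ?thesis unfolding bistochastic_def by (simp add: E)
qed

lemma clinear_on_induced_rep:
  "bistochastic E \<Longrightarrow> clinear_on C_X (induced_rep E)"
  using star_representation_induced_rep unfolding star_representation_def by blast

text \<open>Let \<open>\<tau>\<close> be the map induced by the uniform matrix and \<open>\<phi>\<^sub>e = \<phi> + e \<tau>\<close>. The operator \<open>\<phi>\<^sub>e(1) = \<phi>(1) + e\<close> has
  an invertible square root \<open>R\<close>, and \<open>\<psi> = R\<^sup>-\<^sup>1 \<phi>\<^sub>e R\<^sup>-\<^sup>1\<close> is unital with a positive matrix of generators, hence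
  the restriction of an induced representation. So \<open>\<phi>\<^sub>e = R \<psi> R\<close> preserves positivity of \<open>T\<close>; let \<open>e \<rightarrow> 0\<close>.\<close>

lemma block_positive_imp_cp_on:
  fixes \<phi> :: "('x::finite, 'c::infinite) univ_op \<Rightarrow> ('h::chilbert_space, 'h) cblinfun"
  assumes \<phi>: "clinear_on T_X \<phi>"
    and pos: "block_positive UNIV (xa_matrix (\<lambda>x x' a a'. \<phi> (e_X x x' a a')))"
  shows "cp_on T_X \<phi>"
  unfolding cp_on_def
proof (intro conjI allI impI)
  fix n and T :: "nat \<Rightarrow> nat \<Rightarrow> ('x, 'c) univ_op"
  assume TX: "\<forall>i<n. \<forall>j<n. T i j \<in> T_X" and T: "block_positive {..<n} T"
  define E0 :: "'x \<Rightarrow> 'x \<Rightarrow> 'x \<Rightarrow> 'x \<Rightarrow> ('h, 'h) cblinfun" where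
    "E0 = (\<lambda>x x' a a'. if x = x' \<and> a = a' then complex_of_real (1 / real (card (UNIV :: 'x set))) *\<^sub>C cid else 0)"
  have E0: "bistochastic E0" by (rule bistochastic_uniform) (simp add: E0_def)
  define \<tau> where "\<tau> = (induced_rep E0 :: ('x, 'c) univ_op \<Rightarrow> _)"
  have \<tau>: "clinear_on T_X \<tau>"
    unfolding \<tau>_def by (rule clinear_on_subset[OF clinear_on_induced_rep[OF E0] T_X_subset_C_X])
  have \<tau>e: "\<tau> (e_X x x' a a') = E0 x x' a a'" for x x' a a'
    unfolding \<tau>_def by (rule induced_rep_e_X[OF E0])
  have P: "positive_op (\<phi> cid)"
    unfolding positive_op_def
  proof
    fix \<xi>
    have d: "cinner \<xi> (\<phi> (e_X x x a a) *\<^sub>V \<xi>) \<in> \<real>\<^sub>\<ge>\<^sub>0" for x a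
      using block_positive_diagonal[OF pos finite UNIV_I, where k = "(x, a)" and \<xi> = \<xi>] by (simp add: xa_matrix_def)
    \<comment> \<open>For any fixed \<open>x\<close>, the diagonal entries \<open>e\<^sub>x\<^sub>,\<^sub>x\<^sub>,\<^sub>a\<^sub>,\<^sub>a\<close> sum to \<open>1\<close>; \<open>undefined\<close> is one such \<open>x\<close>.\<close>
    have "cinner \<xi> (\<phi> cid *\<^sub>V \<xi>) = (\<Sum>a\<in>UNIV. cinner \<xi> (\<phi> (e_X undefined undefined a a) *\<^sub>V \<xi>))"
      using sum_e_X_image(1)[OF \<phi>, of undefined undefined, symmetric]
      by (simp add: cblinfun_sum_apply cinner_sum_right)
    also have "\<dots> \<in> \<real>\<^sub>\<ge>\<^sub>0"
      using d by (auto simp: complex_nonneg_Reals_iff intro: sum_nonneg)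
    finally show "cinner \<xi> (\<phi> cid *\<^sub>V \<xi>) \<in> \<real>\<^sub>\<ge>\<^sub>0" .
  qed
  show "block_positive {..<n} (\<lambda>i j. \<phi> (T i j))"
  proof (rule block_positive_limit)
    fix e :: real assume e: "e > 0"
    define \<phi>e where "\<phi>e t = \<phi> t + complex_of_real e *\<^sub>C \<tau> t" for t
    have \<phi>e: "clinear_on T_X \<phi>e"
      using \<phi> \<tau> unfolding clinear_on_def \<phi>e_def
      by (auto simp: scaleC_add_right scaleC_scaleC mult.commute)
    have \<phi>e_cid: "\<phi>e cid = \<phi> cid + complex_of_real e *\<^sub>C cid"
      by (simp add: \<phi>e_def \<tau>_def induced_rep_cid[OF E0])
    obtain R L where R: "adj R = R" "adj L = L" "R o\<^sub>C R = \<phi>e cid" "L o\<^sub>C R = cid" "R o\<^sub>C L = cid"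
      using inverse_square_root[OF P e] unfolding \<phi>e_cid by metis
    define \<psi> where "\<psi> t = L o\<^sub>C \<phi>e t o\<^sub>C L" for t
    have \<psi>: "clinear_on T_X \<psi>"
      using \<phi>e unfolding clinear_on_def \<psi>_def by (auto simp: ccompose_linear)
    have \<psi>_cid: "\<psi> cid = cid"
    proof -
      have "\<psi> cid = (L o\<^sub>C R) o\<^sub>C (R o\<^sub>C L)" by (simp only: \<psi>_def R(3)[symmetric] ccompose_assoc)
      then show ?thesis by (simp add: R)
    qed
    define F where "F = (\<lambda>x x' a a'. \<psi> (e_X x x' a a'))"
    have "block_positive UNIV (xa_matrix F)"
    proof -
      \<comment> \<open>Multiplication by \<open>e\<close> is conjugation by the scalar \<open>sqrt e\<close>.\<close>
      have "block_positive UNIV (\<lambda>i j. complex_of_real e *\<^sub>C xa_matrix E0 i j)"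
      proof -
        have "block_positive UNIV (\<lambda>i j. adj (complex_of_real (sqrt e) *\<^sub>C cid) o\<^sub>C xa_matrix E0 i j o\<^sub>C (complex_of_real (sqrt e) *\<^sub>C cid))"
          using E0 unfolding bistochastic_def by (intro block_positive_conjugate) blast
        moreover have "complex_of_real (sqrt e) * complex_of_real (sqrt e) = complex_of_real e"
          using e by (simp flip: of_real_mult)
        ultimately show ?thesis by (simp add: adj_linear ccompose_linear scaleC_scaleC)
      qed
      then have "block_positive UNIV (\<lambda>i j. adj L o\<^sub>C
          (xa_matrix (\<lambda>x x' a a'. \<phi> (e_X x x' a a')) i j + complex_of_real e *\<^sub>C xa_matrix E0 i j) o\<^sub>C L)"
        by (intro block_positive_conjugate block_positive_add pos)
      moreover have "(\<lambda>i j. adj L o\<^sub>C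
          (xa_matrix (\<lambda>x x' a a'. \<phi> (e_X x x' a a')) i j + complex_of_real e *\<^sub>C xa_matrix E0 i j) o\<^sub>C L) = xa_matrix F"
        by (simp add: fun_eq_iff xa_matrix_def F_def \<psi>_def \<phi>e_def \<tau>e R(2))
      ultimately show ?thesis by simp
    qed
    then have F: "bistochastic F"
      using sum_e_X_image[OF \<psi>] unfolding bistochastic_def by (simp add: F_def \<psi>_cid)
    have rep: "\<psi> t = induced_rep F t" if "t \<in> T_X" for t :: "('x, 'c) univ_op"
      by (rule clinear_on_T_X_eqI[OF \<psi> clinear_on_subset[OF clinear_on_induced_rep[OF F] T_X_subset_C_X] _ that])
        (simp add: induced_rep_e_X[OF F], simp add: F_def)
    have "\<phi>e t = adj R o\<^sub>C induced_rep F t o\<^sub>C R" if "t \<in> T_X" for t :: "('x, 'c) univ_op"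
    proof -
      have "\<phi>e t = (R o\<^sub>C L) o\<^sub>C \<phi>e t o\<^sub>C (L o\<^sub>C R)" by (simp add: R)
      also have "\<dots> = R o\<^sub>C \<psi> t o\<^sub>C R" by (simp only: \<psi>_def ccompose_assoc)
      finally show ?thesis using rep[OF that] by (simp add: R)
    qed
    moreover have "block_positive {..<n} (\<lambda>i j. adj R o\<^sub>C induced_rep F (T i j) o\<^sub>C R)"
      using TX T_X_subset_C_X by (intro block_positive_conjugate block_positive_induced_rep[OF F _ T]) auto
    ultimately show "block_positive {..<n} (\<lambda>i j. \<phi> (T i j) + complex_of_real e *\<^sub>C \<tau> (T i j))"
      using TX by (simp add: block_positive_def \<phi>e_def cong: sum.cong_simp)
  qed
qed (rule \<phi>)

text \<open>The partial sums of \<open>(\<phi>(e))\<close> are \<open>\<delta> \<phi>(1)\<close> by linearity, so only the value at \<open>1\<close> separates positive from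
  bistochastic matrices.\<close>

lemma bistochastic_iff:
  assumes "clinear_on T_X \<phi>"
  shows "bistochastic (\<lambda>x x' a a'. \<phi> (e_X x x' a a')) \<longleftrightarrow>
    block_positive UNIV (xa_matrix (\<lambda>x x' a a'. \<phi> (e_X x x' a a'))) \<and> \<phi> cid = cid"
  unfolding bistochastic_def sum_e_X_image[OF assms] by auto

lemma cp_on_iff_block_positive:
  assumes "clinear_on T_X \<phi>"
  shows "cp_on T_X \<phi> \<longleftrightarrow> block_positive UNIV (xa_matrix (\<lambda>x x' a a'. \<phi> (e_X x x' a a')))"
  using assms cp_on_imp_block_positive block_positive_imp_cp_on by blast

lemma ucp_on_iff_bistochastic:
  assumes "clinear_on T_X \<phi>"
  shows "ucp_on T_X \<phi> \<longleftrightarrow> bistochastic (\<lambda>x x' a a'. \<phi> (e_X x x' a a'))"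
  unfolding ucp_on_def bistochastic_iff[OF assms] cp_on_iff_block_positive[OF assms] ..

lemma bistochastic_iff_representation:
  fixes \<phi> :: "('x::finite, 'c::infinite) univ_op \<Rightarrow> ('h::chilbert_space, 'h) cblinfun"
  assumes \<phi>: "clinear_on T_X \<phi>"
  shows "bistochastic (\<lambda>x x' a a'. \<phi> (e_X x x' a a')) \<longleftrightarrow>
    (\<exists>\<pi>. star_representation C_X \<pi> \<and> \<pi> cid = cid \<and> (\<forall>t\<in>T_X. \<phi> t = \<pi> t))"
proof
  assume E: "bistochastic (\<lambda>x x' a a'. \<phi> (e_X x x' a a'))" (is "bistochastic ?E")
  have "\<phi> t = induced_rep ?E t" if "t \<in> T_X" for t
    by (rule clinear_on_T_X_eqI[OF \<phi> clinear_on_subset[OF clinear_on_induced_rep[OF E] T_X_subset_C_X] _ that])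
      (simp add: induced_rep_e_X[OF E])
  then show "\<exists>\<pi>. star_representation C_X \<pi> \<and> \<pi> cid = cid \<and> (\<forall>t\<in>T_X. \<phi> t = \<pi> t)"
    using star_representation_induced_rep[OF E] induced_rep_cid[OF E] by blast
next
  assume "\<exists>\<pi>. star_representation C_X \<pi> \<and> \<pi> cid = cid \<and> (\<forall>t\<in>T_X. \<phi> t = \<pi> t)"
  then obtain \<pi> where \<pi>: "star_representation C_X \<pi>" "\<pi> cid = cid" "\<And>t. t \<in> T_X \<Longrightarrow> \<phi> t = \<pi> t"
    by blast
  have "block_positive UNIV (\<lambda>i j. \<pi> (xa_matrix e_X i j))"
    by (rule star_representation_block_positive[OF unital_cstar_algebra_C_X \<pi>(1)])
      (auto simp: xa_matrix_def e_X_in_C_X block_positive_e_X[unfolded xa_matrix_def] split: prod.split)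
  moreover have "(\<lambda>i j. \<pi> (xa_matrix e_X i j)) = xa_matrix (\<lambda>x x' a a'. \<phi> (e_X x x' a a'))"
    by (simp add: xa_matrix_def fun_eq_iff \<pi>(3) e_X_in_T_X)
  ultimately show "bistochastic (\<lambda>x x' a a'. \<phi> (e_X x x' a a'))"
    using \<pi>(2) \<pi>(3)[OF cid_in_T_X] by (simp add: bistochastic_iff[OF \<phi>])
qed

lemma universal_cstar_cover_C_X:
  "universal_cstar_cover TYPE('k::chilbert_space)
    (T_X :: ('x::finite, 'c::infinite) univ_op set) (C_X :: ('x, 'c) univ_op set) (\<lambda>t. t)"
proof -
  have "adj t \<in> T_X" if "t \<in> T_X" for t :: "('x, 'c) univ_op"
    using that unfolding T_X_def
  proof (induction rule: complex_vector.span_induct_alt)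
    case base
    then show ?case by (simp add: complex_vector.span_zero)
  next
    case (step c e t)
    then obtain x x' a a' where "e = e_X x x' a a'" by auto
    then have "adj e = e_X x' x a' a" by (simp add: adj_e_X)
    then have "adj e \<in> {e_X x x' a a' | x x' a a'. True}" by blast
    then show ?case
      unfolding adj_linear
      by (intro complex_vector.span_add complex_vector.span_scale step(2)) (rule complex_vector.span_base)
  qed
  then have "operator_system (T_X :: ('x, 'c) univ_op set)"
    unfolding operator_system_def using csubspace_T_X cid_in_T_X by blast
  moreover have "complete_order_embedding (T_X :: ('x, 'c) univ_op set) (\<lambda>t. t)"
    by (simp add: complete_order_embedding_def clinear_on_def)
  moreover have "C_X = unital_cstar_algebra hull ((\<lambda>t. t) ` (T_X :: ('x, 'c) univ_op set))"
  proof (rule hull_unique[symmetric])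
    show "(\<lambda>t. t) ` T_X \<subseteq> C_X" using T_X_subset_C_X by simp
    show "C_X \<subseteq> D" if "(\<lambda>t. t) ` T_X \<subseteq> D" "unital_cstar_algebra D" for D :: "('x, 'c) univ_op set"
      by (rule C_X_minimal[OF that(2)], rule subsetD[OF _ e_X_in_T_X]) (use that(1) in simp)
  qed (rule unital_cstar_algebra_C_X)
  moreover have "\<exists>\<pi>. star_representation C_X \<pi> \<and> (\<forall>t\<in>T_X. \<pi> t = \<phi> t)" if "ucp_on T_X \<phi>"
    for \<phi> :: "('x, 'c) univ_op \<Rightarrow> ('k, 'k) cblinfun"
  proof -
    have "clinear_on T_X \<phi>" using that by (simp add: ucp_on_def cp_on_def)
    then show ?thesis
      using that ucp_on_iff_bistochastic bistochastic_iff_representation by metis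
  qed
  ultimately show ?thesis
    unfolding universal_cstar_cover_def using unital_cstar_algebra_C_X by blast
qed

lemma bistochastic_ucp_extension:
  fixes E :: "'x::finite \<Rightarrow> 'x \<Rightarrow> 'x \<Rightarrow> 'x \<Rightarrow> ('h::chilbert_space, 'h) cblinfun"
  assumes E: "bistochastic E"
  shows "\<exists>\<phi> :: ('x, 'c::infinite) univ_op \<Rightarrow> ('h, 'h) cblinfun.
    ucp_on T_X \<phi> \<and> (\<forall>x x' a a'. \<phi> (e_X x x' a a') = E x x' a a') \<and>
    (\<forall>\<psi>. ucp_on T_X \<psi> \<and> (\<forall>x x' a a'. \<psi> (e_X x x' a a') = E x x' a a') \<longrightarrow> (\<forall>t\<in>T_X. \<psi> t = \<phi> t))"
proof (intro exI[of _ "induced_rep E"] conjI allI impI ballI)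
  have lin: "clinear_on T_X (induced_rep E :: ('x, 'c) univ_op \<Rightarrow> _)"
    by (rule clinear_on_subset[OF clinear_on_induced_rep[OF E] T_X_subset_C_X])
  show "ucp_on T_X (induced_rep E :: ('x, 'c) univ_op \<Rightarrow> _)"
    unfolding ucp_on_iff_bistochastic[OF lin] induced_rep_e_X[OF E] by (rule E)
  show "induced_rep E (e_X x x' a a' :: ('x, 'c) univ_op) = E x x' a a'" for x x' a a'
    by (rule induced_rep_e_X[OF E])
  show "\<psi> t = induced_rep E t"
    if "ucp_on T_X \<psi> \<and> (\<forall>x x' a a'. \<psi> (e_X x x' a a') = E x x' a a')" "t \<in> T_X"
    for \<psi> and t :: "('x, 'c) univ_op"
  proof (rule clinear_on_T_X_eqI[OF _ lin _ that(2)])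
    show "clinear_on T_X \<psi>" using that(1) by (simp only: ucp_on_def cp_on_def)
    show "\<psi> (e_X x x' a a') = induced_rep E (e_X x x' a a')" for x x' a a'
      using that(1) by (simp only: induced_rep_e_X[OF E])
  qed
qed

theorem theorem3p4:
  shows "(\<forall>\<phi> :: ('x::finite, 'c::infinite) univ_op \<Rightarrow> ('h::chilbert_space, 'h) cblinfun.
      clinear_on T_X \<phi> \<longrightarrow>
        (ucp_on T_X \<phi> \<longleftrightarrow> bistochastic (\<lambda>x x' a a'. \<phi> (e_X x x' a a'))) \<and>
        (bistochastic (\<lambda>x x' a a'. \<phi> (e_X x x' a a')) \<longleftrightarrow>
          (\<exists>\<pi>. star_representation C_X \<pi> \<and> \<pi> cid = cid \<and> (\<forall>t\<in>T_X. \<phi> t = \<pi> t))) \<and>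
        (cp_on T_X \<phi> \<longleftrightarrow>
          block_positive UNIV (xa_matrix (\<lambda>x x' a a'. \<phi> (e_X x x' a a'))))) \<and>
    universal_cstar_cover TYPE('k::chilbert_space)
      (T_X :: ('x, 'c) univ_op set) (C_X :: ('x, 'c) univ_op set) (\<lambda>t. t) \<and>
    (\<forall>E :: 'x \<Rightarrow> 'x \<Rightarrow> 'x \<Rightarrow> 'x \<Rightarrow> ('h, 'h) cblinfun. bistochastic E \<longrightarrow>
      (\<exists>\<phi> :: ('x, 'c) univ_op \<Rightarrow> ('h, 'h) cblinfun.
        ucp_on T_X \<phi> \<and> (\<forall>x x' a a'. \<phi> (e_X x x' a a') = E x x' a a') \<and>
        (\<forall>\<psi>. ucp_on T_X \<psi> \<and> (\<forall>x x' a a'. \<psi> (e_X x x' a a') = E x x' a a') \<longrightarrow>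
          (\<forall>t\<in>T_X. \<psi> t = \<phi> t))))"
proof (intro conjI allI impI)
  fix \<phi> :: "('x, 'c) univ_op \<Rightarrow> ('h, 'h) cblinfun"
  assume \<phi>: "clinear_on T_X \<phi>"
  note ucp_on_iff_bistochastic[OF \<phi>] bistochastic_iff_representation[OF \<phi>] cp_on_iff_block_positive[OF \<phi>]
  then show "ucp_on T_X \<phi> \<longleftrightarrow> bistochastic (\<lambda>x x' a a'. \<phi> (e_X x x' a a'))"
    "bistochastic (\<lambda>x x' a a'. \<phi> (e_X x x' a a')) \<longleftrightarrow>
      (\<exists>\<pi>. star_representation C_X \<pi> \<and> \<pi> cid = cid \<and> (\<forall>t\<in>T_X. \<phi> t = \<pi> t))"
    "cp_on T_X \<phi> \<longleftrightarrow> block_positive UNIV (xa_matrix (\<lambda>x x' a a'. \<phi> (e_X x x' a a')))"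
    by blast+
next
  show "universal_cstar_cover TYPE('k) (T_X :: ('x, 'c) univ_op set) (C_X :: ('x, 'c) univ_op set) (\<lambda>t. t)"
    by (rule universal_cstar_cover_C_X)
qed (rule bistochastic_ucp_extension)

end
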